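(* Let $d\ge 2$ and let $p_t(x,\mathrm{d}\xi)$ be the transition kernel of a subcritical affine process on $\mathbb{S}_d^+$ with admissible parameters $(\alpha,b,B,m,\mu)$ satisfying $$\int_{\{\|\xi\|>1\}}\|\xi\|\,m(\mathrm{d}\xi)<\infty.$$ Let $\pi$ be the unique invariant distribution, and let $M\ge1$, $\delta>0$ be constants such that $\|\mathrm{e}^{t\widetilde{B}}\|\le M\mathrm{e}^{-\delta t}$ for all $t\ge0$. If $\alpha=0$, then $$W_1(p_t(x,\cdot),\pi)\le\sqrt{d}\,M\mathrm{e}^{-\delta t}\left(\|x\|+\int_{\mathbb{S}_d^+}\|y\|\,\pi(\mathrm{d}y)\right),\qquad t\ge0,\ x\in\mathbb{S}_d^+.$$
   Context: Let $\mathbb{S}_d$ be the space of real symmetric $d\times d$ matrices with $\langle x,y\rangle=\mathrm{tr}(xy)$ and Frobenius norm $\|x\|=\langle x,x\rangle^{1/2}$; $\mathbb{S}_d^+$ is the cone of positive semidefinite matrices; $x\preceq y$ means $y-x\in\mathbb{S}_d^+$. An $\mathbb{S}_d^+$-valued measure $\eta$ on $\mathbb{S}_d^+\setminus\{0\}$ is a $d\times d$ matrix of signed measures with $\eta(A)\in\mathbb{S}_d^+$ for every Borel $A$ with $0\notin\overline{A}$. Admissible parameters $(\alpha,b,B,m,\mu)$: (i) $\alpha\in\mathbb{S}_d^+$; (ii) $b\in\mathbb{S}_d^+$ with $b\succeq(d-1)\alpha$; (iii) $m$ is a Borel measure on $\mathbb{S}_d^+\setminus\{0\}$ with $\int(\|\xi\|\wedge1)\,m(\mathrm{d}\xi)<\infty$;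 (iv) $\mu$ is an $\mathbb{S}_d^+$-valued sigma-finite measure on $\mathbb{S}_d^+\setminus\{0\}$ with $\int\|\xi\|\,\mathrm{tr}(\mu)(\mathrm{d}\xi)<\infty$, where $\mathrm{tr}(\mu)(A):=\mathrm{tr}(\mu(A))$; (v) $B:\mathbb{S}_d\to\mathbb{S}_d$ is linear with $\langle B(x),u\rangle\ge0$ for all $x,u\in\mathbb{S}_d^+$ with $\langle x,u\rangle=0$. $B^\top$ denotes the adjoint of $B$ with respect to $\langle\cdot,\cdot\rangle$. For $u\in\mathbb{S}_d^+$ put $$F(u)=\langle b,u\rangle-\int_{\mathbb{S}_d^+\setminus\{0\}}(\mathrm{e}^{-\langle u,\xi\rangle}-1)\,m(\mathrm{d}\xi),\quad R(u)=-2u\alpha u+B^\top(u)-\int_{\mathbb{S}_d^+\setminus\{0\}}(\mathrm{e}^{-\langle u,\xi\rangle}-1)\,\mu(\mathrm{d}\xi).$$ Known result (Cuchiero et al.): for admissible parameters there is a unique stochastically continuous transition kernel $p_t(x,\mathrm{d}\xi)$ on $\mathbb{S}_d^+$ with $p_t(x,\mathbb{S}_d^+)=1$ and $$\int_{\mathbb{S}_d^+}\mathrm{e}^{-\langle u,\xi\rangle}p_t(x,\mathrm{d}\xi)=\exp(-\phi(t,u)-\langle\psi(t,u),x\rangle),\quad t\ge0,\ x,u\in\mathbb{S}_d^+,$$ where $\phi,\psi$ are the unique solutions ($\psi$ with values in $\mathbb{S}_d^+$) of $\partial_t\phi(t,u)=F(\psi(t,u))$, $\phi(0,u)=0$, and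 $\partial_t\psi(t,u)=R(\psi(t,u))$, $\psi(0,u)=u$. This is the transition kernel of the affine process with parameters $(\alpha,b,B,m,\mu)$. Effective drift: the linear map $\widetilde{B}:\mathbb{S}_d\to\mathbb{S}_d$, $\widetilde{B}(x)=B(x)+\int_{\mathbb{S}_d^+\setminus\{0\}}\xi\,\langle x,\mu(\mathrm{d}\xi)\rangle$, where $\langle x,\mu(\mathrm{d}\xi)\rangle=\sum_{i,j}x_{ij}\mu_{ij}(\mathrm{d}\xi)$. The process is called subcritical if every eigenvalue of $\widetilde{B}$ has strictly negative real part; then constants $M\ge1$, $\delta>0$ as in the claim exist ($\|\mathrm{e}^{t\widetilde B}\|$ is the operator norm on $(\mathbb{S}_d,\|\cdot\|)$). An invariant distribution is a Borel probability measure $\pi$ on $\mathbb{S}_d^+$ with $\int p_t(x,\mathrm{d}\xi)\pi(\mathrm{d}x)=\pi(\mathrm{d}\xi)$ for all $t\ge0$; under the hypotheses it exists, is unique, and has Laplace transform $\exp(-\int_0^\infty F(\psi(s,u))\,\mathrm{d}s)$, $u\in\mathbb{S}_d^+$. $\mathcal{P}_1(\mathbb{S}_d^+)$ is the set of Borel probability measures $\varrho$ on $\mathbb{S}_d^+$ with $\int\|x\|\varrho(\mathrm{d}x)<\infty$ (under the hypotheses $p_t(x,\cdot)$ and $\pi$ belong to it). For $\varrho,\widetilde\varrho\in\mathcal{P}_1(\mathbb{S}_d^+)$, $W_1(\varrho,\widetilde\varrho)=\inf_H\int\|x-y\|\,H(\mathrm{d}x,\mathrm{d}y)$, the infimum being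 over all Borel probability measures $H$ on $\mathbb{S}_d^+\times\mathbb{S}_d^+$ with marginals $\varrho$ and $\widetilde\varrho$. *)

theory Defs
  imports "HOL-Analysis.Analysis" "HOL-Probability.Probability"
begin

typedef ('d::finite) sym_matrix = "{A :: real^'d^'d. transpose A = A}"
  morphisms mat_of sym_of
  by (rule exI[of _ 0]) (simp add: transpose_def vec_eq_iff)

setup_lifting type_definition_sym_matrix

lemma transpose_mat_of [simp]: "transpose (mat_of x) = mat_of x"
  using mat_of by blast

lemma mat_of_sym: "mat_of x $ i $ j = mat_of x $ j $ i"
proof -
  have "mat_of x $ i $ j = transpose (mat_of x) $ j $ i"
    unfolding transpose_def by simp
  then show ?thesis
    by simp
qed

instantiation sym_matrix :: (finite) real_vector
begin

lift_definition zero_sym_matrix :: "'a sym_matrix" is 0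
  by (simp add: transpose_def vec_eq_iff)
lift_definition plus_sym_matrix :: "'a sym_matrix \<Rightarrow> 'a sym_matrix \<Rightarrow> 'a sym_matrix" is "(+)"
  by (simp add: transpose_def vec_eq_iff)
lift_definition minus_sym_matrix :: "'a sym_matrix \<Rightarrow> 'a sym_matrix \<Rightarrow> 'a sym_matrix" is "(-)"
  by (simp add: transpose_def vec_eq_iff)
lift_definition uminus_sym_matrix :: "'a sym_matrix \<Rightarrow> 'a sym_matrix" is uminus
  by (simp add: transpose_def vec_eq_iff)
lift_definition scaleR_sym_matrix :: "real \<Rightarrow> 'a sym_matrix \<Rightarrow> 'a sym_matrix" is scaleR
  by (simp add: transpose_def vec_eq_iff)

instance
  by (standard; transfer; simp add: algebra_simps)

end

lemma trace_mat_of_mult: "trace (mat_of x ** mat_of y) = mat_of x \<bullet> mat_of y"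
  unfolding trace_def matrix_matrix_mult_def inner_vec_def
  by (simp add: mat_of_sym[of y])

instantiation sym_matrix :: (finite) real_normed_vector
begin

definition norm_sym_matrix :: "'a sym_matrix \<Rightarrow> real" where
  "norm_sym_matrix x = sqrt (trace (mat_of x ** mat_of x))"
definition dist_sym_matrix :: "'a sym_matrix \<Rightarrow> 'a sym_matrix \<Rightarrow> real" where
  "dist_sym_matrix x y = norm (x - y)"
definition sgn_sym_matrix :: "'a sym_matrix \<Rightarrow> 'a sym_matrix" where
  "sgn_sym_matrix x = x /\<^sub>R norm x"
definition uniformity_sym_matrix :: "('a sym_matrix \<times> 'a sym_matrix) filter" where
  "uniformity_sym_matrix = (INF e\<in>{0<..}. principal {(x, y). dist x y < e})"
definition open_sym_matrix :: "'a sym_matrix set \<Rightarrow> bool" where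
  "open_sym_matrix U \<longleftrightarrow> (\<forall>x\<in>U. eventually (\<lambda>(x', y). x' = x \<longrightarrow> y \<in> U) uniformity)"

lemma norm_sym_matrix_eq: "norm x = norm (mat_of x)"
  by (simp add: norm_sym_matrix_def trace_mat_of_mult norm_eq_sqrt_inner)

instance
proof
  fix x y :: "'a sym_matrix" and r :: real
  show "norm x = 0 \<longleftrightarrow> x = 0"
    by (simp add: norm_sym_matrix_eq zero_sym_matrix.rep_eq flip: mat_of_inject)
  show "norm (x + y) \<le> norm x + norm y"
    by (simp add: norm_sym_matrix_eq plus_sym_matrix.rep_eq norm_triangle_ineq)
  show "norm (r *\<^sub>R x) = \<bar>r\<bar> * norm x"
    by (simp add: norm_sym_matrix_eq scaleR_sym_matrix.rep_eq)
qed (simp_all add: dist_sym_matrix_def sgn_sym_matrix_def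
    uniformity_sym_matrix_def open_sym_matrix_def)

end

instantiation sym_matrix :: (finite) real_inner
begin

definition inner_sym_matrix :: "'a sym_matrix \<Rightarrow> 'a sym_matrix \<Rightarrow> real" where
  "inner_sym_matrix x y = trace (mat_of x ** mat_of y)"

lemma inner_sym_matrix_eq: "inner x y = inner (mat_of x) (mat_of y)"
  by (simp add: inner_sym_matrix_def trace_mat_of_mult)

instance
proof
  fix x y z :: "'a sym_matrix" and r :: real
  show "inner x y = inner y x"
    by (simp add: inner_sym_matrix_eq inner_commute)
  show "inner (x + y) z = inner x z + inner y z"
    by (simp add: inner_sym_matrix_eq plus_sym_matrix.rep_eq inner_add_left)
  show "inner (r *\<^sub>R x) y = r * inner x y"
    by (simp add: inner_sym_matrix_eq scaleR_sym_matrix.rep_eq)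
  show "0 \<le> inner x x"
    by (simp add: inner_sym_matrix_eq)
  show "inner x x = 0 \<longleftrightarrow> x = 0"
    by (simp add: inner_sym_matrix_eq zero_sym_matrix.rep_eq flip: mat_of_inject)
  show "norm x = sqrt (inner x x)"
    by (simp add: norm_sym_matrix_def inner_sym_matrix_def)
qed

end

lemma subspace_symmetric: "subspace {A :: real^'d^'d. transpose A = A}"
  by (simp add: subspace_def transpose_def vec_eq_iff)

lemma ex_orthonormal_sym_basis:
  "\<exists>B. B \<subseteq> {A :: real^'d^'d. transpose A = A} \<and> finite B \<and>
     (\<forall>u\<in>B. \<forall>v\<in>B. u \<bullet> v = (if u = v then 1 else 0)) \<and>
     span B = {A. transpose A = A}"
proof -
  let ?S = "{A :: real^'d^'d. transpose A = A}"
  obtain B where B: "B \<subseteq> ?S" "pairwise orthogonal B" "\<And>x. x \<in> B \<Longrightarrow> norm x = 1"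
    "independent B" "span B = ?S"
    by (rule orthonormal_basis_subspace[OF subspace_symmetric]) blast
  have "u \<bullet> v = (if u = v then 1 else 0)" if "u \<in> B" "v \<in> B" for u v
    using B(2,3) that by (auto simp: pairwise_def orthogonal_def norm_eq_1)
  with B show ?thesis
    by (intro exI[of _ B]) (auto simp: independent_imp_finite)
qed

instantiation sym_matrix :: (finite) euclidean_space
begin

definition Basis_sym_matrix :: "'a sym_matrix set" where
  "Basis = sym_of ` (SOME B. B \<subseteq> {A :: real^'a^'a. transpose A = A} \<and> finite B \<and>
     (\<forall>u\<in>B. \<forall>v\<in>B. u \<bullet> v = (if u = v then 1 else 0)) \<and>
     span B = {A. transpose A = A})"

lemma Basis_sym_matrix:
  "finite (Basis :: 'a sym_matrix set)"
  "(Basis :: 'a sym_matrix set) \<noteq> {}"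
  "u \<in> Basis \<Longrightarrow> v \<in> Basis \<Longrightarrow> u \<bullet> v = (if u = v then 1 else 0)"
  "(\<forall>u\<in>Basis. x \<bullet> u = 0) \<longleftrightarrow> x = 0" for u v x :: "'a sym_matrix"
proof -
  obtain B :: "(real^'a^'a) set" where B: "Basis = sym_of ` B"
    "B \<subseteq> {A. transpose A = A}" "finite B"
    "\<And>u v. u \<in> B \<Longrightarrow> v \<in> B \<Longrightarrow> u \<bullet> v = (if u = v then 1 else 0)"
    "span B = {A. transpose A = A}"
    using someI_ex[OF ex_orthonormal_sym_basis, where 'd1 = 'a] Basis_sym_matrix_def by blast
  have rep: "mat_of (sym_of A) = A" if "A \<in> B" for A
    using that B(2) by (auto intro: sym_of_inverse)
  have zero: "x = 0" if "\<forall>u\<in>Basis. x \<bullet> u = 0" for x :: "'a sym_matrix"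
  proof -
    have "orthogonal (mat_of x) A" if "A \<in> B" for A
      using \<open>\<forall>u\<in>Basis. x \<bullet> u = 0\<close> that rep[OF that]
      by (auto simp: B(1) inner_sym_matrix_eq orthogonal_def)
    moreover have "mat_of x \<in> span B"
      by (simp add: B(5))
    ultimately have "orthogonal (mat_of x) (mat_of x)"
      using orthogonal_to_span by blast
    then have "x \<bullet> x = 0"
      by (simp add: orthogonal_def inner_sym_matrix_eq)
    then show ?thesis
      by simp
  qed
  have nz: "sym_of (mat 1) \<noteq> (0 :: 'a sym_matrix)"
  proof
    assume "sym_of (mat 1) = (0 :: 'a sym_matrix)"
    then have "mat 1 = (0 :: real^'a^'a)"
      by (metis (mono_tags) mem_Collect_eq sym_of_inverse transpose_mat zero_sym_matrix.rep_eq)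
    then have "(mat 1 :: real^'a^'a) $ i $ i = 0" for i
      by simp
    then show False
      by (simp add: mat_def)
  qed
  show "finite (Basis :: 'a sym_matrix set)"
    by (simp add: B(1,3))
  show "(Basis :: 'a sym_matrix set) \<noteq> {}"
    using zero[of "sym_of (mat 1)"] nz by auto
  show "u \<in> Basis \<Longrightarrow> v \<in> Basis \<Longrightarrow> u \<bullet> v = (if u = v then 1 else 0)"
    using B(4) rep by (auto simp: B(1) inner_sym_matrix_eq)
  show "(\<forall>u\<in>Basis. x \<bullet> u = 0) \<longleftrightarrow> x = 0"
    using zero by auto
qed

instance
  by standard (use Basis_sym_matrix in auto)

end

definition psd :: "('d::finite) sym_matrix set" where
  "psd = {x. \<forall>v. 0 \<le> v \<bullet> (mat_of x *v v)}"

definition loewner_le :: "('d::finite) sym_matrix \<Rightarrow> 'd sym_matrix \<Rightarrow> bool" (infix \<open>\<preceq>\<close> 50) where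
  "x \<preceq> y \<longleftrightarrow> y - x \<in> psd"

lift_definition sandwich :: "('d::finite) sym_matrix \<Rightarrow> 'd sym_matrix \<Rightarrow> 'd sym_matrix"
  is "\<lambda>u a. u ** a ** u"
  by (simp add: matrix_transpose_mul matrix_mul_assoc)

abbreviation psd_space :: "('d::finite) sym_matrix measure" where
  "psd_space \<equiv> restrict_space borel psd"

abbreviation jump_space :: "('d::finite) sym_matrix measure" where
  "jump_space \<equiv> restrict_space borel (psd - {0})"

text \<open>
  A positive-semidefinite-valued measure is finite only on Borel sets whose closure avoids the
  origin, and its off-diagonal entries need not have any meaning on other sets. It is therefore a
  set function whose values matter on these sets only, and it is countably additive there.
\<close>

definition bounded_away :: "('d::finite) sym_matrix set set" where
  "bounded_away = {A \<in> sets jump_space. 0 \<notin> closure A}"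

definition psd_measure :: "(('d::finite) sym_matrix set \<Rightarrow> 'd sym_matrix) \<Rightarrow> bool" where
  "psd_measure \<mu> \<longleftrightarrow>
     (\<forall>A\<in>bounded_away. \<mu> A \<in> psd) \<and>
     (\<forall>A. range A \<subseteq> bounded_away \<longrightarrow> disjoint_family A \<longrightarrow> (\<Union>n::nat. A n) \<in> bounded_away
        \<longrightarrow> (\<lambda>n. \<mu> (A n)) sums \<mu> (\<Union>n. A n))"

text \<open>
  Integration against a signed measure \<open>\<nu>\<close>, given by its values on the sets bounded away from
  the origin: write \<open>\<nu>\<close> as a difference of two measures \<open>P\<close> and \<open>N\<close> that are finite on these sets
  and integrate against both. An integrand that is integrable for some such pair is integrable for
  the Jordan decomposition, and the value does not depend on the pair; see
  \<open>signed_integral_eqI\<close> below.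
\<close>

definition signed_decomposition ::
  "(('d::finite) sym_matrix set \<Rightarrow> real) \<Rightarrow> 'd sym_matrix measure \<Rightarrow> 'd sym_matrix measure \<Rightarrow> bool"
where
  "signed_decomposition \<nu> P N \<longleftrightarrow>
     sets P = sets jump_space \<and> sets N = sets jump_space \<and>
     (\<forall>A\<in>bounded_away. emeasure P A < \<infinity> \<and> emeasure N A < \<infinity> \<and> \<nu> A = measure P A - measure N A)"

definition has_signed_integral ::
  "(('d::finite) sym_matrix set \<Rightarrow> real) \<Rightarrow> ('d sym_matrix \<Rightarrow> 'b::{banach, second_countable_topology})
     \<Rightarrow> 'b \<Rightarrow> bool"
where
  "has_signed_integral \<nu> f I \<longleftrightarrow>
     (\<exists>P N. signed_decomposition \<nu> P N \<and> integrable P f \<and> integrable N f \<and>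
        I = (\<integral>\<xi>. f \<xi> \<partial>P) - (\<integral>\<xi>. f \<xi> \<partial>N))"

definition signed_integrable ::
  "(('d::finite) sym_matrix set \<Rightarrow> real) \<Rightarrow> ('d sym_matrix \<Rightarrow> 'b::{banach, second_countable_topology})
     \<Rightarrow> bool"
where
  "signed_integrable \<nu> f \<longleftrightarrow> (\<exists>I. has_signed_integral \<nu> f I)"

definition signed_integral ::
  "(('d::finite) sym_matrix set \<Rightarrow> real) \<Rightarrow> ('d sym_matrix \<Rightarrow> 'b::{banach, second_countable_topology})
     \<Rightarrow> 'b"
where
  "signed_integral \<nu> f = (THE I. has_signed_integral \<nu> f I)"

definition sum_measure :: "'a measure \<Rightarrow> 'a measure \<Rightarrow> 'a measure" where
  "sum_measure P Q = measure_of (space P) (sets P) (\<lambda>A. emeasure P A + emeasure Q A)"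

lemma sets_sum_measure [simp, measurable_cong]: "sets (sum_measure P Q) = sets P"
  by (simp add: sum_measure_def)

lemma space_sum_measure [simp]: "space (sum_measure P Q) = space P"
  by (simp add: sum_measure_def)

lemma emeasure_sum_measure:
  assumes "sets Q = sets P"
  shows "emeasure (sum_measure P Q) A = emeasure P A + emeasure Q A"
proof (cases "A \<in> sets P")
  case True
  show ?thesis
  proof (rule emeasure_measure_of[OF sum_measure_def])
    show "sets P \<subseteq> Pow (space P)"
      by (rule sets.space_closed)
    show "positive (sets (sum_measure P Q)) (\<lambda>A. emeasure P A + emeasure Q A)"
      by (simp add: positive_def)
    show "countably_additive (sets (sum_measure P Q)) (\<lambda>A. emeasure P A + emeasure Q A)"
    proof (rule countably_additiveI)
      fix A :: "nat \<Rightarrow> 'a set"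
      assume A: "range A \<subseteq> sets (sum_measure P Q)" "disjoint_family A"
      have "(\<Sum>i. emeasure P (A i) + emeasure Q (A i))
          = (\<Sum>i. emeasure P (A i)) + (\<Sum>i. emeasure Q (A i))"
        by (rule suminf_add[symmetric]) auto
      also have "\<dots> = emeasure P (\<Union>i. A i) + emeasure Q (\<Union>i. A i)"
        using A assms by (simp add: suminf_emeasure)
      finally show "(\<Sum>i. emeasure P (A i) + emeasure Q (A i))
          = emeasure P (\<Union>i. A i) + emeasure Q (\<Union>i. A i)" .
    qed
    show "A \<in> sets (sum_measure P Q)"
      using True by simp
  qed
next
  case False
  then show ?thesis
    using assms by (simp add: emeasure_notin_sets)
qed

lemma nn_integral_sum_measure:
  assumes Q: "sets Q = sets P" and f: "f \<in> borel_measurable P"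
  shows "(\<integral>\<^sup>+x. f x \<partial>sum_measure P Q) = (\<integral>\<^sup>+x. f x \<partial>P) + (\<integral>\<^sup>+x. f x \<partial>Q)"
  using f
proof (induction rule: borel_measurable_induct)
  case (cong f g)
  then show ?case
    using sets_eq_imp_space_eq[OF Q]
    by (simp cong: nn_integral_cong_simp)
next
  case (set A)
  then show ?case
    by (simp add: Q emeasure_sum_measure)
next
  case (mult u c)
  then show ?case
    by (simp add: nn_integral_cmult measurable_cong_sets[OF Q refl] 
        measurable_cong_sets[OF sets_sum_measure refl] distrib_left)
next
  case (add u v)
  then show ?case
    by (simp add: nn_integral_add measurable_cong_sets[OF Q refl]
        measurable_cong_sets[OF sets_sum_measure refl] algebra_simps)
next
  case (seq U)
  have *: "U i \<in> borel_measurable Q" "U i \<in> borel_measurable (sum_measure P Q)" for i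
    using seq(1) by (simp_all add: measurable_cong_sets[OF Q refl]
        measurable_cong_sets[OF sets_sum_measure refl])
  have mono: "incseq (\<lambda>i. integral\<^sup>N M (U i))" for M
    using \<open>incseq U\<close> by (auto simp: mono_def le_fun_def intro!: nn_integral_mono)
  have "(\<integral>\<^sup>+x. (SUP i. U i) x \<partial>sum_measure P Q) = (SUP i. integral\<^sup>N (sum_measure P Q) (U i))"
    using \<open>incseq U\<close> * by (simp add: nn_integral_monotone_convergence_SUP image_comp)
  also have "\<dots> = (SUP i. integral\<^sup>N P (U i) + integral\<^sup>N Q (U i))"
    using seq by simp
  also have "\<dots> = (SUP i. integral\<^sup>N P (U i)) + (SUP i. integral\<^sup>N Q (U i))"
    by (rule ennreal_SUP_add[OF mono mono])
  also have "\<dots> = (\<integral>\<^sup>+x. (SUP i. U i) x \<partial>P) + (\<integral>\<^sup>+x. (SUP i. U i) x \<partial>Q)"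
    using seq(1) \<open>incseq U\<close> * by (simp add: nn_integral_monotone_convergence_SUP image_comp)
  finally show ?case .
qed

lemma integral_sum_measure:
  fixes f :: "'a \<Rightarrow> 'b::{banach, second_countable_topology}"
  assumes Q: "sets Q = sets P" and f: "integrable P f" "integrable Q f"
  shows "integrable (sum_measure P Q) f \<and> integral\<^sup>L (sum_measure P Q) f = integral\<^sup>L P f + integral\<^sup>L Q f"
proof -
  let ?S = "sum_measure P Q"
  have meas: "g \<in> borel_measurable ?S \<longleftrightarrow> g \<in> borel_measurable P"
    "g \<in> borel_measurable Q \<longleftrightarrow> g \<in> borel_measurable P" for g :: "'a \<Rightarrow> 'c::topological_space"
    by (simp_all add: measurable_cong_sets[OF Q refl] measurable_cong_sets[OF sets_sum_measure refl])
  have iff: "integrable ?S g \<longleftrightarrow> integrable P g \<and> integrable Q g" for g :: "'a \<Rightarrow> 'b"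
    by (auto simp: integrable_iff_bounded meas nn_integral_sum_measure[OF Q])
  have S: "integrable ?S f"
    using f iff by blast
  have "integral\<^sup>L ?S f = integral\<^sup>L P f + integral\<^sup>L Q f"
    using S
  proof (induction rule: integrable_induct)
    case (base A c)
    then have A: "A \<in> sets P" "A \<in> sets Q" "emeasure P A < \<infinity>" "emeasure Q A < \<infinity>"
      by (auto simp: emeasure_sum_measure[OF Q] Q)
    then have "measure ?S A = measure P A + measure Q A"
      by (simp add: measure_def emeasure_sum_measure[OF Q] enn2real_plus less_top)
    with A base show ?case
      by (simp add: scaleR_left_distrib)
  next
    case (add g h)
    then show ?case
      by (simp add: iff)
  next
    case (lim g s)
    have *: "(\<lambda>i. integral\<^sup>L M (s i)) \<longlonglongrightarrow> integral\<^sup>L M g"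
      if "integrable M g" "space M = space P" "\<And>i. s i \<in> borel_measurable M" for M
    proof (rule integral_dominated_convergence[where w = "\<lambda>x. 2 * norm (g x)"])
      show "g \<in> borel_measurable M" "\<And>i. s i \<in> borel_measurable M"
        "integrable M (\<lambda>x. 2 * norm (g x))"
        using that by auto
      show "AE x in M. (\<lambda>i. s i x) \<longlonglongrightarrow> g x" "\<And>i. AE x in M. norm (s i x) \<le> 2 * norm (g x)"
        using lim(2,3) that by auto
    qed
    have sm: "s i \<in> borel_measurable P" for i
      using lim(1)[of i] iff by auto
    have "(\<lambda>i. integral\<^sup>L ?S (s i)) \<longlonglongrightarrow> integral\<^sup>L ?S g"
      using lim(4) sm by (intro *) (auto simp: meas)
    moreover have "(\<lambda>i. integral\<^sup>L ?S (s i)) \<longlonglongrightarrow> integral\<^sup>L P g + integral\<^sup>L Q g"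
      unfolding lim.IH using lim(4) sm sets_eq_imp_space_eq[OF Q]
      by (intro tendsto_add *) (auto simp: meas iff)
    ultimately show ?case
      by (rule LIMSEQ_unique)
  qed
  with S show ?thesis
    by blast
qed

lemma psd_measurable [measurable]: "(psd :: 'd::finite sym_matrix set) \<in> sets borel"
proof -
  have "closed {x. 0 \<le> v \<bullet> (mat_of x *v v)}" for v :: "real^'d"
  proof -
    have "linear (\<lambda>x :: 'd sym_matrix. v \<bullet> (mat_of x *v v))"
      by (rule linearI)
        (simp_all add: plus_sym_matrix.rep_eq scaleR_sym_matrix.rep_eq
          matrix_vector_mult_add_rdistrib inner_add_right scaleR_matrix_vector_assoc[symmetric])
    then show ?thesis
      by (intro closed_Collect_le continuous_intros linear_continuous_on)
        (simp add: linear_conv_bounded_linear)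
  qed
  moreover have "psd = (\<Inter>v. {x :: 'd sym_matrix. 0 \<le> v \<bullet> (mat_of x *v v)})"
    by (auto simp: psd_def)
  ultimately have "closed (psd :: 'd sym_matrix set)"
    by (metis (no_types, lifting) closed_INT)
  then show ?thesis
    by simp
qed

lemma sets_jump_space: "A \<in> sets jump_space \<longleftrightarrow> A \<in> sets borel \<and> A \<subseteq> psd - {0}"
  by (subst sets_restrict_space_iff) auto

lemma bounded_away_shell:
  "psd - ball 0 (inverse (real (Suc n))) \<in> (bounded_away :: 'd::finite sym_matrix set set)"
proof -
  have "closure (psd - ball 0 (inverse (real (Suc n)))) \<subseteq> - ball (0 :: 'd sym_matrix) (inverse (real (Suc n)))"
    by (rule closure_minimal) auto
  then show ?thesis
    by (auto simp: bounded_away_def sets_jump_space)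
qed

lemma measure_eqI_bounded_away:
  fixes P Q :: "'d::finite sym_matrix measure"
  assumes sets: "sets P = sets jump_space" "sets Q = sets jump_space"
    and eq: "\<And>A. A \<in> bounded_away \<Longrightarrow> emeasure P A = emeasure Q A"
    and fin: "\<And>A. A \<in> bounded_away \<Longrightarrow> emeasure P A \<noteq> \<infinity>"
  shows "P = Q"
proof (rule measure_eqI_generator_eq[where E = bounded_away and \<Omega> = "psd - {0}"
      and A = "\<lambda>n. psd - ball 0 (inverse (real (Suc n)))"])
  have mono: "B \<in> bounded_away" if "A \<in> bounded_away" "B \<subseteq> A" "B \<in> sets jump_space"
    for A B :: "'d sym_matrix set"
    using that closure_mono[of B A] by (auto simp: bounded_away_def)
  show "Int_stable (bounded_away :: 'd sym_matrix set set)"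
    by (rule Int_stableI, rule mono) (auto simp: bounded_away_def)
  show "bounded_away \<subseteq> Pow (psd - {0} :: 'd sym_matrix set)"
    by (auto simp: bounded_away_def sets_jump_space)
  show "range (\<lambda>n. psd - ball 0 (inverse (real (Suc n)))) \<subseteq> bounded_away"
    using bounded_away_shell by blast
  show un: "(\<Union>n. psd - ball 0 (inverse (real (Suc n)))) = (psd - {0} :: 'd sym_matrix set)"
  proof (intro equalityI subsetI)
    fix x :: "'d sym_matrix"
    assume x: "x \<in> psd - {0}"
    then obtain n where "inverse (real (Suc n)) < norm x"
      using reals_Archimedean[of "norm x"] by auto
    with x show "x \<in> (\<Union>n. psd - ball 0 (inverse (real (Suc n))))"
      by (auto intro!: exI[of _ n])
  qed auto
  have "sigma_sets (psd - {0}) bounded_away = sets (jump_space :: 'd sym_matrix measure)"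
  proof
    show "sigma_sets (psd - {0}) bounded_away \<subseteq> sets (jump_space :: 'd sym_matrix measure)"
      by (rule sets.sigma_sets_subset'[of _ jump_space, simplified])
        (auto simp: bounded_away_def sets_jump_space)
    show "sets (jump_space :: 'd sym_matrix measure) \<subseteq> sigma_sets (psd - {0}) bounded_away"
    proof
      fix A :: "'d sym_matrix set"
      assume A: "A \<in> sets jump_space"
      have "A = (\<Union>n. A \<inter> (psd - ball 0 (inverse (real (Suc n)))))"
        using A un by (auto simp: sets_jump_space)
      moreover have "A \<inter> (psd - ball 0 (inverse (real (Suc n)))) \<in> sigma_sets (psd - {0}) bounded_away" for n
      proof (rule sigma_sets.Basic, rule mono)
        show "psd - ball 0 (inverse (real (Suc n))) \<in> (bounded_away :: 'd sym_matrix set set)"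
          by (rule bounded_away_shell)
        then have "psd - ball 0 (inverse (real (Suc n))) \<in> sets (jump_space :: 'd sym_matrix measure)"
          by (simp add: bounded_away_def)
        with A show "A \<inter> (psd - ball 0 (inverse (real (Suc n)))) \<in> sets jump_space"
          by (rule sets.Int)
      qed (rule Int_lower2)
      ultimately show "A \<in> sigma_sets (psd - {0}) bounded_away"
        using sigma_sets.Union[of "\<lambda>n. A \<inter> (psd - ball 0 (inverse (real (Suc n))))"] by simp
    qed
  qed
  then show "sets P = sigma_sets (psd - {0}) bounded_away" "sets Q = sigma_sets (psd - {0}) bounded_away"
    using sets by simp_all
  show "emeasure P (psd - ball 0 (inverse (real (Suc n)))) \<noteq> \<infinity>" for n
    by (rule fin[OF bounded_away_shell])
qed (rule eq)

lemma signed_integral_eqI: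
  assumes "has_signed_integral \<nu> f I"
  shows "signed_integral \<nu> f = I"
  unfolding signed_integral_def
proof (rule the_equality)
  show "has_signed_integral \<nu> f I"
    by fact
  fix J
  assume "has_signed_integral \<nu> f J"
  then obtain P' N' where 1: "signed_decomposition \<nu> P' N'" "integrable P' f" "integrable N' f"
    "J = integral\<^sup>L P' f - integral\<^sup>L N' f"
    by (auto simp: has_signed_integral_def)
  obtain P N where 2: "signed_decomposition \<nu> P N" "integrable P f" "integrable N f"
    "I = integral\<^sup>L P f - integral\<^sup>L N f"
    using assms by (auto simp: has_signed_integral_def)
  have sets: "sets P' = sets jump_space" "sets N' = sets jump_space"
    "sets P = sets jump_space" "sets N = sets jump_space"
    using 1(1) 2(1) by (auto simp: signed_decomposition_def)
  have "sum_measure P' N = sum_measure P N'"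
  proof (rule measure_eqI_bounded_away)
    fix A :: "'a sym_matrix set"
    assume A: "A \<in> bounded_away"
    then have fin: "emeasure P' A = ennreal (measure P' A)" "emeasure N' A = ennreal (measure N' A)"
      "emeasure P A = ennreal (measure P A)" "emeasure N A = ennreal (measure N A)"
      and "measure P' A - measure N' A = measure P A - measure N A"
      using 1(1) 2(1) by (auto simp: signed_decomposition_def emeasure_eq_ennreal_measure less_top)
    then have "measure P' A + measure N A = measure P A + measure N' A"
      by simp
    then show "emeasure (sum_measure P' N) A = emeasure (sum_measure P N') A"
      by (simp add: emeasure_sum_measure sets fin flip: ennreal_plus)
    show "emeasure (sum_measure P' N) A \<noteq> \<infinity>"
      by (simp add: emeasure_sum_measure sets fin flip: ennreal_plus)
  qed (simp_all add: sets)
  moreover have "integral\<^sup>L (sum_measure P' N) f = integral\<^sup>L P' f + integral\<^sup>L N f"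
    "integral\<^sup>L (sum_measure P N') f = integral\<^sup>L P f + integral\<^sup>L N' f"
    using integral_sum_measure[of N P' f] integral_sum_measure[of N' P f] 1 2 sets by auto
  ultimately have "integral\<^sup>L P' f = integral\<^sup>L P f + integral\<^sup>L N' f - integral\<^sup>L N f"
    by (simp add: eq_diff_eq)
  then show "J = I"
    using 1(4) 2(4) by simp
qed

definition matrix_integral ::
  "(('d::finite) sym_matrix set \<Rightarrow> 'd sym_matrix) \<Rightarrow> ('d sym_matrix \<Rightarrow> real) \<Rightarrow> 'd sym_matrix"
where
  "matrix_integral \<mu> f = sym_of (\<chi> i j. signed_integral (\<lambda>A. mat_of (\<mu> A) $ i $ j) f)"

text \<open>
  The first moment condition on \<open>\<mu>\<close> below is integrability of the norm against the trace measure;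
  sigma-finiteness of \<open>\<mu>\<close> is implied by its finiteness on sets bounded away from the origin.
\<close>

definition admissible ::
  "('d::finite) sym_matrix \<Rightarrow> 'd sym_matrix \<Rightarrow> ('d sym_matrix \<Rightarrow> 'd sym_matrix)
     \<Rightarrow> 'd sym_matrix measure \<Rightarrow> ('d sym_matrix set \<Rightarrow> 'd sym_matrix) \<Rightarrow> bool"
where
  "admissible \<alpha> b B m \<mu> \<longleftrightarrow>
     \<alpha> \<in> psd \<and>
     b \<in> psd \<and> (real CARD('d) - 1) *\<^sub>R \<alpha> \<preceq> b \<and>
     sets m = sets jump_space \<and> (\<integral>\<^sup>+\<xi>. ennreal (min (norm \<xi>) 1) \<partial>m) < \<infinity> \<and>
     psd_measure \<mu> \<and> signed_integrable (\<lambda>A. trace (mat_of (\<mu> A))) norm \<and>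
     linear B \<and> (\<forall>x\<in>psd. \<forall>u\<in>psd. x \<bullet> u = 0 \<longrightarrow> 0 \<le> B x \<bullet> u)"

definition drift_F ::
  "('d::finite) sym_matrix \<Rightarrow> 'd sym_matrix measure \<Rightarrow> 'd sym_matrix \<Rightarrow> real"
where
  "drift_F b m u = b \<bullet> u - (\<integral>\<xi>. (exp (- (u \<bullet> \<xi>)) - 1) \<partial>m)"

definition drift_R ::
  "('d::finite) sym_matrix \<Rightarrow> ('d sym_matrix \<Rightarrow> 'd sym_matrix) \<Rightarrow> ('d sym_matrix set \<Rightarrow> 'd sym_matrix)
     \<Rightarrow> 'd sym_matrix \<Rightarrow> 'd sym_matrix"
where
  "drift_R \<alpha> B \<mu> u =
     - 2 *\<^sub>R sandwich u \<alpha> + adjoint B u - matrix_integral \<mu> (\<lambda>\<xi>. exp (- (u \<bullet> \<xi>)) - 1)"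

definition riccati_solution ::
  "('d::finite) sym_matrix \<Rightarrow> 'd sym_matrix \<Rightarrow> ('d sym_matrix \<Rightarrow> 'd sym_matrix)
     \<Rightarrow> 'd sym_matrix measure \<Rightarrow> ('d sym_matrix set \<Rightarrow> 'd sym_matrix)
     \<Rightarrow> (real \<Rightarrow> 'd sym_matrix \<Rightarrow> real) \<Rightarrow> (real \<Rightarrow> 'd sym_matrix \<Rightarrow> 'd sym_matrix) \<Rightarrow> bool"
where
  "riccati_solution \<alpha> b B m \<mu> \<phi> \<psi> \<longleftrightarrow>
     (\<forall>u\<in>psd. \<phi> 0 u = 0 \<and> \<psi> 0 u = u \<and>
        (\<forall>t\<ge>0. \<psi> t u \<in> psd \<and>
           ((\<lambda>s. \<phi> s u) has_real_derivative drift_F b m (\<psi> t u)) (at t within {0..}) \<and>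
           ((\<lambda>s. \<psi> s u) has_vector_derivative drift_R \<alpha> B \<mu> (\<psi> t u)) (at t within {0..})))"

definition transition_semigroup ::
  "(real \<Rightarrow> ('d::finite) sym_matrix \<Rightarrow> 'd sym_matrix measure) \<Rightarrow> bool"
where
  "transition_semigroup p \<longleftrightarrow>
     (\<forall>t\<ge>0. p t \<in> psd_space \<rightarrow>\<^sub>M prob_algebra psd_space) \<and>
     (\<forall>x\<in>psd. p 0 x = return psd_space x) \<and>
     (\<forall>s\<ge>0. \<forall>t\<ge>0. \<forall>x\<in>psd. p (s + t) x = p s x \<bind> p t)"

definition stochastically_continuous ::
  "(real \<Rightarrow> ('d::finite) sym_matrix \<Rightarrow> 'd sym_matrix measure) \<Rightarrow> bool"
where
  "stochastically_continuous p \<longleftrightarrow>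
     (\<forall>t\<ge>0. \<forall>x\<in>psd. \<forall>f :: 'd sym_matrix \<Rightarrow> real. continuous_on psd f \<and> bounded (f ` psd) \<longrightarrow>
        ((\<lambda>s. \<integral>\<xi>. f \<xi> \<partial>p s x) \<longlongrightarrow> (\<integral>\<xi>. f \<xi> \<partial>p t x)) (at t within {0..}))"

definition affine_kernel ::
  "('d::finite) sym_matrix \<Rightarrow> 'd sym_matrix \<Rightarrow> ('d sym_matrix \<Rightarrow> 'd sym_matrix)
     \<Rightarrow> 'd sym_matrix measure \<Rightarrow> ('d sym_matrix set \<Rightarrow> 'd sym_matrix)
     \<Rightarrow> (real \<Rightarrow> 'd sym_matrix \<Rightarrow> 'd sym_matrix measure) \<Rightarrow> bool"
where
  "affine_kernel \<alpha> b B m \<mu> p \<longleftrightarrow>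
     transition_semigroup p \<and> stochastically_continuous p \<and>
     (\<exists>\<phi> \<psi>. riccati_solution \<alpha> b B m \<mu> \<phi> \<psi> \<and>
        (\<forall>t\<ge>0. \<forall>x\<in>psd. \<forall>u\<in>psd.
           (\<integral>\<xi>. exp (- (u \<bullet> \<xi>)) \<partial>p t x) = exp (- \<phi> t u - \<psi> t u \<bullet> x)))"

definition effective_drift ::
  "(('d::finite) sym_matrix \<Rightarrow> 'd sym_matrix) \<Rightarrow> ('d sym_matrix set \<Rightarrow> 'd sym_matrix)
     \<Rightarrow> 'd sym_matrix \<Rightarrow> 'd sym_matrix"
where
  "effective_drift B \<mu> x = B x + signed_integral (\<lambda>A. x \<bullet> \<mu> A) (\<lambda>\<xi>. \<xi>)"

text \<open>
  \<open>z\<close> is an eigenvalue of the complexification of \<open>T\<close>: the eigenvector is \<open>v + \<i> w\<close>, and the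
  equations are the real and imaginary parts of \<open>T v + \<i> T w = z (v + \<i> w)\<close>.
\<close>

definition complex_eigenvalue :: "('a::real_vector \<Rightarrow> 'a) \<Rightarrow> complex \<Rightarrow> bool" where
  "complex_eigenvalue T z \<longleftrightarrow>
     (\<exists>v w. (v \<noteq> 0 \<or> w \<noteq> 0) \<and>
        T v = Re z *\<^sub>R v - Im z *\<^sub>R w \<and> T w = Im z *\<^sub>R v + Re z *\<^sub>R w)"

definition subcritical ::
  "(('d::finite) sym_matrix \<Rightarrow> 'd sym_matrix) \<Rightarrow> ('d sym_matrix set \<Rightarrow> 'd sym_matrix) \<Rightarrow> bool"
where
  "subcritical B \<mu> \<longleftrightarrow> (\<forall>z. complex_eigenvalue (effective_drift B \<mu>) z \<longrightarrow> Re z < 0)"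

definition exp_map :: "('a::real_normed_vector \<Rightarrow> 'a) \<Rightarrow> 'a \<Rightarrow> 'a" where
  "exp_map T x = (\<Sum>k. (T ^^ k) x /\<^sub>R fact k)"

definition invariant_distribution ::
  "(real \<Rightarrow> ('d::finite) sym_matrix \<Rightarrow> 'd sym_matrix measure) \<Rightarrow> 'd sym_matrix measure \<Rightarrow> bool"
where
  "invariant_distribution p \<pi> \<longleftrightarrow>
     prob_space \<pi> \<and> sets \<pi> = sets psd_space \<and> (\<forall>t\<ge>0. \<pi> \<bind> p t = \<pi>)"

definition couplings :: "'a measure \<Rightarrow> 'a measure \<Rightarrow> ('a \<times> 'a) measure set" where
  "couplings \<rho> \<rho>' = {H. prob_space H \<and> sets H = sets (\<rho> \<Otimes>\<^sub>M \<rho>') \<and>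
     distr H \<rho> fst = \<rho> \<and> distr H \<rho>' snd = \<rho>'}"

definition wasserstein1 :: "'a::real_normed_vector measure \<Rightarrow> 'a measure \<Rightarrow> ennreal" where
  "wasserstein1 \<rho> \<rho>' = (INF H\<in>couplings \<rho> \<rho>'. \<integral>\<^sup>+z. ennreal (norm (fst z - snd z)) \<partial>H)"

end

theory Submission
  imports Defs
begin

text \<open>
  Without diffusion the transition law splits as \<open>p\<^sub>t(x) = p\<^sub>t(0) * q\<^sub>t(x)\<close>, where \<open>q\<^sub>t(x)\<close> has the
  Laplace transform \<open>exp(-\<langle>\<psi>(t,u), x\<rangle>)\<close>; integrating over \<open>x\<close> with respect to \<open>\<pi>\<close> gives
  \<open>\<pi> = p\<^sub>t(0) * q'\<close>. Using the same \<open>p\<^sub>t(0)\<close>-distributed summand in both laws yields a coupling whose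
  cost is at most the sum of the first moments of \<open>q\<^sub>t(x)\<close> and \<open>q'\<close>. Since the norm is at most the
  trace on the cone and \<open>\<langle>\<psi>(t,u), x\<rangle> \<le> \<langle>u, exp(t B~) x\<rangle>\<close>, these moments decay like \<open>exp(-\<delta> t)\<close>.

  The law \<open>q\<^sub>t(x)\<close> exists because \<open>\<psi>\<close> is the limit of a splitting scheme for the Riccati equation
  (resolvent step for the linear drift, Euler step for the jumps): one step of the scheme is the
  Laplace exponent of a shifted compound Poisson law, and this property survives composition and limits.
\<close>

section \<open>The positive semidefinite cone\<close>

text \<open>The splitting asks for the law of the process without immigration, that is with
  \<open>b = 0\<close> and \<open>m = 0\<close>. Since \<open>d \<ge> 2\<close>, the condition
  \<open>(d - 1) \<alpha> \<preceq> b\<close> allows this only for \<open>\<alpha> = 0\<close>; this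
  ties the argument to the absence of diffusion. Only the kernel \<open>p\<close> of the full
  process is given, so the law without immigration has to be constructed, and its Laplace transform
  is all that is known of it. Hence two general results: a law on the cone is determined by its
  Laplace transform, and a limit of transforms of discrete measures that tends to 1 along the
  sequences \<open>u / k\<close> is again the transform of a law. In the second one, mass escaping
  to infinity becomes visible as mass on the faces of a compact cube. The factor
  \<open>sqrt d\<close> is the Frobenius norm of the identity: the mean of the trace is at most
  \<open>\<langle>1, exp(t B~) x\<rangle> \<le> sqrt d * M * exp(-\<delta> t) * norm x\<close>. The
  comparison of the Riccati flow with the linear flow rests on \<open>1 - exp(-z) \<le> z\<close>,
  applied in every step of the scheme. Finiteness of the first moment of \<open>\<pi>\<close> comes
  from the same inequality, applied to \<open>\<phi>\<close>.\<close>

lift_definition sym_one :: "('d::finite) sym_matrix" is "mat 1"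
  by (rule transpose_mat)

lift_definition rank_one :: "real^('d::finite) \<Rightarrow> 'd sym_matrix" is "\<lambda>v. \<chi> i j. v $ i * v $ j"
  by (simp add: transpose_def vec_eq_iff mult.commute)

lemma sym_matrix_eqI: "(\<And>i j. mat_of x $ i $ j = mat_of y $ i $ j) \<Longrightarrow> x = y"
  by (simp add: vec_eq_iff flip: mat_of_inject)

lemma inner_sym_matrix_sum: "x \<bullet> y = (\<Sum>i\<in>UNIV. \<Sum>j\<in>UNIV. mat_of x $ i $ j * mat_of y $ i $ j)"
  by (simp add: inner_sym_matrix_eq inner_vec_def)

text \<open>Quadratic forms become linear functionals of the matrix, so \<open>psd\<close> turns
  into an intersection of half-spaces and later arguments can stay within the inner product.\<close>

lemma quadratic_form: "v \<bullet> (mat_of x *v v) = x \<bullet> rank_one v"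
  by (simp add: inner_sym_matrix_sum rank_one.rep_eq inner_vec_def matrix_vector_mult_def
      sum_distrib_left algebra_simps)

lemma psd_iff_rank_one: "x \<in> psd \<longleftrightarrow> (\<forall>v. 0 \<le> x \<bullet> rank_one v)"
  by (simp add: psd_def quadratic_form)

lemma psd_0 [simp]: "0 \<in> psd"
  by (simp add: psd_iff_rank_one)

lemma psd_add: "x \<in> psd \<Longrightarrow> y \<in> psd \<Longrightarrow> x + y \<in> psd"
  by (simp add: psd_iff_rank_one inner_add_left)

lemma psd_scaleR: "x \<in> psd \<Longrightarrow> 0 \<le> c \<Longrightarrow> c *\<^sub>R x \<in> psd"
  by (simp add: psd_iff_rank_one)

lemma inner_rank_one_rank_one: "rank_one v \<bullet> rank_one w = (v \<bullet> w)\<^sup>2"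
  by (simp add: inner_sym_matrix_sum rank_one.rep_eq inner_vec_def power2_eq_square sum_product
      algebra_simps)

lemma norm_rank_one: "norm (rank_one v) = (norm v)\<^sup>2"
  by (simp add: norm_eq_sqrt_inner inner_rank_one_rank_one)

lemma inner_one_rank_one: "sym_one \<bullet> rank_one v = (norm v)\<^sup>2"
  by (simp add: sym_one.rep_eq power2_norm_eq_inner flip: quadratic_form)

lemma rank_one_psd [simp]: "rank_one v \<in> psd"
  by (simp add: psd_iff_rank_one inner_rank_one_rank_one)

lemma sym_one_psd [simp]: "sym_one \<in> psd"
  by (simp add: psd_iff_rank_one inner_one_rank_one)

lemma closed_psd: "closed (psd :: 'd::finite sym_matrix set)"
proof -
  have "psd = (\<Inter>v. {x :: 'd sym_matrix. 0 \<le> x \<bullet> rank_one v})"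
    by (auto simp: psd_iff_rank_one)
  also have "closed \<dots>"
    by (intro closed_INT ballI closed_Collect_le continuous_intros)
  finally show ?thesis .
qed

lemma convex_psd: "convex (psd :: 'd::finite sym_matrix set)"
  by (auto simp: convex_def intro!: psd_add psd_scaleR)

section \<open>Rank-one decomposition and self-duality of the cone\<close>

lemma psd_diag_nonneg: "x \<in> psd \<Longrightarrow> 0 \<le> mat_of x $ i $ i"
proof -
  assume "x \<in> psd"
  then have "0 \<le> axis i 1 \<bullet> (mat_of x *v axis i 1)"
    by (simp add: psd_def)
  then show ?thesis
    by (simp add: matrix_vector_mult_basis column_def inner_axis')
qed

text \<open>One elimination step of a Cholesky factorisation. The form of \<open>x\<close> is
  evaluated at \<open>v - t e_i\<close> with the \<open>t\<close> that minimises it; the minimum is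
  the form of \<open>x\<close> at \<open>v\<close> minus
  \<open>(w \<bullet> v)\<^sup>2\<close>.\<close>

lemma psd_schur_complement:
  fixes x :: "('d::finite) sym_matrix"
  assumes x: "x \<in> psd" and pos: "mat_of x $ i $ i > 0"
  defines "w \<equiv> (1 / sqrt (mat_of x $ i $ i)) *\<^sub>R column i (mat_of x)"
  shows "x - rank_one w \<in> psd"
  unfolding psd_def
proof (intro CollectI allI)
  fix v :: "real^'d"
  let ?X = "mat_of x" and ?e = "axis i 1 :: real^'d"
  define t where "t = (column i ?X \<bullet> v) / ?X $ i $ i"
  have e: "?X *v ?e = column i ?X"
    by (simp add: matrix_vector_mult_basis)
  have sym: "?e \<bullet> (?X *v v) = column i ?X \<bullet> v"
    by (metis dot_lmul_matrix e transpose_mat_of vector_transpose_matrix)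
  have ii: "?e \<bullet> column i ?X = ?X $ i $ i"
    by (simp add: inner_axis' column_def)
  have "0 \<le> (v - t *\<^sub>R ?e) \<bullet> (?X *v (v - t *\<^sub>R ?e))"
    using x by (simp add: psd_def)
  also have "\<dots> = v \<bullet> (?X *v v) - 2 * t * (column i ?X \<bullet> v) + t\<^sup>2 * ?X $ i $ i"
    by (simp add: matrix_vector_mult_diff_distrib matrix_vector_mult_scaleR e inner_diff_left
        inner_diff_right sym ii inner_commute[of v] power2_eq_square algebra_simps)
  also have "\<dots> = v \<bullet> (?X *v v) - (column i ?X \<bullet> v)\<^sup>2 / ?X $ i $ i"
    using pos by (simp add: t_def power2_eq_square field_simps)
  also have "\<dots> = v \<bullet> (?X *v v) - (w \<bullet> v)\<^sup>2"
    using pos by (simp add: w_def power_mult_distrib power_divide)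
  also have "\<dots> = (x - rank_one w) \<bullet> rank_one v"
    by (simp add: inner_diff_left quadratic_form inner_rank_one_rank_one)
  finally show "0 \<le> v \<bullet> (mat_of (x - rank_one w) *v v)"
    by (simp add: quadratic_form)
qed

text \<open>At \<open>e_i + s e_j\<close> the form reduces to \<open>2 * s * x_ij\<close>, which has
  to be nonnegative for both signs of \<open>s\<close>.\<close>

lemma psd_zero_diag:
  fixes x :: "('d::finite) sym_matrix"
  assumes x: "x \<in> psd" and diag: "\<And>i. mat_of x $ i $ i = 0"
  shows "x = 0"
proof (rule sym_matrix_eqI)
  fix i j
  let ?X = "mat_of x" 
  have "0 \<le> (axis i 1 + s *\<^sub>R axis j 1) \<bullet> (?X *v (axis i 1 + s *\<^sub>R axis j 1))" for s
    using x by (simp add: psd_def)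
  then have "0 \<le> 2 * s * ?X $ i $ j" for s
    by (simp add: matrix_vector_right_distrib matrix_vector_mult_scaleR inner_add_left inner_add_right
        matrix_vector_mult_basis inner_axis' column_def diag mat_of_sym[of x j i] algebra_simps)
  from this[of 1] this[of "-1"] show "?X $ i $ j = mat_of 0 $ i $ j"
    by (simp add: zero_sym_matrix.rep_eq)
qed

text \<open>Cholesky factorisation in the shape of an induction rule. Removing the rank-one part at
  a nonzero diagonal entry makes that entry vanish, so the number of nonzero diagonal entries
  drops.\<close>

lemma psd_rank_one_induct [consumes 1, case_names zero add]:
  fixes x :: "('d::finite) sym_matrix"
  assumes "x \<in> psd" and zero: "P 0" and add: "\<And>x v. x \<in> psd \<Longrightarrow> P x \<Longrightarrow> P (x + rank_one v)"
  shows "P x"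
  using assms(1)
proof (induction "card {i. mat_of x $ i $ i \<noteq> 0}" arbitrary: x rule: less_induct)
  case less
  show ?case
  proof (cases "\<forall>i. mat_of x $ i $ i = 0")
    case True
    with less.prems zero show ?thesis
      using psd_zero_diag by blast
  next
    case False
    then obtain i where "mat_of x $ i $ i \<noteq> 0"
      by blast
    with psd_diag_nonneg[OF less.prems, of i] have pos: "mat_of x $ i $ i > 0"
      by simp
    define w where "w = (1 / sqrt (mat_of x $ i $ i)) *\<^sub>R column i (mat_of x)"
    let ?y = "x - rank_one w"
    have y: "?y \<in> psd"
      unfolding w_def by (rule psd_schur_complement[OF less.prems pos])
    have diag: "mat_of ?y $ j $ j = mat_of x $ j $ j - (w $ j)\<^sup>2" for j
      by (simp add: minus_sym_matrix.rep_eq rank_one.rep_eq power2_eq_square)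
    \<comment> \<open>A vanishing entry cannot come back: it would turn into
      \<open>- (w $ j)\<^sup>2\<close>, but the remainder is still positive semidefinite.\<close>
    have "mat_of ?y $ j $ j = 0" if "mat_of x $ j $ j = 0" for j
      using psd_diag_nonneg[OF y, of j] that by (simp add: diag)
    moreover have "mat_of ?y $ i $ i = 0"
      using pos unfolding diag by (simp add: w_def column_def power2_eq_square field_simps)
    ultimately have "{j. mat_of ?y $ j $ j \<noteq> 0} \<subset> {j. mat_of x $ j $ j \<noteq> 0}"
      using pos by (metis (mono_tags, lifting) less_irrefl mem_Collect_eq psubsetI subsetI)
    then have "P ?y"
      using less.hyps y by (simp add: psubset_card_mono)
    from add[OF y this, of w] show ?thesis
      by simp
  qed
qed

lemma psd_inner_nonneg: "y \<in> psd \<Longrightarrow> x \<in> psd \<Longrightarrow> 0 \<le> x \<bullet> y"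
proof (induction y rule: psd_rank_one_induct)
  case (add y v)
  then show ?case
    by (simp add: inner_add_right psd_iff_rank_one)
qed simp

lemma psd_self_dual: "x \<in> psd \<longleftrightarrow> (\<forall>y\<in>psd. 0 \<le> x \<bullet> y)"
  using psd_inner_nonneg psd_iff_rank_one rank_one_psd by blast

text \<open>Equality holds for rank-one matrices, where both sides are the squared length of the
  vector; the triangle inequality does the rest. The trace on the right is linear, so its mean can
  be read off a Laplace transform.\<close>

lemma norm_le_inner_one: "x \<in> psd \<Longrightarrow> norm x \<le> sym_one \<bullet> x"
proof (induction x rule: psd_rank_one_induct)
  case (add x v)
  have "norm (x + rank_one v) \<le> norm x + norm (rank_one v)"
    by (rule norm_triangle_ineq)
  with add show ?case
    by (simp add: inner_add_right inner_one_rank_one norm_rank_one)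
qed simp

lemma norm_sym_one: "norm (sym_one :: ('d::finite) sym_matrix) = sqrt (real CARD('d))"
proof -
  have "mat_of (sym_one :: 'd sym_matrix) \<bullet> mat_of sym_one = real CARD('d)"
    by (simp add: sym_one.rep_eq inner_vec_def mat_def if_distrib cong: if_cong)
  then show ?thesis
    by (simp add: norm_eq_sqrt_inner inner_sym_matrix_eq)
qed

text \<open>The Frobenius norm dominates the largest absolute eigenvalue. Every symmetric matrix is
  thereby a difference of two elements of the cone, which extends facts about positive measures from
  the cone to the whole space.\<close>

lemma psd_shift: 
  assumes "norm x \<le> c"
  shows "c *\<^sub>R sym_one + x \<in> psd" "c *\<^sub>R sym_one - x \<in> psd"
proof -
  have "\<bar>x \<bullet> rank_one v\<bar> \<le> c * (norm v)\<^sup>2" for v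
    using Cauchy_Schwarz_ineq2[of x "rank_one v"] mult_right_mono[OF assms, of "(norm v)\<^sup>2"]
    by (simp add: norm_rank_one)
  then have "- (c * (norm v)\<^sup>2) \<le> x \<bullet> rank_one v \<and> x \<bullet> rank_one v \<le> c * (norm v)\<^sup>2" for v
    by (metis abs_le_iff minus_le_iff)
  then show "c *\<^sub>R sym_one + x \<in> psd" "c *\<^sub>R sym_one - x \<in> psd"
    by (simp_all add: psd_iff_rank_one inner_add_left inner_diff_left inner_one_rank_one)
      (smt (verit))
qed

section \<open>Integration against the jump kernel\<close>

lemma has_signed_integral_add:
  assumes "has_signed_integral \<nu> f I" "has_signed_integral \<nu>' f I'"
  shows "has_signed_integral (\<lambda>A. \<nu> A + \<nu>' A) f (I + I')"
proof -
  obtain P N where 1: "signed_decomposition \<nu> P N" "integrable P f" "integrable N f"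
    "I = integral\<^sup>L P f - integral\<^sup>L N f"
    using assms(1) by (auto simp: has_signed_integral_def)
  obtain P' N' where 2: "signed_decomposition \<nu>' P' N'" "integrable P' f" "integrable N' f"
    "I' = integral\<^sup>L P' f - integral\<^sup>L N' f"
    using assms(2) by (auto simp: has_signed_integral_def)
  have sets: "sets P' = sets P" "sets N' = sets N" "sets P = sets jump_space" "sets N = sets jump_space"
    using 1(1) 2(1) by (auto simp: signed_decomposition_def)
  have meas: "measure (sum_measure M M') A = measure M A + measure M' A"
    if "sets M' = sets M" "emeasure M A < \<infinity>" "emeasure M' A < \<infinity>" for M M' :: "'a sym_matrix measure" and A
    using that by (simp add: measure_def emeasure_sum_measure enn2real_plus)
  have "signed_decomposition (\<lambda>A. \<nu> A + \<nu>' A) (sum_measure P P') (sum_measure N N')"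
    using 1(1) 2(1) sets by (auto simp: signed_decomposition_def emeasure_sum_measure meas)
  then show ?thesis
    using integral_sum_measure[OF sets(1) 1(2) 2(2)] integral_sum_measure[OF sets(2) 1(3) 2(3)] 1(4) 2(4)
    unfolding has_signed_integral_def
    by (intro exI[of _ "sum_measure P P'"] exI[of _ "sum_measure N N'"]) simp
qed

lemma has_signed_integral_uminus:
  assumes "has_signed_integral \<nu> f I"
  shows "has_signed_integral (\<lambda>A. - \<nu> A) f (- I)"
proof -
  obtain P N where "signed_decomposition \<nu> P N" "integrable P f" "integrable N f"
    "I = integral\<^sup>L P f - integral\<^sup>L N f"
    using assms by (auto simp: has_signed_integral_def)
  then show ?thesis
    unfolding has_signed_integral_def signed_decomposition_def
    by (intro exI[of _ N] exI[of _ P]) simp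
qed

lemma integral_scale_measure:
  fixes f :: "'a \<Rightarrow> 'b::{banach, second_countable_topology}"
  assumes f: "integrable M f" and c: "0 \<le> c"
  shows "integrable (scale_measure (ennreal c) M) f \<and>
    integral\<^sup>L (scale_measure (ennreal c) M) f = c *\<^sub>R integral\<^sup>L M f"
proof -
  have "scale_measure (ennreal c) M = density M (\<lambda>_. ennreal c)"
    by (rule measure_eqI) (auto simp: emeasure_density nn_integral_cmult_indicator)
  with assms show ?thesis
    by (simp add: integrable_density integral_density)
qed

lemma has_signed_integral_scale:
  assumes "has_signed_integral \<nu> f I"
  shows "has_signed_integral (\<lambda>A. c * \<nu> A) f (c *\<^sub>R I)"
proof -
  have pos: "has_signed_integral (\<lambda>A. c * \<nu> A) f (c *\<^sub>R I)" if c: "0 \<le> c" for c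
  proof -
    obtain P N where 1: "signed_decomposition \<nu> P N" "integrable P f" "integrable N f"
      "I = integral\<^sup>L P f - integral\<^sup>L N f"
      using assms by (auto simp: has_signed_integral_def)
    then have "signed_decomposition (\<lambda>A. c * \<nu> A) (scale_measure (ennreal c) P) (scale_measure (ennreal c) N)"
      using c
      by (auto simp: signed_decomposition_def measure_def enn2real_mult ennreal_mult_less_top right_diff_distrib)
    then show ?thesis
      using integral_scale_measure[OF 1(2) c] integral_scale_measure[OF 1(3) c] 1(4)
      unfolding has_signed_integral_def
      by (intro exI[of _ "scale_measure (ennreal c) P"] exI[of _ "scale_measure (ennreal c) N"])
        (simp add: scaleR_diff_right)
  qed
  show ?thesis
  proof (cases "0 \<le> c")
    case False
    then show ?thesis
      using has_signed_integral_uminus[OF pos[of "- c"]] by simp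
  qed (rule pos)
qed

lemma bounded_away_subset: "A \<in> bounded_away \<Longrightarrow> B \<subseteq> A \<Longrightarrow> B \<in> sets jump_space \<Longrightarrow> B \<in> bounded_away"
  using closure_mono[of B A] by (auto simp: bounded_away_def)

lemma bounded_away_sets: "A \<in> bounded_away \<Longrightarrow> A \<in> sets jump_space"
  by (simp add: bounded_away_def)

text \<open>
  Cut \<open>psd - {0}\<close> into countably many shells bounded away from the origin and add up.
\<close>

lemma ex_measure_bounded_away:
  fixes \<nu> :: "('d::finite) sym_matrix set \<Rightarrow> real"
  assumes nonneg: "\<And>A. A \<in> bounded_away \<Longrightarrow> 0 \<le> \<nu> A"
    and add: "\<And>A :: nat \<Rightarrow> 'd sym_matrix set. range A \<subseteq> bounded_away \<Longrightarrow> disjoint_family A \<Longrightarrow>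
      (\<Union>n. A n) \<in> bounded_away \<Longrightarrow> (\<lambda>n. \<nu> (A n)) sums \<nu> (\<Union>n. A n)"
  shows "\<exists>P. sets P = sets jump_space \<and> (\<forall>A\<in>bounded_away. emeasure P A = ennreal (\<nu> A))"
proof -
  define W where "W n = (psd - ball 0 (inverse (real (Suc n))) :: 'd sym_matrix set)" for n
  define S where "S n = disjointed W n" for n
  have W: "range W \<subseteq> sets (jump_space :: 'd sym_matrix measure)" "W n \<in> bounded_away" for n
    using bounded_away_shell bounded_away_sets by (auto simp: W_def)
  have S_sets: "S n \<in> sets (jump_space :: 'd sym_matrix measure)" for n
    using sets.range_disjointed_sets[OF W(1)] by (auto simp: S_def)
  have S: "S n \<in> bounded_away" for n
    using disjointed_subset[of W n] S_sets by (auto intro!: bounded_away_subset[OF W(2)[of n]] simp: S_def)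
  have disj: "disjoint_family S"
    unfolding S_def by (rule disjoint_family_disjointed)
  have un: "(\<Union>n. S n) = psd - {0}"
  proof -
    have "(\<Union>n. S n) = (\<Union>n. W n)"
      unfolding S_def by (rule UN_disjointed_eq)
    also have "\<dots> = psd - {0}"
    proof (intro equalityI subsetI)
      fix x :: "'d sym_matrix"
      assume x: "x \<in> psd - {0}"
      then obtain n where "inverse (real (Suc n)) < norm x"
        using reals_Archimedean[of "norm x"] by auto
      with x show "x \<in> (\<Union>n. W n)"
        by (auto simp: W_def intro!: exI[of _ n])
    qed (auto simp: W_def)
    finally show ?thesis .
  qed
  have ba: "A \<inter> S n \<in> bounded_away" if "A \<in> sets jump_space" for A n
    by (rule bounded_away_subset[OF S[of n]]) (use that S_sets in auto)
  have empty: "\<nu> {} = 0"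
  proof -
    have "({} :: 'd sym_matrix set) \<in> bounded_away"
      by (simp add: bounded_away_def)
    \<comment> \<open>Additivity for a sequence of empty sets makes a constant series summable,
      which forces the constant to be 0.\<close>
    with add[of "\<lambda>_. {}"] have "summable (\<lambda>n::nat. \<nu> {})"
      by (auto simp: disjoint_family_on_def sums_iff)
    then show ?thesis
      by (simp add: summable_const_iff)
  qed
  define P where "P = measure_of (psd - {0}) (sets jump_space) (\<lambda>A. \<Sum>n. ennreal (\<nu> (A \<inter> S n)))"
  have "(\<Union>(sets jump_space)) \<subseteq> (psd - {0} :: 'd sym_matrix set)"
    by (auto simp: sets_jump_space)
  then have sub: "sets jump_space \<subseteq> Pow (psd - {0} :: 'd sym_matrix set)"
    by blast
  have "space (jump_space :: 'd sym_matrix measure) = psd - {0}"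
    by (simp add: space_restrict_space)
  then have sets_P: "sets P = sets jump_space"
    unfolding P_def using sets.sigma_sets_eq[of jump_space] sub by (simp add: sets_measure_of del: space_restrict_space)
  have emeasure_P: "emeasure P A = (\<Sum>n. ennreal (\<nu> (A \<inter> S n)))" if A: "A \<in> sets jump_space" for A
  proof (rule emeasure_measure_of[OF P_def sub])
    show "positive (sets P) (\<lambda>A. \<Sum>n. ennreal (\<nu> (A \<inter> S n)))"
      by (simp add: positive_def empty)
    show "countably_additive (sets P) (\<lambda>A. \<Sum>n. ennreal (\<nu> (A \<inter> S n)))"
    proof (rule countably_additiveI)
      fix A :: "nat \<Rightarrow> 'd sym_matrix set"
      assume A: "range A \<subseteq> sets P" "disjoint_family A"
      have sums: "(\<lambda>i. \<nu> (A i \<inter> S n)) sums \<nu> (\<Union>i. A i \<inter> S n)" for n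
      proof (rule add)
        show "range (\<lambda>i. A i \<inter> S n) \<subseteq> bounded_away"
          using A(1) ba by (auto simp: sets_P)
        show "disjoint_family (\<lambda>i. A i \<inter> S n)"
          using A(2) by (auto simp: disjoint_family_on_def)
        have "(\<Union>i. A i) \<in> sets jump_space"
          using A(1) by (auto simp: sets_P)
        from ba[OF this, of n] show "(\<Union>i. A i \<inter> S n) \<in> bounded_away"
          by (simp add: Int_commute)
      qed
      have "(\<Sum>i n. ennreal (\<nu> (A i \<inter> S n))) = (\<Sum>n i. ennreal (\<nu> (A i \<inter> S n)))"
        using nn_integral_suminf[of "\<lambda>n i. ennreal (\<nu> (A i \<inter> S n))" "count_space UNIV"]
        by (simp add: nn_integral_count_space_nat)
      also have "\<dots> = (\<Sum>n. ennreal (\<nu> (\<Union>i. A i \<inter> S n)))"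
        using A(1) ba nonneg by (intro suminf_cong suminf_ennreal_eq sums) (auto simp: sets_P)
      finally show "(\<Sum>i n. ennreal (\<nu> (A i \<inter> S n))) = (\<Sum>n. ennreal (\<nu> ((\<Union>i. A i) \<inter> S n)))"
        by simp
    qed
    show "A \<in> sets P"
      using A by (simp add: sets_P)
  qed
  have "emeasure P A = ennreal (\<nu> A)" if A: "A \<in> bounded_away" for A
  proof -
    note A' = bounded_away_sets[OF A]
    have eq: "(\<Union>n. A \<inter> S n) = A"
      using un A' by (auto simp: sets_jump_space)
    have "(\<lambda>n. \<nu> (A \<inter> S n)) sums \<nu> (\<Union>n. A \<inter> S n)"
      using ba[OF A'] disj A by (intro add) (auto simp: disjoint_family_on_def eq simp del: UN_simps)
    then have "(\<Sum>n. ennreal (\<nu> (A \<inter> S n))) = ennreal (\<nu> A)"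
      unfolding eq using ba[OF A'] nonneg by (intro suminf_ennreal_eq) auto
    then show ?thesis
      using emeasure_P[OF A'] by simp
  qed
  with sets_P show ?thesis
    by blast
qed

text \<open>
  Entries of a matrix are inner products with the following symmetric matrices, which reduces
  entrywise integration to integration against the signed measures \<open>x \<bullet> \<mu>\<close>.
\<close>

definition sym_unit :: "'d \<Rightarrow> 'd \<Rightarrow> ('d::finite) sym_matrix" where
  "sym_unit i j = (1 / 4) *\<^sub>R (rank_one (axis i 1 + axis j 1) - rank_one (axis i 1 - axis j 1))"

lemma inner_sym_unit: "sym_unit i j \<bullet> x = mat_of x $ i $ j"
proof -
  have "x \<bullet> sym_unit i j = (1 / 4) * (2 * mat_of x $ i $ j + 2 * mat_of x $ j $ i)"
    unfolding sym_unit_def inner_scaleR_right inner_diff_right quadratic_form[symmetric]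
    by (simp add: matrix_vector_right_distrib matrix_vector_mult_diff_distrib inner_add_left
        inner_add_right inner_diff_left inner_diff_right matrix_vector_mult_basis inner_axis'
        column_def)
  then show ?thesis
    by (simp add: inner_commute mat_of_sym[of x j i])
qed

lemma sym_unit_representation: "(\<Sum>i\<in>UNIV. \<Sum>j\<in>UNIV. mat_of x $ i $ j *\<^sub>R sym_unit i j) = x"
proof -
  have "(\<Sum>i\<in>UNIV. \<Sum>j\<in>UNIV. mat_of x $ i $ j *\<^sub>R sym_unit i j) \<bullet> y = x \<bullet> y" for y
    by (simp add: inner_sum_left inner_sym_unit inner_sym_matrix_sum[of x y])
  then show ?thesis
    by (rule vector_eq_rdot[THEN iffD1, OF allI])
qed

lemma trace_eq_inner_one: "trace (mat_of x) = sym_one \<bullet> x"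
  by (simp add: inner_sym_matrix_def sym_one.rep_eq)

section \<open>The scalar measures \<open>x \<bullet> \<mu>\<close> for \<open>x\<close> in the
  cone\<close>

locale jump_kernel =
  fixes \<mu> :: "('d::finite) sym_matrix set \<Rightarrow> 'd sym_matrix"
  assumes psd_measure: "psd_measure \<mu>"
    and moment: "signed_integrable (\<lambda>A. trace (mat_of (\<mu> A))) norm"
begin

text \<open>The measure usually written \<open>\<langle>x, \<mu>(d\<xi>)\<rangle>\<close>. It is
  used for \<open>x\<close> in \<open>psd\<close> only, where \<open>x \<bullet> \<mu>\<close> is
  nonnegative and such a measure exists; its values on sets bounded away from 0 determine
  it.\<close>

definition jump_measure :: "'d sym_matrix \<Rightarrow> 'd sym_matrix measure" where
  "jump_measure x = (SOME P. sets P = sets jump_space \<and>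
     (\<forall>A\<in>bounded_away. emeasure P A = ennreal (x \<bullet> \<mu> A)))"

lemma
  assumes x: "x \<in> psd"
  shows sets_jump_measure: "sets (jump_measure x) = sets jump_space"
    and emeasure_jump_measure: "A \<in> bounded_away \<Longrightarrow> emeasure (jump_measure x) A = ennreal (x \<bullet> \<mu> A)"
proof -
  have "\<exists>P. sets P = sets jump_space \<and> (\<forall>A\<in>bounded_away. emeasure P A = ennreal (x \<bullet> \<mu> A))"
  proof (rule ex_measure_bounded_away)
    show "0 \<le> x \<bullet> \<mu> A" if "A \<in> bounded_away" for A
      using psd_measure that x by (intro psd_inner_nonneg) (auto simp: psd_measure_def)
    show "(\<lambda>n. x \<bullet> \<mu> (A n)) sums (x \<bullet> \<mu> (\<Union>n. A n))"
      if "range A \<subseteq> bounded_away" "disjoint_family A" "(\<Union>n. A n) \<in> bounded_away" for A :: "nat \<Rightarrow> _"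
      using psd_measure that by (intro bounded_linear.sums[OF bounded_linear_inner_right]) (auto simp: psd_measure_def)
  qed
  from someI_ex[OF this] show "sets (jump_measure x) = sets jump_space"
    "A \<in> bounded_away \<Longrightarrow> emeasure (jump_measure x) A = ennreal (x \<bullet> \<mu> A)"
    unfolding jump_measure_def by auto
qed

lemma jump_inner_nonneg: "x \<in> psd \<Longrightarrow> A \<in> bounded_away \<Longrightarrow> 0 \<le> x \<bullet> \<mu> A"
  using psd_measure by (intro psd_inner_nonneg) (auto simp: psd_measure_def)

lemma jump_measure_eqI:
  assumes P: "sets P = sets jump_space" and x: "x \<in> psd"
    and eq: "\<And>A. A \<in> bounded_away \<Longrightarrow> emeasure P A = ennreal (x \<bullet> \<mu> A)"
  shows "P = jump_measure x"
  by (rule measure_eqI_bounded_away) (simp_all add: P eq sets_jump_measure[OF x] emeasure_jump_measure[OF x])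

lemma jump_measure_add:
  assumes "x \<in> psd" "y \<in> psd"
  shows "sum_measure (jump_measure x) (jump_measure y) = jump_measure (x + y)"
  by (rule jump_measure_eqI)
    (use assms in \<open>simp_all add: sets_jump_measure emeasure_sum_measure emeasure_jump_measure psd_add
      inner_add_left jump_inner_nonneg\<close>)

lemma jump_measure_scaleR:
  assumes "x \<in> psd" "0 \<le> c"
  shows "scale_measure (ennreal c) (jump_measure x) = jump_measure (c *\<^sub>R x)"
  by (rule jump_measure_eqI)
    (use assms in \<open>simp_all add: sets_jump_measure emeasure_jump_measure psd_scaleR ennreal_mult'\<close>)

lemma measurable_jump_measure:
  "f \<in> borel_measurable borel \<Longrightarrow> x \<in> psd \<Longrightarrow> f \<in> borel_measurable (jump_measure x)"
  unfolding measurable_cong_sets[OF sets_jump_measure refl] by (rule measurable_restrict_space1)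

lemma space_jump_measure: "x \<in> psd \<Longrightarrow> space (jump_measure x) = psd - {0}"
  using sets_eq_imp_space_eq[OF sets_jump_measure] by (simp add: space_restrict_space)

text \<open>\<open>jump_measure sym_one\<close> is the trace measure. The moment condition only
  provides some pair with difference \<open>P - N\<close> equal to the trace; hence the trace
  measure plus \<open>N\<close> is \<open>P\<close>, against which the norm is integrable.\<close>

lemma nn_integral_norm_jump_measure_one: "(\<integral>\<^sup>+\<xi>. ennreal (norm \<xi>) \<partial>jump_measure sym_one) < \<infinity>"
proof -
  obtain P N where PN: "signed_decomposition (\<lambda>A. trace (mat_of (\<mu> A))) P N"
    and int: "integrable P (norm :: 'd sym_matrix \<Rightarrow> real)"
    using moment by (auto simp: signed_integrable_def has_signed_integral_def)
  let ?Q = "jump_measure sym_one"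
  have sets: "sets P = sets jump_space" "sets N = sets jump_space" "sets ?Q = sets jump_space"
    using PN by (auto simp: signed_decomposition_def sets_jump_measure)
  have "sum_measure ?Q N = P"
  proof (rule measure_eqI_bounded_away)
    fix A :: "'d sym_matrix set"
    assume A: "A \<in> bounded_away"
    then have fin: "emeasure P A = ennreal (measure P A)" "emeasure N A = ennreal (measure N A)"
      and eq: "sym_one \<bullet> \<mu> A = measure P A - measure N A"
      using PN by (auto simp: signed_decomposition_def emeasure_eq_ennreal_measure less_top trace_eq_inner_one)
    have "emeasure (sum_measure ?Q N) A = ennreal (sym_one \<bullet> \<mu> A) + ennreal (measure N A)"
      using A by (simp add: emeasure_sum_measure sets emeasure_jump_measure fin)
    also have "\<dots> = ennreal (sym_one \<bullet> \<mu> A + measure N A)"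
      using jump_inner_nonneg[OF sym_one_psd A] by (simp add: ennreal_plus)
    finally show "emeasure (sum_measure ?Q N) A = emeasure P A" "emeasure (sum_measure ?Q N) A \<noteq> \<infinity>"
      by (simp_all add: eq fin)
  qed (simp_all add: sets)
  then have "(\<integral>\<^sup>+\<xi>. ennreal (norm \<xi>) \<partial>P) = (\<integral>\<^sup>+\<xi>. ennreal (norm \<xi>) \<partial>?Q) + (\<integral>\<^sup>+\<xi>. ennreal (norm \<xi>) \<partial>N)"
    using nn_integral_sum_measure[of N ?Q "\<lambda>\<xi>. ennreal (norm \<xi>)"] sets
    by (simp add: measurable_jump_measure)
  moreover have "(\<integral>\<^sup>+\<xi>. ennreal (norm \<xi>) \<partial>P) < \<infinity>"
    using int by (simp add: integrable_iff_bounded)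
  ultimately show ?thesis
    by (simp add: less_top)
qed

definition jump_moment :: real where
  "jump_moment = (\<integral>\<xi>. norm \<xi> \<partial>jump_measure sym_one)"

lemma jump_moment_nonneg: "0 \<le> jump_moment"
  by (simp add: jump_moment_def)

text \<open>Domination by the trace measure: \<open>norm x *\<^sub>R sym_one - x\<close> lies in the
  cone, so its jump measure is a positive complement of that of \<open>x\<close> within
  \<open>norm x\<close> times the trace measure.\<close>

lemma
  assumes x: "x \<in> psd"
  shows integrable_norm_jump_measure: "integrable (jump_measure x) norm"
    and integral_norm_jump_measure: "(\<integral>\<xi>. norm \<xi> \<partial>jump_measure x) \<le> norm x * jump_moment"
proof -
  let ?c = "norm x"
  have y: "?c *\<^sub>R sym_one - x \<in> psd"
    by (rule psd_shift) simp
  have one: "integrable (jump_measure sym_one) (norm :: 'd sym_matrix \<Rightarrow> real)"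
    using nn_integral_norm_jump_measure_one by (auto simp: integrable_iff_bounded measurable_jump_measure)
  have sum: "sum_measure (jump_measure x) (jump_measure (?c *\<^sub>R sym_one - x))
      = scale_measure (ennreal ?c) (jump_measure sym_one)"
    using x y by (simp add: jump_measure_add jump_measure_scaleR)
  have scaled: "integrable (scale_measure (ennreal ?c) (jump_measure sym_one)) (norm :: 'd sym_matrix \<Rightarrow> real)"
    "integral\<^sup>L (scale_measure (ennreal ?c) (jump_measure sym_one)) norm = ?c * jump_moment"
    using integral_scale_measure[OF one, of ?c] by (simp_all add: jump_moment_def)
  have "(\<integral>\<^sup>+\<xi>. ennreal (norm \<xi>) \<partial>jump_measure x) + (\<integral>\<^sup>+\<xi>. ennreal (norm \<xi>) \<partial>jump_measure (?c *\<^sub>R sym_one - x))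
      = (\<integral>\<^sup>+\<xi>. ennreal (norm \<xi>) \<partial>scale_measure (ennreal ?c) (jump_measure sym_one))"
    unfolding sum[symmetric] using x y
    by (intro nn_integral_sum_measure[symmetric]) (simp_all add: sets_jump_measure measurable_jump_measure)
  also have "\<dots> < \<infinity>"
    using scaled(1) by (simp add: integrable_iff_bounded)
  finally have "(\<integral>\<^sup>+\<xi>. ennreal (norm \<xi>) \<partial>jump_measure x) < \<infinity>"
    "(\<integral>\<^sup>+\<xi>. ennreal (norm \<xi>) \<partial>jump_measure (?c *\<^sub>R sym_one - x)) < \<infinity>"
    by (simp_all add: less_top)
  then have int: "integrable (jump_measure x) (norm :: 'd sym_matrix \<Rightarrow> real)"
    "integrable (jump_measure (?c *\<^sub>R sym_one - x)) (norm :: 'd sym_matrix \<Rightarrow> real)"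
    using x y by (auto simp: integrable_iff_bounded measurable_jump_measure)
  then show "integrable (jump_measure x) norm"
    by simp
  have "(\<integral>\<xi>. norm \<xi> \<partial>jump_measure x) + (\<integral>\<xi>. norm \<xi> \<partial>jump_measure (?c *\<^sub>R sym_one - x))
      = integral\<^sup>L (scale_measure (ennreal ?c) (jump_measure sym_one)) norm"
    unfolding sum[symmetric] using integral_sum_measure[OF _ int] x y by (simp add: sets_jump_measure)
  moreover have "0 \<le> (\<integral>\<xi>. norm \<xi> \<partial>jump_measure (?c *\<^sub>R sym_one - x))"
    by simp
  ultimately show "(\<integral>\<xi>. norm \<xi> \<partial>jump_measure x) \<le> ?c * jump_moment"
    unfolding scaled(2) by linarith
qed

lemma integrable_jump_measure:
  fixes f :: "'d sym_matrix \<Rightarrow> 'b::{banach, second_countable_topology}"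
  assumes f: "f \<in> borel_measurable borel" "\<And>\<xi>. \<xi> \<in> psd \<Longrightarrow> norm (f \<xi>) \<le> C * norm \<xi>" and x: "x \<in> psd"
  shows "integrable (jump_measure x) f"
proof (rule Bochner_Integration.integrable_bound)
  show "integrable (jump_measure x) (\<lambda>\<xi>. C * norm \<xi>)"
    using integrable_norm_jump_measure[OF x] by simp
  show "AE \<xi> in jump_measure x. norm (f \<xi>) \<le> norm (C * norm \<xi>)"
    using f(2) by (intro AE_I2) (auto simp: space_jump_measure[OF x] intro: order_trans abs_ge_self)
qed (rule measurable_jump_measure[OF f(1) x])

context
  fixes f :: "'d sym_matrix \<Rightarrow> 'b::{banach, second_countable_topology}" and C :: real
  assumes f: "f \<in> borel_measurable borel" "\<And>\<xi>. \<xi> \<in> psd \<Longrightarrow> norm (f \<xi>) \<le> C * norm \<xi>"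
begin

lemma has_signed_integral_jump_psd:
  assumes x: "x \<in> psd"
  shows "has_signed_integral (\<lambda>A. x \<bullet> \<mu> A) f (\<integral>\<xi>. f \<xi> \<partial>jump_measure x)"
proof -
  have "signed_decomposition (\<lambda>A. x \<bullet> \<mu> A) (jump_measure x) (null_measure jump_space)"
    using x by (auto simp: signed_decomposition_def sets_jump_measure emeasure_jump_measure
        measure_def jump_inner_nonneg)
  moreover have "integrable (null_measure jump_space) f"
    using measurable_restrict_space1[OF f(1)] by (simp add: integrable_iff_bounded)
  moreover have "integral\<^sup>L (null_measure jump_space) f = 0"
    by (intro integral_eq_zero_AE AE_I'[of "space (null_measure jump_space)"]) (auto simp: null_sets_def sets_jump_space intro!: sets.Diff)
  ultimately show ?thesis
    unfolding has_signed_integral_def using integrable_jump_measure[OF f x]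
    by (intro exI[of _ "jump_measure x"] exI[of _ "null_measure jump_space"]) simp
qed

text \<open>Writing \<open>x\<close> as the difference of
  \<open>norm x *\<^sub>R sym_one + x\<close> and \<open>norm x *\<^sub>R sym_one\<close> gives two
  positive measures. For arbitrary symmetric \<open>x\<close> the description operator in
  \<open>signed_integral\<close> thus picks a genuine integral.\<close>

lemma has_signed_integral_jump:
  "has_signed_integral (\<lambda>A. x \<bullet> \<mu> A) f (signed_integral (\<lambda>A. x \<bullet> \<mu> A) f)"
proof -
  let ?c = "norm x"
  have "?c *\<^sub>R sym_one + x \<in> psd" "?c *\<^sub>R sym_one \<in> psd"
    by (rule psd_shift, simp) (simp add: psd_scaleR)
  from has_signed_integral_add[OF has_signed_integral_jump_psd[OF this(1)]
      has_signed_integral_uminus[OF has_signed_integral_jump_psd[OF this(2)]]]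
  have "\<exists>I. has_signed_integral (\<lambda>A. x \<bullet> \<mu> A) f I"
    by (auto simp: inner_add_left)
  then show ?thesis
    using signed_integral_eqI by metis
qed

lemma signed_integral_jump_psd:
  "x \<in> psd \<Longrightarrow> signed_integral (\<lambda>A. x \<bullet> \<mu> A) f = (\<integral>\<xi>. f \<xi> \<partial>jump_measure x)"
  by (rule signed_integral_eqI) (rule has_signed_integral_jump_psd)

lemma linear_signed_integral_jump: "linear (\<lambda>x. signed_integral (\<lambda>A. x \<bullet> \<mu> A) f)"
proof (rule linearI)
  fix x y c
  show "signed_integral (\<lambda>A. (x + y) \<bullet> \<mu> A) f
      = signed_integral (\<lambda>A. x \<bullet> \<mu> A) f + signed_integral (\<lambda>A. y \<bullet> \<mu> A) f"
    using has_signed_integral_add[OF has_signed_integral_jump has_signed_integral_jump]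
    unfolding inner_add_left by (rule signed_integral_eqI)
  show "signed_integral (\<lambda>A. (c *\<^sub>R x) \<bullet> \<mu> A) f = c *\<^sub>R signed_integral (\<lambda>A. x \<bullet> \<mu> A) f"
    using has_signed_integral_scale[OF has_signed_integral_jump]
    unfolding inner_scaleR_left by (rule signed_integral_eqI)
qed

end

lemma matrix_integral_inner:
  assumes f: "f \<in> borel_measurable borel" "\<And>\<xi>. \<xi> \<in> psd \<Longrightarrow> norm (f \<xi>) \<le> C * norm \<xi>"
  shows "matrix_integral \<mu> f \<bullet> x = signed_integral (\<lambda>A. x \<bullet> \<mu> A) f"
proof -
  let ?S = "\<lambda>x. signed_integral (\<lambda>A. x \<bullet> \<mu> A) f"
  have lin: "linear ?S"
    using f by (rule linear_signed_integral_jump)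
  \<comment> \<open>\<open>sym_of\<close> can only be undone on symmetric matrices, so symmetry of
    the entrywise integral comes first.\<close>
  have "transpose (\<chi> i j. signed_integral (\<lambda>A. mat_of (\<mu> A) $ i $ j) f)
      = (\<chi> i j. signed_integral (\<lambda>A. mat_of (\<mu> A) $ i $ j) f)"
  proof -
    have "signed_integral (\<lambda>A. mat_of (\<mu> A) $ i $ j) f = signed_integral (\<lambda>A. mat_of (\<mu> A) $ j $ i) f" for i j
      by (rule arg_cong[of _ _ "\<lambda>\<nu>. signed_integral \<nu> f"]) (rule ext, rule mat_of_sym)
    then show ?thesis
      by (simp add: transpose_def vec_eq_iff)
  qed
  then have entry: "mat_of (matrix_integral \<mu> f) $ i $ j = ?S (sym_unit i j)" for i j
    by (simp add: matrix_integral_def sym_of_inverse inner_sym_unit)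
  have "matrix_integral \<mu> f \<bullet> x = (\<Sum>i\<in>UNIV. \<Sum>j\<in>UNIV. mat_of x $ i $ j * ?S (sym_unit i j))"
    by (simp add: inner_sym_matrix_sum entry mult.commute)
  also have "\<dots> = ?S (\<Sum>i\<in>UNIV. \<Sum>j\<in>UNIV. mat_of x $ i $ j *\<^sub>R sym_unit i j)"
    by (simp only: linear_sum[OF lin] linear_scale[OF lin] real_scaleR_def)
  finally show ?thesis
    by (simp add: sym_unit_representation)
qed

end

section \<open>Limits of Laplace transforms of discrete measures\<close>

text \<open>With \<open>C = {0..}\<close> and \<open>V = psd\<close> these are the Laplace
  transforms of finite discrete measures on the cone. With \<open>C = UNIV\<close> they are signed
  combinations, which serve as the algebra of test functions in the uniqueness proof.\<close>

inductive exp_sum :: "real set \<Rightarrow> 'a::real_inner set \<Rightarrow> ('a \<Rightarrow> real) \<Rightarrow> bool" for C V where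
  zero: "exp_sum C V (\<lambda>u. 0)"
| add_exp: "exp_sum C V g \<Longrightarrow> c \<in> C \<Longrightarrow> v \<in> V \<Longrightarrow> exp_sum C V (\<lambda>u. g u + c * exp (- (u \<bullet> v)))"

lemma exp_sum_add: "exp_sum C V g \<Longrightarrow> exp_sum C V f \<Longrightarrow> exp_sum C V (\<lambda>u. f u + g u)"
proof (induction rule: exp_sum.induct)
  case (add_exp g c v)
  then show ?case
    using exp_sum.add_exp[of C V "\<lambda>u. f u + g u" c v] by (simp add: add.assoc)
qed simp

lemma exp_sum_exp: "c \<in> C \<Longrightarrow> v \<in> V \<Longrightarrow> exp_sum C V (\<lambda>u. c * exp (- (u \<bullet> v)))"
  using exp_sum.add_exp[OF exp_sum.zero] by simp

lemma exp_sum_sum: "(\<And>i. i \<in> I \<Longrightarrow> exp_sum C V (f i)) \<Longrightarrow> exp_sum C V (\<lambda>u. \<Sum>i\<in>I. f i u)"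
  by (induction I rule: infinite_finite_induct) (auto intro: exp_sum_add exp_sum.zero)

text \<open>Convolution of discrete measures: weights multiply and atoms add.\<close>

lemma exp_sum_mult:
  assumes C: "\<And>a b. a \<in> C \<Longrightarrow> b \<in> C \<Longrightarrow> a * b \<in> C"
    and V: "\<And>v w. v \<in> V \<Longrightarrow> w \<in> V \<Longrightarrow> v + w \<in> V"
    and "exp_sum C V g" "exp_sum C V f"
  shows "exp_sum C V (\<lambda>u. f u * g u)"
proof -
  have exp: "exp_sum C V (\<lambda>u. c * exp (- (u \<bullet> v)) * g u)" if "exp_sum C V g" "c \<in> C" "v \<in> V" for g c v
    using that
  proof (induction rule: exp_sum.induct)
    case (add_exp g a w)
    then show ?case
      using exp_sum.add_exp[of C V "\<lambda>u. c * exp (- (u \<bullet> v)) * g u" "c * a" "v + w"] C V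
      by (simp add: distrib_left inner_add_right exp_add[symmetric] algebra_simps)
  qed (simp add: exp_sum.zero)
  show ?thesis
    using assms(3,4)
  proof (induction rule: exp_sum.induct)
    case (add_exp g c v)
    then show ?case
      using exp_sum_add[OF exp[of f c v], of "\<lambda>u. f u * g u"]
      by (simp add: distrib_left mult.commute)
  qed (simp add: exp_sum.zero)
qed

text \<open>
  Working with this closure instead of Laplace transforms of measures avoids transition kernels:
  composition with a Riccati flow needs no measurability in the initial state.
\<close>

definition laplace_limit :: "(('d::finite) sym_matrix \<Rightarrow> real) \<Rightarrow> bool" where
  "laplace_limit L \<longleftrightarrow> (\<forall>U e. finite U \<longrightarrow> U \<subseteq> psd \<longrightarrow> 0 < e \<longrightarrow>
     (\<exists>g. exp_sum {0..} psd g \<and> (\<forall>u\<in>U. \<bar>g u - L u\<bar> < e)))"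

lemma exp_sum_imp_laplace_limit: "exp_sum {0..} psd g \<Longrightarrow> laplace_limit g"
  by (auto simp: laplace_limit_def intro!: exI[of _ g])

lemma laplace_limit_cong:
  "(\<And>u. u \<in> psd \<Longrightarrow> f u = g u) \<Longrightarrow> laplace_limit f \<longleftrightarrow> laplace_limit g"
  unfolding laplace_limit_def
  by (intro arg_cong[of _ _ All] ext imp_cong refl arg_cong[of _ _ Ex] conj_cong ball_cong)
    (auto simp: subset_iff)

lemma laplace_limit_sequence:
  assumes L: "laplace_limit L" and U: "finite U" "U \<subseteq> psd"
  obtains g where "\<And>n::nat. exp_sum {0..} psd (g n)" "\<And>u. u \<in> U \<Longrightarrow> (\<lambda>n. g n u) \<longlonglongrightarrow> L u"
proof -
  have "\<forall>n::nat. \<exists>g. exp_sum {0..} psd g \<and> (\<forall>u\<in>U. \<bar>g u - L u\<bar> < inverse (real (Suc n)))"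
    using L U by (auto simp: laplace_limit_def)
  then obtain g where g: "\<And>n. exp_sum {0..} psd (g n)" "\<And>n u. u \<in> U \<Longrightarrow> \<bar>g n u - L u\<bar> < inverse (real (Suc n))"
    by metis
  have "(\<lambda>n. g n u) \<longlonglongrightarrow> L u" if "u \<in> U" for u
    by (rule LIM_zero_cancel, rule Lim_null_comparison[OF _ LIMSEQ_inverse_real_of_nat])
      (use g(2)[OF that] in \<open>auto intro!: always_eventually less_imp_le\<close>)
  with g(1) that show ?thesis
    by blast
qed

text \<open>An \<open>e / 2\<close> argument. The approximating sequence may depend on the finite
  set \<open>U\<close>; in the applications it is itself chosen by approximation on a finite
  set.\<close>

lemma laplace_limit_closed:
  assumes "\<And>U. finite U \<Longrightarrow> U \<subseteq> psd \<Longrightarrow>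
    \<exists>h. (\<forall>n::nat. laplace_limit (h n)) \<and> (\<forall>u\<in>U. (\<lambda>n. h n u) \<longlonglongrightarrow> L u)"
  shows "laplace_limit L"
  unfolding laplace_limit_def
proof (intro allI impI)
  fix U :: "'a sym_matrix set" and e :: real
  assume U: "finite U" "U \<subseteq> psd" and e: "0 < e"
  obtain h where h: "\<And>n::nat. laplace_limit (h n)" "\<And>u. u \<in> U \<Longrightarrow> (\<lambda>n. h n u) \<longlonglongrightarrow> L u"
    using assms[OF U] by blast
  have "\<forall>\<^sub>F n in sequentially. \<forall>u\<in>U. dist (h n u) (L u) < e / 2"
    using U(1) h(2) e by (intro eventually_ball_finite ballI tendstoD) auto
  then obtain n where n: "\<And>u. u \<in> U \<Longrightarrow> \<bar>h n u - L u\<bar> < e / 2"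
    by (auto simp: eventually_sequentially dist_real_def)
  obtain g where g: "exp_sum {0..} psd g" "\<And>u. u \<in> U \<Longrightarrow> \<bar>g u - h n u\<bar> < e / 2"
    using h(1)[of n] U e unfolding laplace_limit_def by (meson half_gt_zero)
  have "\<bar>g u - L u\<bar> < e" if "u \<in> U" for u
    using n[OF that] g(2)[OF that] by linarith
  with g(1) show "\<exists>g. exp_sum {0..} psd g \<and> (\<forall>u\<in>U. \<bar>g u - L u\<bar> < e)"
    by blast
qed

lemma laplace_limit_lim:
  assumes "\<And>n::nat. laplace_limit (h n)" "\<And>u. u \<in> psd \<Longrightarrow> (\<lambda>n. h n u) \<longlonglongrightarrow> L u"
  shows "laplace_limit L"
  using assms by (intro laplace_limit_closed) (meson subsetD)

lemma laplace_limit_combine: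
  fixes f g :: "('d::finite) sym_matrix \<Rightarrow> real"
  assumes "laplace_limit f" "laplace_limit g"
    and exp_sum: "\<And>f g :: 'd sym_matrix \<Rightarrow> real. exp_sum {0..} psd f \<Longrightarrow> exp_sum {0..} psd g \<Longrightarrow> exp_sum {0..} psd (\<lambda>u. F (f u) (g u))"
    and lim: "\<And>(a :: nat \<Rightarrow> real) b c d. a \<longlonglongrightarrow> c \<Longrightarrow> b \<longlonglongrightarrow> d \<Longrightarrow> (\<lambda>n. F (a n) (b n)) \<longlonglongrightarrow> F c d"
  shows "laplace_limit (\<lambda>u. F (f u) (g u))"
proof (rule laplace_limit_closed)
  fix U :: "'d sym_matrix set"
  assume U: "finite U" "U \<subseteq> psd"
  obtain f' where f': "\<And>n::nat. exp_sum {0..} psd (f' n)" "\<And>u. u \<in> U \<Longrightarrow> (\<lambda>n. f' n u) \<longlonglongrightarrow> f u"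
    using laplace_limit_sequence[OF assms(1) U] by blast
  obtain g' where g': "\<And>n::nat. exp_sum {0..} psd (g' n)" "\<And>u. u \<in> U \<Longrightarrow> (\<lambda>n. g' n u) \<longlonglongrightarrow> g u"
    using laplace_limit_sequence[OF assms(2) U] by blast
  show "\<exists>h. (\<forall>n::nat. laplace_limit (h n)) \<and> (\<forall>u\<in>U. (\<lambda>n. h n u) \<longlonglongrightarrow> F (f u) (g u))"
    using exp_sum_imp_laplace_limit[OF exp_sum[OF f'(1) g'(1)]] lim[OF f'(2) g'(2)]
    by (intro exI[of _ "\<lambda>n u. F (f' n u) (g' n u)"]) blast
qed

lemma laplace_limit_add: "laplace_limit f \<Longrightarrow> laplace_limit g \<Longrightarrow> laplace_limit (\<lambda>u. f u + g u)"
  by (rule laplace_limit_combine[where F = "(+)"]) (auto intro: exp_sum_add tendsto_add)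

lemma laplace_limit_mult: "laplace_limit f \<Longrightarrow> laplace_limit g \<Longrightarrow> laplace_limit (\<lambda>u. f u * g u)"
  by (rule laplace_limit_combine[where F = "(*)"]) (auto intro: exp_sum_mult psd_add tendsto_mult)

lemma laplace_limit_exp: "\<xi> \<in> psd \<Longrightarrow> laplace_limit (\<lambda>u. exp (- (u \<bullet> \<xi>)))"
  using exp_sum_exp[of 1 "{0..}" \<xi> psd] by (simp add: exp_sum_imp_laplace_limit)

lemma laplace_limit_const: "0 \<le> c \<Longrightarrow> laplace_limit (\<lambda>u. c)"
  using exp_sum_imp_laplace_limit[OF exp_sum_exp[of c "{0..}" 0 psd]] by simp

lemma laplace_limit_sum:
  "(\<And>i. i \<in> I \<Longrightarrow> laplace_limit (f i)) \<Longrightarrow> laplace_limit (\<lambda>u. \<Sum>i\<in>I. f i u)"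
  by (induction I rule: infinite_finite_induct) (auto intro: laplace_limit_add laplace_limit_const)

lemma laplace_limit_prod:
  "(\<And>i. i \<in> I \<Longrightarrow> laplace_limit (f i)) \<Longrightarrow> laplace_limit (\<lambda>u. \<Prod>i\<in>I. f i u)"
  by (induction I rule: infinite_finite_induct) (auto intro: laplace_limit_mult laplace_limit_const)

lemma laplace_limit_power: "laplace_limit f \<Longrightarrow> laplace_limit (\<lambda>u. f u ^ n)"
  by (induction n) (auto intro: laplace_limit_mult laplace_limit_const)

text \<open>The transform of a compound Poisson law with rate \<open>c\<close> whose jumps have
  transform \<open>f\<close>: \<open>exp (- c)\<close> times the exponential series of
  \<open>c * f\<close>, all of whose coefficients are nonnegative.\<close>

lemma laplace_limit_poisson:
  assumes "laplace_limit f" "0 \<le> c"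
  shows "laplace_limit (\<lambda>u. exp (- (c * (1 - f u))))"
proof -
  have "laplace_limit (\<lambda>u. exp (c * f u))"
  proof (rule laplace_limit_lim)
    show "laplace_limit (\<lambda>u. \<Sum>k<n. inverse (fact k) * (c * f u) ^ k)" for n
      using assms by (intro laplace_limit_sum laplace_limit_mult laplace_limit_power laplace_limit_const) simp_all
    show "(\<lambda>n. \<Sum>k<n. inverse (fact k) * (c * f u) ^ k) \<longlonglongrightarrow> exp (c * f u)" for u
      using exp_converges[of "c * f u"] by (simp add: sums_def)
  qed
  then have "laplace_limit (\<lambda>u. exp (- c) * exp (c * f u))"
    by (intro laplace_limit_mult laplace_limit_const) simp_all
  then show ?thesis
    by (simp add: exp_add[symmetric] algebra_simps)
qed

text \<open>Substituting \<open>g\<close> into a discrete transform gives a nonnegative combination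
  of the functions \<open>exp (- (g u \<bullet> \<xi>))\<close>, and \<open>L\<close> only has to be
  approximated on the finite image of \<open>U\<close>. This is the Chapman-Kolmogorov composition
  on the level of exponents.\<close>

lemma laplace_limit_compose:
  fixes g :: "('d::finite) sym_matrix \<Rightarrow> 'd sym_matrix"
  assumes L: "laplace_limit L" and g: "\<And>u. u \<in> psd \<Longrightarrow> g u \<in> psd"
    and exp: "\<And>\<xi>. \<xi> \<in> psd \<Longrightarrow> laplace_limit (\<lambda>u. exp (- (g u \<bullet> \<xi>)))"
  shows "laplace_limit (\<lambda>u. L (g u))"
proof (rule laplace_limit_closed)
  fix U :: "'d sym_matrix set"
  assume U: "finite U" "U \<subseteq> psd"
  have fin: "laplace_limit (\<lambda>u. f (g u))" if "exp_sum {0..} psd f" for f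
    using that
  proof induction
    case (add_exp f c \<xi>)
    then show ?case
      by (intro laplace_limit_add laplace_limit_mult laplace_limit_const exp) simp_all
  qed (simp add: laplace_limit_const)
  obtain f where f: "\<And>n::nat. exp_sum {0..} psd (f n)" "\<And>u. u \<in> g ` U \<Longrightarrow> (\<lambda>n. f n u) \<longlonglongrightarrow> L u"
    using laplace_limit_sequence[OF L, of "g ` U"] U g by auto
  then show "\<exists>h. (\<forall>n::nat. laplace_limit (h n)) \<and> (\<forall>u\<in>U. (\<lambda>n. h n u) \<longlonglongrightarrow> L (g u))"
    using fin by (intro exI[of _ "\<lambda>n u. f n (g u)"]) auto
qed

section \<open>Compound Poisson laws and mixtures\<close>

lemma one_minus_exp_bounds: "0 \<le> (z::real) \<Longrightarrow> 0 \<le> 1 - exp (- z) \<and> 1 - exp (- z) \<le> z"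
  using exp_ge_add_one_self[of "- z"] by simp

text \<open>Finiteness is asked only where \<open>h\<close> does not vanish: a jump measure may be
  infinite near the origin, but there the simple function may be 0 and
  \<open>1 - exp (- (u \<bullet> 0))\<close> vanishes.\<close>

lemma integral_simple_range:
  fixes h :: "'b \<Rightarrow> real"
  assumes s: "simple_function M s"
    and fin: "\<And>y. y \<in> s ` space M \<Longrightarrow> h y \<noteq> 0 \<Longrightarrow> emeasure M (s -` {y} \<inter> space M) < \<infinity>"
  shows "(\<integral>x. h (s x) \<partial>M) = (\<Sum>y\<in>s ` space M. h y * measure M (s -` {y} \<inter> space M))"
proof -
  have range: "finite (s ` space M)"
    using s by (rule simple_functionD)
  have sets: "s -` {y} \<inter> space M \<in> sets M" for y
    using s by (rule simple_functionD)
  have int: "integrable M (\<lambda>x. h y * indicator (s -` {y} \<inter> space M) x)" if "y \<in> s ` space M" for y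
    using fin[OF that] sets by (cases "h y = 0") (auto simp: integrable_indicator_iff)
  have "(\<integral>x. h (s x) \<partial>M) = (\<integral>x. (\<Sum>y\<in>s ` space M. h y * indicator (s -` {y} \<inter> space M) x) \<partial>M)"
  proof (rule Bochner_Integration.integral_cong[OF refl])
    fix x
    assume x: "x \<in> space M"
    have "(\<Sum>y\<in>s ` space M. h y * indicator (s -` {y} \<inter> space M) x)
        = (\<Sum>y\<in>s ` space M. if y = s x then h y else 0)"
      using x by (intro sum.cong refl) (auto simp: indicator_def)
    also have "\<dots> = h (s x)"
      using range x by (simp add: sum.delta)
    finally show "h (s x) = (\<Sum>y\<in>s ` space M. h y * indicator (s -` {y} \<inter> space M) x)"
      by simp
  qed
  also have "\<dots> = (\<Sum>y\<in>s ` space M. h y * measure M (s -` {y} \<inter> space M))"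
    using int sets by (subst Bochner_Integration.integral_sum) (auto intro!: sum.cong)
  finally show ?thesis .
qed

text \<open>Ordinary simple approximants may leave the cone. The nearest-point projection brings
  them back; it is 1-Lipschitz and fixes both 0 and the points of the cone, so the norm bound and
  the limit survive.\<close>

lemma psd_simple_approximation:
  fixes \<nu> :: "('d::finite) sym_matrix measure"
  assumes id: "(\<lambda>\<xi>. \<xi>) \<in> borel_measurable \<nu>" and space: "space \<nu> \<subseteq> psd"
  obtains s :: "nat \<Rightarrow> 'd sym_matrix \<Rightarrow> 'd sym_matrix" where "\<And>i. simple_function \<nu> (s i)" "\<And>i x. s i x \<in> psd"
    "\<And>i x. x \<in> space \<nu> \<Longrightarrow> norm (s i x) \<le> 2 * norm x" "\<And>x. x \<in> space \<nu> \<Longrightarrow> (\<lambda>i. s i x) \<longlonglongrightarrow> x"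
proof -
  obtain F :: "nat \<Rightarrow> 'd sym_matrix \<Rightarrow> 'd sym_matrix" where F: "\<And>i. simple_function \<nu> (F i)"
    "\<And>x. x \<in> space \<nu> \<Longrightarrow> (\<lambda>i. F i x) \<longlonglongrightarrow> x"
    "\<And>i x. x \<in> space \<nu> \<Longrightarrow> dist (F i x) 0 \<le> 2 * dist x 0"
    using borel_measurable_implies_sequence_metric[OF id, of 0] by blast
  show ?thesis
  proof (rule that[of "\<lambda>i x. closest_point psd (F i x)"])
    show "simple_function \<nu> (\<lambda>x. closest_point psd (F i x))" for i
      using simple_function_compose1[OF F(1)] by auto
    show "closest_point psd (F i x) \<in> psd" for i x
      using closed_psd by (rule closest_point_in_set) (use psd_0 in blast)
    fix x
    assume x: "x \<in> space \<nu>"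
    have "dist (closest_point psd (F i x)) (closest_point psd 0) \<le> dist (F i x) 0" for i
      using convex_psd closed_psd
      by (rule closest_point_lipschitz) (use psd_0 in blast)
    from order_trans[OF this F(3)[OF x]] show "norm (closest_point psd (F i x)) \<le> 2 * norm x" for i
      by (simp add: closest_point_self dist_norm)
    have "isCont (closest_point psd) x"
      using convex_psd closed_psd by (rule continuous_at_closest_point) (use psd_0 in blast)
    from isCont_tendsto_compose[OF this F(2)[OF x]] show "(\<lambda>i. closest_point psd (F i x)) \<longlonglongrightarrow> x"
      using x space by (auto simp: closest_point_self)
  qed
qed

text \<open>\<open>\<nu>\<close> may be infinite, so the law need not have a finite jump rate.
  Replacing \<open>\<xi>\<close> by simple approximants turns the transform into a finite product of
  Poisson factors, and the exponents converge by domination with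
  \<open>2 * norm u * norm \<xi>\<close>.\<close>

lemma laplace_limit_compound_poisson:
  fixes \<nu> :: "('d::finite) sym_matrix measure"
  assumes sets: "sets \<nu> = sets jump_space" and int: "integrable \<nu> norm"
  shows "laplace_limit (\<lambda>u. exp (- (\<integral>\<xi>. 1 - exp (- (u \<bullet> \<xi>)) \<partial>\<nu>)))"
proof -
  have "space \<nu> = psd - {0}"
    using sets_eq_imp_space_eq[OF sets] by (simp add: space_restrict_space)
  then have space: "space \<nu> \<subseteq> psd"
    by blast
  have id: "(\<lambda>\<xi>. \<xi>) \<in> borel_measurable \<nu>"
    unfolding measurable_cong_sets[OF sets refl] by (rule measurable_restrict_space1) simp
  obtain s where simple: "\<And>i::nat. simple_function \<nu> (s i)" and psd: "\<And>i x. s i x \<in> psd"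
    and norm: "\<And>i x. x \<in> space \<nu> \<Longrightarrow> norm (s i x) \<le> 2 * norm x"
    and lim: "\<And>x. x \<in> space \<nu> \<Longrightarrow> (\<lambda>i. s i x) \<longlonglongrightarrow> x"
    by (rule psd_simple_approximation[OF id space]) blast
  have [measurable]: "s i \<in> borel_measurable \<nu>" for i
    using simple by (rule borel_measurable_simple_function)
  have bound: "integrable \<nu> (\<lambda>x. 2 * norm x)"
    using int by simp
  have int_s: "integrable \<nu> (s i)" for i
    by (rule Bochner_Integration.integrable_bound[OF bound]) (use norm in auto)
  have fin: "emeasure \<nu> (s i -` {y} \<inter> space \<nu>) < \<infinity>" if "y \<noteq> 0" for i y
  proof -
    have A: "s i -` {y} \<inter> space \<nu> \<in> sets \<nu>"
      using simple by (rule simple_functionD)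
    have "integrable \<nu> (indicator (s i -` {y} \<inter> space \<nu>) :: _ \<Rightarrow> real)"
    proof (rule Bochner_Integration.integrable_bound)
      \<comment> \<open>Markov's inequality: on the level set of \<open>y\<close> this function has
        norm 1.\<close>
      show "integrable \<nu> (\<lambda>x. inverse (norm y) *\<^sub>R s i x)"
        by (intro integrable_scaleR_right int_s)
      show "indicator (s i -` {y} \<inter> space \<nu>) \<in> borel_measurable \<nu>"
        using A by measurable
      show "AE x in \<nu>. norm (indicator (s i -` {y} \<inter> space \<nu>) x :: real) \<le> norm (inverse (norm y) *\<^sub>R s i x)"
        using that by (intro AE_I2) (auto simp: indicator_def)
    qed
    then show ?thesis
      using A by (simp add: integrable_indicator_iff)
  qed
  show ?thesis
  proof (rule laplace_limit_lim)
    fix n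
    have "(\<integral>\<xi>. 1 - exp (- (u \<bullet> s n \<xi>)) \<partial>\<nu>)
        = (\<Sum>y\<in>s n ` space \<nu>. (1 - exp (- (u \<bullet> y))) * measure \<nu> (s n -` {y} \<inter> space \<nu>))" for u
      by (rule integral_simple_range[OF simple]) (rule fin, auto)
    then have "exp (- (\<integral>\<xi>. 1 - exp (- (u \<bullet> s n \<xi>)) \<partial>\<nu>))
        = (\<Prod>y\<in>s n ` space \<nu>. exp (- (measure \<nu> (s n -` {y} \<inter> space \<nu>) * (1 - exp (- (u \<bullet> y))))))" for u
      using simple_functionD(1)[OF simple, of n] by (simp add: exp_sum mult.commute flip: sum_negf)
    then show "laplace_limit (\<lambda>u. exp (- (\<integral>\<xi>. 1 - exp (- (u \<bullet> s n \<xi>)) \<partial>\<nu>)))"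
      using psd by (auto intro!: laplace_limit_prod laplace_limit_poisson laplace_limit_exp)
  next
    fix u :: "'d sym_matrix"
    assume u: "u \<in> psd"
    have "(\<lambda>n. \<integral>\<xi>. 1 - exp (- (u \<bullet> s n \<xi>)) \<partial>\<nu>) \<longlonglongrightarrow> (\<integral>\<xi>. 1 - exp (- (u \<bullet> \<xi>)) \<partial>\<nu>)"
    proof (rule integral_dominated_convergence)
      show "integrable \<nu> (\<lambda>x. norm u * (2 * norm x))"
        using bound by simp
      show "(\<lambda>\<xi>. 1 - exp (- (u \<bullet> \<xi>))) \<in> borel_measurable \<nu>"
        using id by measurable
      show "(\<lambda>\<xi>. 1 - exp (- (u \<bullet> s n \<xi>))) \<in> borel_measurable \<nu>" for n
        by measurable
      show "AE \<xi> in \<nu>. (\<lambda>n. 1 - exp (- (u \<bullet> s n \<xi>))) \<longlonglongrightarrow> 1 - exp (- (u \<bullet> \<xi>))"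
        using lim by (intro AE_I2 tendsto_intros) auto
      show "AE \<xi> in \<nu>. norm (1 - exp (- (u \<bullet> s n \<xi>))) \<le> norm u * (2 * norm \<xi>)" for n
      proof (rule AE_I2)
        fix \<xi>
        assume \<xi>: "\<xi> \<in> space \<nu>"
        have "0 \<le> u \<bullet> s n \<xi>"
          using psd u by (rule psd_inner_nonneg)
        moreover have "u \<bullet> s n \<xi> \<le> norm u * (2 * norm \<xi>)"
          using norm_cauchy_schwarz[of u "s n \<xi>"] mult_left_mono[OF norm[OF \<xi>, of n] norm_ge_zero[of u]]
          by linarith
        ultimately show "norm (1 - exp (- (u \<bullet> s n \<xi>))) \<le> norm u * (2 * norm \<xi>)"
          using one_minus_exp_bounds[of "u \<bullet> s n \<xi>"] by simp
      qed
    qed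
    then show "(\<lambda>n. exp (- (\<integral>\<xi>. 1 - exp (- (u \<bullet> s n \<xi>)) \<partial>\<nu>))) \<longlonglongrightarrow> exp (- (\<integral>\<xi>. 1 - exp (- (u \<bullet> \<xi>)) \<partial>\<nu>))"
      by (intro tendsto_intros)
  qed
qed

text \<open>Averages over a random initial state. Since \<open>q\<close> is approximated by laws
  with finitely many atoms, no kernel measurable in \<open>\<xi>\<close> has to be built.\<close>

lemma laplace_limit_mixture:
  fixes g :: "('d::finite) sym_matrix \<Rightarrow> 'd sym_matrix"
  assumes q: "prob_space q" "sets q = sets psd_space"
    and g: "\<And>u. u \<in> psd \<Longrightarrow> g u \<in> psd"
    and exp: "\<And>\<xi>. \<xi> \<in> psd \<Longrightarrow> laplace_limit (\<lambda>u. exp (- (g u \<bullet> \<xi>)))"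
  shows "laplace_limit (\<lambda>u. \<integral>\<xi>. exp (- (g u \<bullet> \<xi>)) \<partial>q)"
proof -
  interpret prob_space q by fact
  have space: "space q = psd"
    using sets_eq_imp_space_eq[OF q(2)] by (simp add: space_restrict_space)
  have id: "(\<lambda>\<xi>. \<xi>) \<in> borel_measurable q"
    unfolding measurable_cong_sets[OF q(2) refl] by (rule measurable_restrict_space1) simp
  obtain s where simple: "\<And>i::nat. simple_function q (s i)" and psd: "\<And>i x. s i x \<in> psd"
    and lim: "\<And>x. x \<in> space q \<Longrightarrow> (\<lambda>i. s i x) \<longlonglongrightarrow> x"
    by (rule psd_simple_approximation[OF id]) (use space in blast)+
  have [measurable]: "s i \<in> borel_measurable q" for i
    using simple by (rule borel_measurable_simple_function)
  show ?thesis
  proof (rule laplace_limit_lim)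
    fix n
    have "(\<integral>\<xi>. exp (- (g u \<bullet> s n \<xi>)) \<partial>q)
        = (\<Sum>y\<in>s n ` space q. exp (- (g u \<bullet> y)) * measure q (s n -` {y} \<inter> space q))" for u
      by (rule integral_simple_range[OF simple]) (simp add: emeasure_eq_measure)
    then show "laplace_limit (\<lambda>u. \<integral>\<xi>. exp (- (g u \<bullet> s n \<xi>)) \<partial>q)"
      using psd by (auto intro!: laplace_limit_sum laplace_limit_mult laplace_limit_const exp)
  next
    fix u :: "'d sym_matrix"
    assume "u \<in> psd"
    then have gu: "g u \<in> psd"
      by (rule g)
    show "(\<lambda>n. \<integral>\<xi>. exp (- (g u \<bullet> s n \<xi>)) \<partial>q) \<longlonglongrightarrow> (\<integral>\<xi>. exp (- (g u \<bullet> \<xi>)) \<partial>q)"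
    proof (rule integral_dominated_convergence[where w = "\<lambda>_. 1"])
      show "(\<lambda>\<xi>. exp (- (g u \<bullet> \<xi>))) \<in> borel_measurable q"
        using id by measurable
      show "AE \<xi> in q. (\<lambda>n. exp (- (g u \<bullet> s n \<xi>))) \<longlonglongrightarrow> exp (- (g u \<bullet> \<xi>))"
        using lim by (intro AE_I2 tendsto_intros) auto
      show "AE \<xi> in q. norm (exp (- (g u \<bullet> s n \<xi>))) \<le> 1" for n
        using psd_inner_nonneg[OF psd gu] by simp
    qed auto
  qed
qed

section \<open>Weak compactness on a cube\<close>

text \<open>Ceilings select the expansion that ends in ones at dyadic points. It represents every
  number of the half-open interval from 0 to 1, including 1 itself; the exponential coordinates used
  later lie in that interval.\<close>

definition binary_digit :: "nat \<Rightarrow> real \<Rightarrow> real" where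
  "binary_digit j x = of_int (\<lceil>2 ^ Suc j * x\<rceil> - 2 * \<lceil>2 ^ j * x\<rceil> + 1)"

lemma binary_digit_cases: "binary_digit j x \<in> {0, 1}"
proof -
  have "\<lceil>2 * y\<rceil> = 2 * \<lceil>y\<rceil> \<or> \<lceil>2 * y\<rceil> = 2 * \<lceil>y\<rceil> - 1" for y :: real
    by linarith
  from this[of "2 ^ j * x"] show ?thesis
    by (auto simp: binary_digit_def mult.assoc)
qed

lemma binary_digit_sums:
  assumes "0 < x" "x \<le> 1"
  shows "(\<lambda>j. binary_digit j x / 2 ^ Suc j) sums x"
proof -
  \<comment> \<open>The ceilings telescope to
    \<open>\<lceil>2 ^ n * x\<rceil> / 2 ^ n - \<lceil>x\<rceil>\<close>, the added ones contribute
    \<open>1 - 1 / 2 ^ n\<close>, and \<open>\<lceil>x\<rceil> = 1\<close>.\<close>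
  have partial: "(\<Sum>j<n. binary_digit j x / 2 ^ Suc j) = (of_int \<lceil>2 ^ n * x\<rceil> - 1) / 2 ^ n" for n
  proof (induction n)
    case 0
    have "\<lceil>x\<rceil> = 1"
      using assms by (simp add: ceiling_eq_iff)
    then show ?case by simp
  next
    case (Suc n)
    then show ?case
      by (simp add: binary_digit_def divide_simps)
  qed
  have "(\<lambda>n. (of_int \<lceil>2 ^ n * x\<rceil> - 1) / 2 ^ n) \<longlonglongrightarrow> x"
  proof (rule tendsto_sandwich)
    have *: "2 ^ n * x - 1 \<le> of_int \<lceil>2 ^ n * x\<rceil> - 1 \<and> of_int \<lceil>2 ^ n * x\<rceil> - 1 \<le> 2 ^ n * x" for n :: nat
      by linarith
    show "\<forall>\<^sub>F n in sequentially. x - (1 / 2) ^ n \<le> (of_int \<lceil>2 ^ n * x\<rceil> - 1) / 2 ^ n"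
    proof (intro always_eventually allI)
      fix n :: nat
      from * have "(2 ^ n * x - 1) / 2 ^ n \<le> (of_int \<lceil>2 ^ n * x\<rceil> - 1) / 2 ^ n"
        by (intro divide_right_mono) auto
      then show "x - (1 / 2) ^ n \<le> (of_int \<lceil>2 ^ n * x\<rceil> - 1) / 2 ^ n"
        by (simp add: diff_divide_distrib power_one_over)
    qed
    show "\<forall>\<^sub>F n in sequentially. (of_int \<lceil>2 ^ n * x\<rceil> - 1) / 2 ^ n \<le> x"
    proof (intro always_eventually allI)
      fix n :: nat
      from * have "(of_int \<lceil>2 ^ n * x\<rceil> - 1) / 2 ^ n \<le> (2 ^ n * x) / 2 ^ n"
        by (intro divide_right_mono) auto
      then show "(of_int \<lceil>2 ^ n * x\<rceil> - 1) / 2 ^ n \<le> x"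
        by simp
    qed
    show "(\<lambda>n. x - (1 / 2) ^ n) \<longlonglongrightarrow> x"
      by (rule tendsto_eq_intros LIMSEQ_power_zero | simp)+
  qed simp
  then show ?thesis
    unfolding sums_def partial .
qed

text \<open>
  Digits \<open>0\<close> and \<open>1\<close> in base 4 leave gaps: shifted by \<open>1/3\<close>, the scaled numbers stay away from the
  integers, so that each digit is a continuous function of the encoded number.
\<close>

definition base4_digit :: "nat \<Rightarrow> real \<Rightarrow> real" where
  "base4_digit k y = of_int (\<lfloor>4 ^ Suc k * y + 1 / 3\<rfloor> - 4 * \<lfloor>4 ^ k * y + 1 / 3\<rfloor>)"

text \<open>Stated for the number alone, without a digit sequence, so that it is a measurable
  property and passes from one random variable to another with the same law.\<close>

definition base4_sparse :: "real \<Rightarrow> bool" where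
  "base4_sparse y \<longleftrightarrow> (\<forall>k. 1 / 3 \<le> frac (4 ^ k * y + 1 / 3) \<and> frac (4 ^ k * y + 1 / 3) \<le> 2 / 3
     \<and> base4_digit k y \<in> {0, 1})"

definition base4_encode :: "(nat \<Rightarrow> real) \<Rightarrow> real" where
  "base4_encode a = (\<Sum>k. a k / 4 ^ Suc k)"

lemma base4_summable:
  assumes "\<And>k. a k \<in> {0, 1 :: real}"
  shows "summable (\<lambda>k. a k / 4 ^ Suc k)" "base4_encode a \<in> {0 .. 1 / 3}"
proof -
  have geo: "(\<lambda>k. 1 / 4 ^ Suc k) sums (1 / 3 :: real)"
    using sums_mult[OF geometric_sums[of "1 / 4 :: real"], of "1 / 4"] by (simp add: power_one_over)
  have a: "0 \<le> a k \<and> a k \<le> 1" for k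
    using assms[of k] by auto
  show "summable (\<lambda>k. a k / 4 ^ Suc k)"
    by (rule summable_comparison_test'[OF sums_summable[OF geo], of 0])
      (use a in \<open>auto simp: divide_right_mono\<close>)
  then have "0 \<le> base4_encode a" "base4_encode a \<le> (\<Sum>k. 1 / 4 ^ Suc k)"
    unfolding base4_encode_def using a
    by (auto intro!: suminf_nonneg suminf_le sums_summable[OF geo] divide_right_mono
        simp del: power_Suc)
  then show "base4_encode a \<in> {0 .. 1 / 3}"
    using sums_unique[OF geo] by simp
qed

lemma base4_encode_shift:
  assumes a: "\<And>k. a k \<in> {0, 1 :: real}"
  shows "4 * base4_encode a = a 0 + base4_encode (\<lambda>k. a (Suc k))"
proof -
  have "base4_encode a = a 0 / 4 + (\<Sum>k. a (Suc k) / 4 ^ Suc (Suc k))"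
    unfolding base4_encode_def using suminf_split_head[of "\<lambda>k. a k / 4 ^ Suc k", OF base4_summable(1)] a by simp
  also have "(\<Sum>k. a (Suc k) / 4 ^ Suc (Suc k)) = (\<Sum>k. a (Suc k) / 4 ^ Suc k) / 4"
    using suminf_divide[OF base4_summable(1)[of "\<lambda>k. a (Suc k)"], of 4] a by (simp add: mult.commute)
  finally show ?thesis
    by (simp add: base4_encode_def)
qed

lemma base4_encode_scaled:
  assumes a: "\<And>k. a k \<in> {0, 1 :: real}"
  shows "\<exists>A :: int. 4 ^ k * base4_encode a = of_int A + base4_encode (\<lambda>i. a (k + i))"
proof (induction k)
  case 0
  show ?case
    by (rule exI[of _ 0]) simp
next
  case (Suc k)
  then obtain A :: int where "4 ^ k * base4_encode a = of_int A + base4_encode (\<lambda>i. a (k + i))"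
    by blast
  then have "4 ^ Suc k * base4_encode a = 4 * of_int A + 4 * base4_encode (\<lambda>i. a (k + i))"
    by simp
  also have "4 * base4_encode (\<lambda>i. a (k + i)) = a k + base4_encode (\<lambda>i. a (Suc k + i))"
    using base4_encode_shift[of "\<lambda>i. a (k + i)"] a by simp
  finally show ?case
    using a[of k] by (intro exI[of _ "4 * A + (if a k = 0 then 0 else 1)"]) auto
qed

text \<open>Multiplied by \<open>4 ^ k\<close>, the encoded number is an integer plus a tail between
  0 and 1/3. The shift by 1/3 puts the fractional part between 1/3 and 2/3, so the floor recovers
  the integer, and consecutive floors give the digit.\<close>

lemma
  assumes a: "\<And>k. a k \<in> {0, 1 :: real}"
  shows base4_digit_encode: "base4_digit k (base4_encode a) = a k"
    and base4_sparse_encode: "base4_sparse (base4_encode a)"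
proof -
  let ?y = "base4_encode a"
  have tail: "base4_encode (\<lambda>i. a (k + i)) \<in> {0 .. 1 / 3}" for k
    by (rule base4_summable(2)) (rule a)
  have floor: "of_int \<lfloor>4 ^ k * ?y + 1 / 3\<rfloor> = 4 ^ k * ?y - base4_encode (\<lambda>i. a (k + i))" for k
  proof -
    obtain A :: int where A: "4 ^ k * ?y = of_int A + base4_encode (\<lambda>i. a (k + i))"
      using base4_encode_scaled[of a k] a by blast
    then have "\<lfloor>4 ^ k * ?y + 1 / 3\<rfloor> = A"
      using tail[of k] by (simp add: floor_eq_iff)
    with A show ?thesis by simp
  qed
  show digit: "base4_digit k ?y = a k" for k
  proof -
    have "base4_digit k ?y = 4 * base4_encode (\<lambda>i. a (k + i)) - base4_encode (\<lambda>i. a (Suc k + i))"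
      unfolding base4_digit_def of_int_diff of_int_mult floor by simp
    also have "\<dots> = a k"
      using base4_encode_shift[of "\<lambda>i. a (k + i)"] a by simp
    finally show ?thesis .
  qed
  show "base4_sparse ?y"
    unfolding base4_sparse_def frac_def floor digit using tail a by auto
qed

text \<open>Scaled members of the sequence stay at distance at least 1/3 from the integers. Once
  they are within 1/6 of the scaled limit, both have the same floor, so each digit is eventually
  constant.\<close>

lemma tendsto_base4_digit:
  assumes Y: "Y \<longlonglongrightarrow> y" and sparse: "\<And>n. base4_sparse (Y n)"
  shows "(\<lambda>n. base4_digit k (Y n)) \<longlonglongrightarrow> base4_digit k y"
proof -
  have *: "\<forall>\<^sub>F n in sequentially. \<lfloor>4 ^ k * Y n + 1 / 3\<rfloor> = \<lfloor>4 ^ k * y + 1 / 3\<rfloor>" for k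
  proof -
    have "(\<lambda>n. 4 ^ k * Y n + 1 / 3) \<longlonglongrightarrow> 4 ^ k * y + 1 / 3"
      by (intro tendsto_intros Y)
    then have "\<forall>\<^sub>F n in sequentially. dist (4 ^ k * Y n + 1 / 3) (4 ^ k * y + 1 / 3) < 1 / 6"
      by (rule tendstoD) simp
    then show ?thesis
    proof eventually_elim
      case (elim n)
      have "1 / 3 \<le> frac (4 ^ k * Y n + 1 / 3)" "frac (4 ^ k * Y n + 1 / 3) \<le> 2 / 3"
        using sparse[of n] by (auto simp: base4_sparse_def)
      then have "of_int \<lfloor>4 ^ k * Y n + 1 / 3\<rfloor> \<le> 4 ^ k * y + 1 / 3"
        "4 ^ k * y + 1 / 3 < of_int \<lfloor>4 ^ k * Y n + 1 / 3\<rfloor> + 1"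
        using elim unfolding frac_def dist_real_def by linarith+
      then show ?case
        by (metis floor_eq_iff)
    qed
  qed
  have "\<forall>\<^sub>F n in sequentially. base4_digit k (Y n) = base4_digit k y"
    using *[of k] *[of "Suc k"] by eventually_elim (simp only: base4_digit_def)
  then show ?thesis
    by (rule tendsto_eventually)
qed

text \<open>The pairing function interleaves the binary digits of all coordinates. Indices
  \<open>i\<close> beyond the dimension repeat digits of some coordinate; \<open>cube_decode\<close>
  never reads those positions.\<close>

definition cube_encode :: "'a::euclidean_space \<Rightarrow> real" where
  "cube_encode x = base4_encode (\<lambda>k. case prod_decode k of
     (i, j) \<Rightarrow> binary_digit j (x \<bullet> from_nat_into Basis i))"

definition cube_decode :: "real \<Rightarrow> 'a::euclidean_space" where
  "cube_decode y = (\<Sum>b\<in>Basis. (\<Sum>j. base4_digit (prod_encode (to_nat_on Basis b, j)) y / 2 ^ Suc j) *\<^sub>R b)"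

lemma cube_encode_digits: 
  "(case prod_decode k of (i, j) \<Rightarrow> binary_digit j (x \<bullet> from_nat_into Basis i)) \<in> {0, 1}"
  using binary_digit_cases by (simp split: prod.split)

lemma cube_decode_encode:
  fixes x :: "'a::euclidean_space"
  assumes "\<forall>b\<in>Basis. 0 < x \<bullet> b \<and> x \<bullet> b \<le> 1"
  shows "cube_decode (cube_encode x) = x"
proof -
  have "cube_decode (cube_encode x) = (\<Sum>b\<in>Basis. (\<Sum>j. binary_digit j (x \<bullet> b) / 2 ^ Suc j) *\<^sub>R b)"
    unfolding cube_decode_def cube_encode_def base4_digit_encode[OF cube_encode_digits]
    by (intro sum.cong refl) (simp add: countable_finite)
  also have "\<dots> = (\<Sum>b\<in>Basis. (x \<bullet> b) *\<^sub>R b)"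
    using assms by (intro sum.cong refl) (simp add: sums_unique[OF binary_digit_sums, symmetric] del: power_Suc)
  also have "\<dots> = x"
    by (rule euclidean_representation)
  finally show ?thesis .
qed

lemma base4_sparse_cube_encode: "base4_sparse (cube_encode x)"
  unfolding cube_encode_def by (rule base4_sparse_encode) (rule cube_encode_digits)

lemma cube_encode_bounds: "cube_encode x \<in> {0 .. 1 / 3}"
  unfolding cube_encode_def by (rule base4_summable(2)) (rule cube_encode_digits)

lemma measurable_cube_encode [measurable]: "cube_encode \<in> borel_measurable borel"
proof -
  have "(\<lambda>x. case prod_decode k of (i, j) \<Rightarrow> binary_digit j (x \<bullet> from_nat_into Basis i)) \<in> borel_measurable borel" for k
    unfolding binary_digit_def by (cases "prod_decode k") simp
  then show ?thesis
    unfolding cube_encode_def base4_encode_def by measurable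
qed

lemma measurable_base4_digit [measurable]: "base4_digit k \<in> borel_measurable borel"
  unfolding base4_digit_def by measurable

lemma measurable_cube_decode [measurable]: "cube_decode \<in> borel_measurable borel"
  unfolding cube_decode_def by measurable

lemma pred_base4_sparse [measurable]: "Measurable.pred borel base4_sparse"
  unfolding base4_sparse_def frac_def by measurable

text \<open>Every digit converges, and the digits of the sequence are 0 or 1, so the series are
  dominated by a geometric one. Convergence of codes hence gives convergence of the encoded
  vectors.\<close>

lemma tendsto_cube_decode:
  assumes Y: "Y \<longlonglongrightarrow> y" and sparse: "\<And>n. base4_sparse (Y n)"
  shows "(\<lambda>n. cube_decode (Y n)) \<longlonglongrightarrow> cube_decode y"
  unfolding cube_decode_def
proof (intro tendsto_sum tendsto_scaleR tendsto_const)
  fix b :: 'a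
  let ?k = "\<lambda>j. prod_encode (to_nat_on Basis b, j)"
  have "eventually (\<lambda>n. summable (\<lambda>j. norm (base4_digit (?k j) (Y n) / 2 ^ Suc j))) sequentially \<and>
    summable (\<lambda>j. norm (base4_digit (?k j) y / 2 ^ Suc j)) \<and>
    (\<lambda>n. \<Sum>j. base4_digit (?k j) (Y n) / 2 ^ Suc j) \<longlonglongrightarrow> (\<Sum>j. base4_digit (?k j) y / 2 ^ Suc j)"
  proof (rule tannerys_theorem)
    show "(\<lambda>n. base4_digit (?k j) (Y n) / 2 ^ Suc j) \<longlonglongrightarrow> base4_digit (?k j) y / 2 ^ Suc j" for j
      by (intro tendsto_intros tendsto_base4_digit assms) simp
    have "norm (base4_digit (?k j) (Y n) / 2 ^ Suc j) \<le> (1 / 2) ^ Suc j" for j n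
    proof -
      have "base4_digit (?k j) (Y n) \<in> {0, 1}"
        using sparse[of n] by (auto simp: base4_sparse_def)
      then show ?thesis
        by (auto simp: power_one_over)
    qed
    then show "\<forall>\<^sub>F (j, n) in sequentially \<times>\<^sub>F sequentially.
        norm (base4_digit (?k j) (Y n) / 2 ^ Suc j) \<le> (1 / 2) ^ Suc j"
      by (intro always_eventually) auto
    show "summable (\<lambda>j. (1 / 2 :: real) ^ Suc j)"
      by simp
  qed simp
  then show "(\<lambda>n. \<Sum>j. base4_digit (?k j) (Y n) / 2 ^ Suc j) \<longlonglongrightarrow> (\<Sum>j. base4_digit (?k j) y / 2 ^ Suc j)"
    by blast
qed

text \<open>
  The cube is encoded into the real line, where Helly's selection theorem and Skorohod's
  representation are available.
\<close>

theorem cube_convergent_subsequence: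
  fixes P :: "nat \<Rightarrow> 'a::euclidean_space measure"
  assumes prob: "\<And>n. prob_space (P n)" and sets: "\<And>n. sets (P n) = sets borel"
    and cube: "\<And>n. AE x in P n. \<forall>b\<in>Basis. 0 < x \<bullet> b \<and> x \<bullet> b \<le> 1"
  obtains r :: "nat \<Rightarrow> nat" and \<Omega> :: "real measure" and X :: "nat \<Rightarrow> real \<Rightarrow> 'a" and Z :: "real \<Rightarrow> 'a"
  where "strict_mono r" "prob_space \<Omega>" "\<And>n. X n \<in> borel_measurable \<Omega>"
    "\<And>n. distr \<Omega> borel (X n) = P (r n)" "Z \<in> borel_measurable \<Omega>"
    "AE \<omega> in \<Omega>. (\<lambda>n. X n \<omega>) \<longlonglongrightarrow> Z \<omega>"
proof -
  have meas [measurable]: "cube_encode \<in> borel_measurable (P n)" for n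
    using measurable_cong_sets[OF sets refl] measurable_cube_encode by blast
  define D where "D n = distr (P n) borel cube_encode" for n
  have D: "real_distribution (D n)" for n
    unfolding D_def by (rule prob_space.real_distribution_distr[OF prob meas])
  \<comment> \<open>All codes lie between 0 and 1/3. Tightness is phrased with intervals open on the
    left, so the left end has to be below 0.\<close>
  have "measure (D n) {-1<..1} = 1" for n
  proof -
    interpret real_distribution "D n" by (rule D)
    have "AE y in D n. y \<in> {-1<..1}"
      unfolding D_def
    proof (subst AE_distr_iff)
      have "cube_encode x \<in> {-1<..1}" for x :: 'a
        using cube_encode_bounds[of x] by auto
      then show "AE x in P n. cube_encode x \<in> {-1<..1}"
        by simp
    qed auto
    then show ?thesis
      by (subst prob_eq_1) auto
  qed
  then have "tight D"
    unfolding tight_def using D by (intro conjI allI impI exI[of _ "-1"] exI[of _ 1]) auto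
  from tight_imp_convergent_subsubsequence[OF this strict_mono_id]
  obtain r N where r: "strict_mono r" "real_distribution N" "weak_conv_m (\<lambda>n. D (r n)) N"
    by (auto simp: comp_def)
  from Skorohod[OF D r(2,3)] obtain \<Omega> :: "real measure" and Y y where \<Omega>: "prob_space \<Omega>"
    and Y [measurable]: "\<And>n. Y n \<in> borel_measurable \<Omega>" and DY: "\<And>n. distr \<Omega> borel (Y n) = D (r n)"
    and y: "y \<in> measurable \<Omega> lborel" and lim: "\<And>\<omega>. \<omega> \<in> space \<Omega> \<Longrightarrow> (\<lambda>n. Y n \<omega>) \<longlonglongrightarrow> y \<omega>"
    by blast
  show ?thesis
  proof (rule that[OF r(1) \<Omega>])
    show "(\<lambda>\<omega>. cube_decode (Y n \<omega>)) \<in> borel_measurable \<Omega>" for n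
      by measurable
    show "(\<lambda>\<omega>. cube_decode (y \<omega>)) \<in> borel_measurable \<Omega>"
      using y by (simp add: measurable_compose[OF _ measurable_cube_decode])
    \<comment> \<open>\<open>Y n\<close> has the law of the code of a
      \<open>P (r n)\<close>-distributed vector, and decoding undoes encoding almost surely.\<close>
    show "distr \<Omega> borel (\<lambda>\<omega>. cube_decode (Y n \<omega>)) = P (r n)" for n
    proof -
      have "distr \<Omega> borel (\<lambda>\<omega>. cube_decode (Y n \<omega>)) = distr (distr \<Omega> borel (Y n)) borel cube_decode"
        by (simp add: distr_distr comp_def)
      also have "\<dots> = distr (P (r n)) borel (\<lambda>x. cube_decode (cube_encode x))"
        unfolding DY D_def by (simp add: distr_distr comp_def)
      also have "\<dots> = distr (P (r n)) borel (\<lambda>x. x)"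
      proof (rule distr_cong_AE)
        show "AE x in P (r n). cube_decode (cube_encode x) = x"
          using cube[of "r n"] by eventually_elim (rule cube_decode_encode)
      qed (auto simp: measurable_ident_sets[OF sets])
      also have "\<dots> = P (r n)"
        by (simp add: distr_id2 sets)
      finally show ?thesis .
    qed
    \<comment> \<open>The representation theorem controls \<open>Y n\<close> only through its law,
      so sparseness is transferred from \<open>D (r n)\<close>.\<close>
    have "AE \<omega> in \<Omega>. base4_sparse (Y n \<omega>)" for n
    proof -
      have "AE y in D (r n). base4_sparse y"
        unfolding D_def by (subst AE_distr_iff) (auto simp: base4_sparse_cube_encode)
      then show ?thesis
        unfolding DY[symmetric] by (subst (asm) AE_distr_iff) auto
    qed
    then have "AE \<omega> in \<Omega>. \<forall>n. base4_sparse (Y n \<omega>)"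
      by (simp add: AE_all_countable)
    then show "AE \<omega> in \<Omega>. (\<lambda>n. cube_decode (Y n \<omega>)) \<longlonglongrightarrow> cube_decode (y \<omega>)"
      using AE_space by eventually_elim (rule tendsto_cube_decode, use lim in auto)
  qed
qed

section \<open>Laplace transforms on the cone: uniqueness and representation\<close>

abbreviation laplace_transform :: "('d::finite) sym_matrix measure \<Rightarrow> 'd sym_matrix \<Rightarrow> real" where
  "laplace_transform q u \<equiv> (\<integral>\<xi>. exp (- (u \<bullet> \<xi>)) \<partial>q)"

text \<open>A basis vector has norm 1, so \<open>sym_one + b\<close> lies in the cone. Subtracting
  \<open>sym_one\<close> gives \<open>b\<close> back, so these few directions already determine a
  point.\<close>

definition laplace_generators :: "('d::finite) sym_matrix set" where
  "laplace_generators = insert sym_one ((\<lambda>b. sym_one + b) ` Basis)"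

text \<open>The additive monoid generated by these directions: it is countable, and closure under
  addition makes the exponentials closed under multiplication.\<close>

definition laplace_directions :: "('d::finite) sym_matrix set" where
  "laplace_directions = sum_list ` lists laplace_generators"

lemma finite_laplace_generators: "finite laplace_generators"
  by (simp add: laplace_generators_def)

lemma laplace_generators_psd: "laplace_generators \<subseteq> psd"
proof -
  have "sym_one + b \<in> psd" if "b \<in> Basis" for b :: "'a sym_matrix"
    using psd_shift(1)[of b 1] that by simp
  then show ?thesis
    by (auto simp: laplace_generators_def)
qed

lemma laplace_directions_psd: "laplace_directions \<subseteq> psd"
proof -
  have "sum_list xs \<in> psd" if "xs \<in> lists laplace_generators" for xs :: "'a sym_matrix list"
    using that by induction (use laplace_generators_psd in \<open>auto intro: psd_add\<close>)
  then show ?thesis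
    by (auto simp: laplace_directions_def)
qed

lemma laplace_generators_subset: "laplace_generators \<subseteq> laplace_directions"
proof
  fix v :: "'a sym_matrix"
  assume "v \<in> laplace_generators"
  then show "v \<in> laplace_directions"
    unfolding laplace_directions_def by (intro image_eqI[of _ _ "[v]"]) auto
qed

lemma zero_laplace_directions: "0 \<in> laplace_directions"
  unfolding laplace_directions_def by (intro image_eqI[of _ _ "[]"]) auto

lemma laplace_directions_add:
  assumes "v \<in> laplace_directions" "w \<in> laplace_directions"
  shows "v + w \<in> laplace_directions"
proof -
  obtain xs ys where "v = sum_list xs" "w = sum_list ys"
    "xs \<in> lists laplace_generators" "ys \<in> lists laplace_generators"
    using assms by (auto simp: laplace_directions_def)
  then show ?thesis
    unfolding laplace_directions_def by (intro image_eqI[of _ _ "xs @ ys"]) auto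
qed

lemma countable_laplace_directions: "countable laplace_directions"
  unfolding laplace_directions_def
  by (intro countable_image countable_lists countable_finite finite_laplace_generators)

text \<open>
  These coordinates map \<open>psd\<close> into a compact cube and turn polynomials into combinations of
  exponentials, so that Laplace transforms become moments.
\<close>

definition laplace_coord :: "('d::finite) sym_matrix \<Rightarrow> 'd sym_matrix \<times> real" where
  "laplace_coord \<xi> = (\<Sum>b\<in>Basis. exp (- (\<xi> \<bullet> (sym_one + b))) *\<^sub>R b, exp (- (\<xi> \<bullet> sym_one)))"

text \<open>Logarithms of the coordinates recover the point: \<open>\<xi> \<bullet> (sym_one + b) -
  \<xi> \<bullet> sym_one = \<xi> \<bullet> b\<close>.\<close>

definition laplace_inv :: "('d::finite) sym_matrix \<times> real \<Rightarrow> 'd sym_matrix" where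
  "laplace_inv z = (\<Sum>b\<in>Basis. (ln (snd z) - ln (fst z \<bullet> b)) *\<^sub>R b)"

lemma laplace_inv_coord: "laplace_inv (laplace_coord \<xi>) = \<xi>"
  by (simp add: laplace_inv_def laplace_coord_def inner_add_right euclidean_representation)

lemma laplace_coord_inner:
  assumes "c \<in> Basis"
  obtains v where "v \<in> laplace_generators" "\<And>\<xi>. laplace_coord \<xi> \<bullet> c = exp (- (\<xi> \<bullet> v))"
proof -
  consider b where "b \<in> Basis" "c = (b, 0)" | "c = (0, 1)"
    using assms by (auto simp: Basis_prod_def)
  then show ?thesis
  proof cases
    case 1
    then show ?thesis
      by (intro that[of "sym_one + b"]) (auto simp: laplace_generators_def laplace_coord_def)
  next
    case 2
    then show ?thesis
      by (intro that[of sym_one]) (auto simp: laplace_generators_def laplace_coord_def)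
  qed
qed

lemma laplace_coord_cube:
  assumes "\<xi> \<in> psd" "c \<in> Basis"
  shows "0 < laplace_coord \<xi> \<bullet> c \<and> laplace_coord \<xi> \<bullet> c \<le> 1"
proof -
  obtain v where v: "v \<in> laplace_generators" "laplace_coord \<xi> \<bullet> c = exp (- (\<xi> \<bullet> v))"
    using laplace_coord_inner[OF assms(2)] by metis
  moreover have "0 \<le> \<xi> \<bullet> v"
    using v(1) laplace_generators_psd assms(1) by (intro psd_inner_nonneg) auto
  ultimately show ?thesis
    by simp
qed

lemma measurable_laplace_coord [measurable]: "laplace_coord \<in> borel_measurable borel"
  unfolding laplace_coord_def by (intro borel_measurable_continuous_onI continuous_intros)

lemma measurable_laplace_inv [measurable]: "laplace_inv \<in> borel_measurable borel"
proof -
  have "(\<lambda>z :: 'a sym_matrix \<times> real. fst z \<bullet> b) \<in> borel_measurable borel" for b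
    by (intro borel_measurable_continuous_onI continuous_intros)
  moreover have "(\<lambda>z :: 'a sym_matrix \<times> real. snd z) \<in> borel_measurable borel"
    by (intro borel_measurable_continuous_onI continuous_intros)
  ultimately show ?thesis
    unfolding laplace_inv_def by (intro borel_measurable_sum borel_measurable_scaleR borel_measurable_diff
        borel_measurable_ln borel_measurable_const)
qed

lemma exp_sum_polynomial:
  assumes "real_polynomial_function g"
  shows "exp_sum UNIV laplace_directions (\<lambda>\<xi>. g (laplace_coord \<xi>))"
  using assms
proof induction
  case (linear f)
  interpret bounded_linear f by fact
  have "f (laplace_coord \<xi>) = (\<Sum>c\<in>Basis. f c * (laplace_coord \<xi> \<bullet> c))" for \<xi>
  proof -
    have "f (laplace_coord \<xi>) = f (\<Sum>c\<in>Basis. (laplace_coord \<xi> \<bullet> c) *\<^sub>R c)"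
      by (simp add: euclidean_representation)
    then show ?thesis
      by (simp add: sum scaleR mult.commute)
  qed
  moreover have "exp_sum UNIV laplace_directions (\<lambda>\<xi>. f c * (laplace_coord \<xi> \<bullet> c))" if c: "c \<in> Basis" for c
  proof -
    obtain v where v: "v \<in> laplace_generators" "\<And>\<xi>. laplace_coord \<xi> \<bullet> c = exp (- (\<xi> \<bullet> v))"
      using laplace_coord_inner[OF c] by metis
    then show ?thesis
      using laplace_generators_subset by (auto intro: exp_sum_exp)
  qed
  ultimately show ?case
    by (simp add: exp_sum_sum)
next
  case (const c)
  show ?case
    using exp_sum_exp[of c UNIV 0 laplace_directions] zero_laplace_directions by simp
next
  case (add f g)
  then show ?case
    by (intro exp_sum_add)
next
  case (mult f g)
  then show ?case
    by (intro exp_sum_mult laplace_directions_add) auto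
qed

text \<open>The indicator of a closed set is the pointwise limit of the continuous functions
  \<open>max 0 (1 - n * infdist x F)\<close>, and closed sets form a generator stable under
  intersection.\<close>

lemma measure_eqI_continuous:
  fixes M N :: "'a::metric_space measure"
  assumes M: "finite_measure M" "sets M = sets borel" and N: "finite_measure N" "sets N = sets borel"
    and eq: "\<And>f :: 'a \<Rightarrow> real. continuous_on UNIV f \<Longrightarrow> (\<And>x. 0 \<le> f x \<and> f x \<le> 1) \<Longrightarrow>
      integral\<^sup>L M f = integral\<^sup>L N f"
  shows "M = N"
proof (rule measure_eqI_generator_eq[where E = "Collect closed" and \<Omega> = UNIV and A = "\<lambda>_. UNIV"])
  fix F :: "'a set"
  assume "F \<in> Collect closed"
  then have F: "closed F" by simp
  show "emeasure M F = emeasure N F"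
  proof (cases "F = {}")
    case False
    define f where "f n x = max 0 (1 - real n * infdist x F)" for n x
    have cont: "continuous_on UNIV (f n)" for n
      unfolding f_def by (intro continuous_intros)
    have bounds: "0 \<le> f n x \<and> f n x \<le> 1" for n x
      by (simp add: f_def infdist_nonneg)
    have lim: "(\<lambda>n. f n x) \<longlonglongrightarrow> indicator F x" for x
    proof (cases "x \<in> F")
      case True
      then show ?thesis
        by (simp add: f_def)
    next
      case False
      then have pos: "0 < infdist x F"
        using in_closed_iff_infdist_zero[OF F \<open>F \<noteq> {}\<close>, of x] infdist_nonneg[of x F] by linarith
      obtain k :: nat where k: "1 / infdist x F < real k"
        using reals_Archimedean2 by blast
      have "\<forall>\<^sub>F n in sequentially. f n x = 0"
        using eventually_ge_at_top[of k]
      proof eventually_elim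
        case (elim n)
        have "1 < real k * infdist x F"
          using k pos by (simp add: field_simps)
        also have "\<dots> \<le> real n * infdist x F"
          using elim pos by (intro mult_right_mono) auto
        finally show ?case
          by (simp add: f_def)
      qed
      then show ?thesis
        using False by (simp add: tendsto_eventually)
    qed
    have conv: "(\<lambda>n. integral\<^sup>L K (f n)) \<longlonglongrightarrow> measure K F" if "finite_measure K" "sets K = sets borel" for K
    proof -
      interpret finite_measure K by fact
      have "(\<lambda>n. integral\<^sup>L K (f n)) \<longlonglongrightarrow> integral\<^sup>L K (indicator F)"
      proof (rule integral_dominated_convergence[where w = "\<lambda>_. 1"])
        show "f n \<in> borel_measurable K" for n
          using cont that(2) by (simp add: measurable_cong_sets[OF that(2) refl] borel_measurable_continuous_onI)
        show "indicator F \<in> borel_measurable K"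
          using F that(2) by (intro borel_measurable_indicator) simp
      qed (use lim bounds in auto)
      then show ?thesis
        using F that(2) sets_eq_imp_space_eq[OF that(2)] by simp
    qed
    have "measure M F = measure N F"
      using conv[OF M] conv[OF N] eq[OF cont bounds] by (simp add: LIMSEQ_unique)
    then show ?thesis
      using M(1) N(1) by (simp add: finite_measure.emeasure_eq_measure)
  qed simp
next
  show "sets M = sigma_sets UNIV (Collect closed)" "sets N = sigma_sets UNIV (Collect closed)"
    using M(2) N(2) by (simp_all add: borel_eq_closed)
  show "emeasure M UNIV \<noteq> \<infinity>"
    using M(1) by (simp add: finite_measure.emeasure_eq_measure)
qed (auto simp: Int_stable_def)

lemma integrable_exp_psd:
  fixes P :: "('d::finite) sym_matrix measure"
  assumes P: "prob_space P" "sets P = sets psd_space" and v: "v \<in> psd"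
  shows "integrable P (\<lambda>\<xi>. exp (- (\<xi> \<bullet> v)))"
proof -
  interpret prob_space P by fact
  have "space P = psd"
    using sets_eq_imp_space_eq[OF P(2)] by (simp add: space_restrict_space)
  then show ?thesis
    using v psd_inner_nonneg
    by (intro integrable_const_bound[of _ 1] AE_I2)
      (auto simp: measurable_cong_sets[OF P(2) refl] intro!: measurable_restrict_space1)
qed

text \<open>The assumed equalities say that the images under \<open>laplace_coord\<close> have the
  same moments. Those images live on a compact cube, where Stone-Weierstrass makes the moments
  decisive, and \<open>laplace_coord\<close> has a measurable left inverse.\<close>

theorem laplace_transform_unique:
  fixes P Q :: "('d::finite) sym_matrix measure"
  assumes P: "prob_space P" "sets P = sets psd_space" and Q: "prob_space Q" "sets Q = sets psd_space"
    and eq: "\<And>u. u \<in> laplace_directions \<Longrightarrow> (\<integral>\<xi>. exp (- (\<xi> \<bullet> u)) \<partial>P) = (\<integral>\<xi>. exp (- (\<xi> \<bullet> u)) \<partial>Q)"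
  shows "P = Q"
proof -
  have meas: "f \<in> borel_measurable borel \<Longrightarrow> f \<in> borel_measurable P"
    "f \<in> borel_measurable borel \<Longrightarrow> f \<in> borel_measurable Q" for f :: "'d sym_matrix \<Rightarrow> 'b::topological_space"
    unfolding measurable_cong_sets[OF P(2) refl] measurable_cong_sets[OF Q(2) refl]
    by (auto intro: measurable_restrict_space1)
  have space: "space P = psd" "space Q = psd"
    using sets_eq_imp_space_eq[OF P(2)] sets_eq_imp_space_eq[OF Q(2)] by (auto simp: space_restrict_space)
  have exp: "integrable P f \<and> integrable Q f \<and> integral\<^sup>L P f = integral\<^sup>L Q f"
    if "exp_sum UNIV laplace_directions f" for f
    using that
  proof induction
    case (add_exp g c v)
    then show ?case
      using laplace_directions_psd integrable_exp_psd[OF P] integrable_exp_psd[OF Q] eq[of v] by auto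
  qed simp
  define K where "K = cbox (0 :: 'd sym_matrix \<times> real) One"
  have K: "laplace_coord \<xi> \<in> K" if "\<xi> \<in> psd" for \<xi>
    using laplace_coord_cube[OF that] by (auto simp: K_def mem_box less_imp_le)
  have PQ: "distr P borel laplace_coord = distr Q borel laplace_coord"
  proof (rule measure_eqI_continuous)
    show "finite_measure (distr P borel laplace_coord)" "finite_measure (distr Q borel laplace_coord)"
      using P Q meas(1)[OF measurable_laplace_coord] meas(2)[OF measurable_laplace_coord]
      by (auto intro!: prob_space.finite_measure prob_space.prob_space_distr)
    fix f :: "'d sym_matrix \<times> real \<Rightarrow> real"
    assume f: "continuous_on UNIV f" "\<And>x. 0 \<le> f x \<and> f x \<le> 1"
    have f_meas: "(\<lambda>\<xi>. f (laplace_coord \<xi>)) \<in> borel_measurable borel"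
      using f(1) by (intro measurable_compose[OF measurable_laplace_coord] borel_measurable_continuous_onI)
    have int: "integrable R (\<lambda>\<xi>. f (laplace_coord \<xi>))"
      if "prob_space R" "(\<lambda>\<xi>. f (laplace_coord \<xi>)) \<in> borel_measurable R" for R
      using that f(2) by (intro finite_measure.integrable_const_bound[where B = 1]) (auto intro: prob_space.finite_measure)
    have "\<bar>(\<integral>\<xi>. f (laplace_coord \<xi>) \<partial>P) - (\<integral>\<xi>. f (laplace_coord \<xi>) \<partial>Q)\<bar> \<le> e" if "0 < e" for e :: real
    proof -
      have "compact K" "continuous_on K f" "0 < e / 2"
        using f(1) that by (auto simp: K_def intro: continuous_on_subset)
      then obtain g where g: "real_polynomial_function g" "\<And>x. x \<in> K \<Longrightarrow> \<bar>f x - g x\<bar> < e / 2"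
        by (rule Stone_Weierstrass_real_polynomial_function) blast
      note E = exp[OF exp_sum_polynomial[OF g(1)]]
      have close: "\<bar>(\<integral>\<xi>. f (laplace_coord \<xi>) \<partial>R) - (\<integral>\<xi>. g (laplace_coord \<xi>) \<partial>R)\<bar> \<le> e / 2"
        if R: "prob_space R" "space R = psd" and i: "integrable R (\<lambda>\<xi>. f (laplace_coord \<xi>))"
          "integrable R (\<lambda>\<xi>. g (laplace_coord \<xi>))" for R
      proof -
        interpret prob_space R by fact
        have "\<bar>\<integral>\<xi>. f (laplace_coord \<xi>) - g (laplace_coord \<xi>) \<partial>R\<bar>
            \<le> (\<integral>\<xi>. \<bar>f (laplace_coord \<xi>) - g (laplace_coord \<xi>)\<bar> \<partial>R)"
          by (rule integral_abs_bound)
        also have "\<dots> \<le> (\<integral>\<xi>. e / 2 \<partial>R)"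
          using i g(2) K R(2) by (intro integral_mono) (auto simp: less_imp_le)
        finally show ?thesis
          using i by (simp add: prob_space)
      qed
      show ?thesis
        using close[OF P(1) space(1) int[OF P(1) meas(1)[OF f_meas]] conjunct1[OF E]]
          close[OF Q(1) space(2) int[OF Q(1) meas(2)[OF f_meas]] conjunct1[OF conjunct2[OF E]]]
          conjunct2[OF conjunct2[OF E]] by linarith
    qed
    then have "(\<integral>\<xi>. f (laplace_coord \<xi>) \<partial>P) = (\<integral>\<xi>. f (laplace_coord \<xi>) \<partial>Q)"
      using field_le_epsilon[of "\<bar>(\<integral>\<xi>. f (laplace_coord \<xi>) \<partial>P) - (\<integral>\<xi>. f (laplace_coord \<xi>) \<partial>Q)\<bar>" 0] by auto
    then show "integral\<^sup>L (distr P borel laplace_coord) f = integral\<^sup>L (distr Q borel laplace_coord) f"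
      using meas(1)[OF measurable_laplace_coord] meas(2)[OF measurable_laplace_coord] f(1)
      by (simp add: integral_distr borel_measurable_continuous_onI)
  qed auto
  \<comment> \<open>The default value 0 keeps \<open>h\<close> inside the cone everywhere, which
    measurability into \<open>psd_space\<close> requires; on the image of the cone it is the inverse
    of \<open>laplace_coord\<close>.\<close>
  define h where "h z = (if laplace_inv z \<in> psd then laplace_inv z else 0)" for z :: "'d sym_matrix \<times> real"
  have h: "h \<in> borel \<rightarrow>\<^sub>M psd_space"
    unfolding h_def by (intro measurable_restrict_space2) auto
  have recover: "distr (distr R borel laplace_coord) psd_space h = R"
    if R: "sets R = sets psd_space" "space R = psd" "laplace_coord \<in> borel_measurable R" for R
  proof -
    have "distr (distr R borel laplace_coord) psd_space h = distr R psd_space (\<lambda>\<xi>. h (laplace_coord \<xi>))"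
      using h R(3) by (simp add: distr_distr comp_def)
    also have "\<dots> = distr R R (\<lambda>\<xi>. \<xi>)"
      using R by (intro distr_cong) (auto simp: h_def laplace_inv_coord)
    finally show ?thesis
      by (simp add: distr_id)
  qed
  show ?thesis
    using recover[OF P(2) space(1) meas(1)[OF measurable_laplace_coord]]
      recover[OF Q(2) space(2) meas(2)[OF measurable_laplace_coord]]
    unfolding PQ by (rule trans[OF sym])
qed

section \<open>Existence of a law with a given limit transform\<close>

lemma exp_sum_finite_measure:
  assumes "exp_sum {0..} (psd :: ('d::finite) sym_matrix set) g"
  shows "\<exists>M. sets M = sets borel \<and> emeasure M UNIV < \<infinity> \<and> emeasure M (- psd) = 0 \<and>
    (\<forall>u\<in>psd. integrable M (\<lambda>\<xi>. exp (- (u \<bullet> \<xi>))) \<and> laplace_transform M u = g u)"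
  using assms
proof induction
  case zero
  show ?case
    by (rule exI[of _ "scale_measure 0 borel"]) (simp add: integrable_iff_bounded nn_integral_scale_measure
        integral_eq_nn_integral)
next
  case (add_exp g c v)
  then obtain M where M: "sets M = sets borel" "emeasure M UNIV < \<infinity>" "emeasure M (- psd) = 0"
    "\<And>u. u \<in> psd \<Longrightarrow> integrable M (\<lambda>\<xi>. exp (- (u \<bullet> \<xi>)))"
    "\<And>u. u \<in> psd \<Longrightarrow> laplace_transform M u = g u"
    by blast
  let ?D = "scale_measure (ennreal c) (return borel v)"
  have int: "integrable (return borel v) (\<lambda>\<xi>. exp (- (u \<bullet> \<xi>)))" for u
    by (simp add: integrable_iff_bounded nn_integral_return)
  have D: "integrable ?D (\<lambda>\<xi>. exp (- (u \<bullet> \<xi>)))" "(\<integral>\<xi>. exp (- (u \<bullet> \<xi>)) \<partial>?D) = c * exp (- (u \<bullet> v))" for u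
    using integral_scale_measure[OF int[of u], of c] \<open>c \<in> {0..}\<close> by (simp_all add: integral_return)
  have sets: "sets ?D = sets M"
    by (simp add: M(1))
  have "- psd \<in> sets (borel :: 'd sym_matrix measure)"
    using sets.compl_sets[OF psd_measurable] by (simp add: Compl_eq_Diff_UNIV)
  then have "emeasure (sum_measure M ?D) (- psd) = 0"
    using M(3) \<open>v \<in> psd\<close> by (simp add: emeasure_sum_measure[OF sets])
  moreover have "emeasure (sum_measure M ?D) UNIV < \<infinity>"
    using M(2) by (simp add: emeasure_sum_measure[OF sets] ennreal_mult_less_top)
  ultimately show ?case
    using integral_sum_measure[OF sets M(4) D(1)] M(1,5) D(2)
    by (intro exI[of _ "sum_measure M ?D"]) auto
qed

lemma exp_sum_prob_measure:
  assumes g: "exp_sum {0..} (psd :: ('d::finite) sym_matrix set) g" and pos: "0 < g 0"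
  obtains P where "prob_space P" "sets P = sets borel" "AE \<xi> in P. \<xi> \<in> psd"
    "\<And>u. u \<in> psd \<Longrightarrow> laplace_transform P u = g u / g 0"
proof -
  obtain M where M: "sets M = sets borel" "emeasure M UNIV < \<infinity>" "emeasure M (- psd) = 0"
    "\<And>u. u \<in> psd \<Longrightarrow> integrable M (\<lambda>\<xi>. exp (- (u \<bullet> \<xi>)))"
    "\<And>u. u \<in> psd \<Longrightarrow> laplace_transform M u = g u"
    using exp_sum_finite_measure[OF g] by blast
  have space: "space M = UNIV"
    using sets_eq_imp_space_eq[OF M(1)] by simp
  let ?P = "scale_measure (ennreal (1 / g 0)) M"
  \<comment> \<open>At \<open>u = 0\<close> the transform is the total mass, which explains the
    normalisation by \<open>g 0\<close>.\<close>
  have "measure M UNIV = g 0"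
    using M(5)[of 0] by (simp add: space)
  then have "emeasure M UNIV = ennreal (g 0)"
    using M(2) by (simp add: emeasure_eq_ennreal_measure less_top)
  moreover have "space ?P = UNIV"
    using sets_eq_imp_space_eq[of ?P M] space by simp
  ultimately have "emeasure ?P (space ?P) = 1"
    using pos by (simp flip: ennreal_mult)
  then have "prob_space ?P"
    by (rule prob_spaceI)
  moreover have "AE \<xi> in ?P. \<xi> \<in> psd"
  proof (rule AE_I[where N = "- psd"])
    have "- psd \<in> sets (borel :: 'd sym_matrix measure)"
      using sets.compl_sets[OF psd_measurable] by (simp add: Compl_eq_Diff_UNIV)
    then show "- psd \<in> sets ?P"
      by (simp add: M(1))
  qed (auto simp: M(3))
  moreover have "laplace_transform ?P u = g u / g 0" if "u \<in> psd" for u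
    using integral_scale_measure[OF M(4)[OF that], of "1 / g 0"] M(5)[OF that] pos by simp
  ultimately show ?thesis
    using that[of ?P] M(1) by simp
qed

text \<open>Approximating laws are moved into the cube, where a subsequence converges. The limit
  \<open>Z\<close> comes from a point of the cone unless one of its coordinates is 0, which means
  mass lost at infinity. The assumption \<open>cont\<close> excludes this: the mean of the
  \<open>(k+1)\<close>-th root of a coordinate is \<open>L\<close> at a generator divided by
  \<open>k + 1\<close>, which tends to 1, while a root of 0 stays 0.\<close>

lemma laplace_representation_countable:
  fixes L :: "('d::finite) sym_matrix \<Rightarrow> real"
  assumes L: "laplace_limit L" "L 0 = 1"
    and cont: "\<And>u. u \<in> psd \<Longrightarrow> (\<lambda>k. L ((1 / real (Suc k)) *\<^sub>R u)) \<longlonglongrightarrow> 1"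
    and V: "countable V" "V \<subseteq> psd"
  obtains q where "prob_space q" "sets q = sets psd_space"
    "\<And>u. u \<in> V \<Longrightarrow> laplace_transform q u = L u"
proof -
  \<comment> \<open>The scaled generators are the arguments at which roots of the coordinates have
    their means; 0 is there for the normalisation.\<close>
  define V' where "V' = insert 0 (V \<union> (\<Union>k. (\<lambda>w. (1 / real (Suc k)) *\<^sub>R w) ` laplace_generators))"
  have "countable (\<Union>k. (\<lambda>w :: 'd sym_matrix. (1 / real (Suc k)) *\<^sub>R w) ` laplace_generators)"
    by (rule countable_UN) (simp_all add: countable_finite finite_laplace_generators)
  with V(1) have "countable V'"
    unfolding V'_def by (intro countable_insert countable_Un)
  moreover have "V' \<subseteq> psd" "V' \<noteq> {}"
    using V(2) laplace_generators_psd by (auto simp: V'_def intro: psd_scaleR)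
  ultimately have V': "countable V'" "V' \<noteq> {}" "V' \<subseteq> psd"
    by blast+
  define v where "v = from_nat_into V'"
  have v: "v n \<in> psd" for n
    using V'(3) from_nat_into[OF V'(2)] by (auto simp: v_def)
  \<comment> \<open>A diagonal choice: the \<open>n\<close>-th approximant is accurate at the first
    \<open>n + 1\<close> points of the enumeration.\<close>
  have "\<forall>n. \<exists>g. exp_sum {0..} psd g \<and> (\<forall>u\<in>v ` {..n}. \<bar>g u - L u\<bar> < inverse (real (Suc n)))"
  proof
    fix n
    have "finite (v ` {..n})" "v ` {..n} \<subseteq> psd" "0 < inverse (real (Suc n))"
      using v by auto
    then show "\<exists>g. exp_sum {0..} psd g \<and> (\<forall>u\<in>v ` {..n}. \<bar>g u - L u\<bar> < inverse (real (Suc n)))"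
      using L(1) unfolding laplace_limit_def by blast
  qed
  then obtain g where g: "\<And>n. exp_sum {0..} psd (g n)"
    "\<And>n i. i \<le> n \<Longrightarrow> \<bar>g n (v i) - L (v i)\<bar> < inverse (real (Suc n))"
    by (metis atMost_iff imageI)
  have g_lim: "(\<lambda>n. g n u) \<longlonglongrightarrow> L u" if u: "u \<in> V'" for u
  proof -
    obtain i where i: "u = v i"
      using from_nat_into_surj[OF V'(1) u] by (auto simp: v_def)
    show ?thesis
    proof (rule LIM_zero_cancel, rule Lim_null_comparison[OF _ LIMSEQ_inverse_real_of_nat])
      show "\<forall>\<^sub>F n in sequentially. norm (g n u - L u) \<le> inverse (real (Suc n))"
        using eventually_ge_at_top[of i] by eventually_elim (use g(2) i in \<open>auto intro: less_imp_le\<close>)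
    qed
  qed
  have "\<exists>P. prob_space P \<and> sets P = sets borel \<and> (AE \<xi> in P. \<xi> \<in> psd) \<and>
      (0 < g n 0 \<longrightarrow> (\<forall>u\<in>psd. laplace_transform P u = g n u / g n 0))" for n
  proof (cases "0 < g n 0")
    case True
    then show ?thesis
      using exp_sum_prob_measure[OF g(1)[of n]] by metis
  next
    case False
    \<comment> \<open>A placeholder law: \<open>g n 0\<close> tends to \<open>L 0 = 1\<close>, so
      this case occurs for finitely many \<open>n\<close> only.\<close>
    then show ?thesis
      by (intro exI[of _ "return borel 0"]) (auto simp: prob_space_return AE_return)
  qed
  then obtain P where P: "\<And>n. prob_space (P n)" "\<And>n. sets (P n) = sets borel" "\<And>n. AE \<xi> in P n. \<xi> \<in> psd"
    "\<And>n u. 0 < g n 0 \<Longrightarrow> u \<in> psd \<Longrightarrow> laplace_transform (P n) u = g n u / g n 0"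
    by metis
  have "0 \<in> V'"
    by (simp add: V'_def)
  have P_lim: "(\<lambda>n. \<integral>\<xi>. exp (- (u \<bullet> \<xi>)) \<partial>P n) \<longlonglongrightarrow> L u" if u: "u \<in> V'" for u
  proof -
    have "(\<lambda>n. g n u / g n 0) \<longlonglongrightarrow> L u / L 0"
      using g_lim[OF u] g_lim[OF \<open>0 \<in> V'\<close>] L(2) by (intro tendsto_divide) auto
    moreover have "\<forall>\<^sub>F n in sequentially. g n u / g n 0 = laplace_transform (P n) u"
      using order_tendstoD(1)[OF g_lim[OF \<open>0 \<in> V'\<close>], of 0] L(2) V'(3) u
      by (auto elim!: eventually_mono simp: P(4))
    ultimately show ?thesis
      using L(2) by (auto intro: Lim_transform_eventually)
  qed
  have meas_P [measurable]: "f \<in> borel_measurable borel \<Longrightarrow> f \<in> borel_measurable (P n)" for f :: "'d sym_matrix \<Rightarrow> 'b::topological_space" and n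
    unfolding measurable_cong_sets[OF P(2) refl] by simp
  define Q where "Q n = distr (P n) borel laplace_coord" for n
  have Q: "prob_space (Q n)" "sets (Q n) = sets borel" for n
    unfolding Q_def using P(1) by (intro prob_space.prob_space_distr) auto
  have "AE z in Q n. \<forall>c\<in>Basis. 0 < z \<bullet> c \<and> z \<bullet> c \<le> 1" for n
    unfolding Q_def using P(3)[of n]
    by (subst AE_distr_iff) (auto elim!: eventually_mono dest: laplace_coord_cube)
  then obtain r :: "nat \<Rightarrow> nat" and \<Omega> :: "real measure" and X Z where r: "strict_mono r" and \<Omega>: "prob_space \<Omega>"
    and X [measurable]: "\<And>n. X n \<in> borel_measurable \<Omega>" and law: "\<And>n. distr \<Omega> borel (X n) = Q (r n)"
    and Z [measurable]: "Z \<in> borel_measurable \<Omega>" and X_lim: "AE \<omega> in \<Omega>. (\<lambda>n. X n \<omega>) \<longlonglongrightarrow> Z \<omega>"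
    by (rule cube_convergent_subsequence[of Q, OF Q]) blast
  interpret \<Omega>: prob_space \<Omega> by fact
  have expect: "(\<integral>\<omega>. f (X n \<omega>) \<partial>\<Omega>) = (\<integral>\<xi>. f (laplace_coord \<xi>) \<partial>P (r n))"
    if [measurable]: "f \<in> borel_measurable borel" for f :: "_ \<Rightarrow> real" and n
  proof -
    have "(\<integral>\<omega>. f (X n \<omega>) \<partial>\<Omega>) = integral\<^sup>L (distr \<Omega> borel (X n)) f"
      by (simp add: integral_distr)
    then show ?thesis
      unfolding law Q_def by (simp add: integral_distr)
  qed
  have AE_X: "AE \<omega> in \<Omega>. \<forall>n. p (X n \<omega>)"
    if "Measurable.pred borel p" "\<And>\<xi>. \<xi> \<in> psd \<Longrightarrow> p (laplace_coord \<xi>)" for p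
  proof -
    have "AE \<omega> in \<Omega>. p (X n \<omega>)" for n
    proof -
      have "AE \<xi> in P (r n). p (laplace_coord \<xi>)"
        using P(3) by eventually_elim (rule that(2))
      then have "AE z in Q (r n). p z"
        unfolding Q_def using that(1) by (subst AE_distr_iff) auto
      then show ?thesis
        unfolding law[symmetric] using that(1) by (subst (asm) AE_distr_iff) auto
    qed
    then show ?thesis
      by (simp add: AE_all_countable)
  qed
  have cube_meas: "Measurable.pred borel (\<lambda>z :: 'd sym_matrix \<times> real. \<forall>c\<in>Basis. 0 < z \<bullet> c \<and> z \<bullet> c \<le> 1)"
    by (intro pred_intros_finite) auto
  have X_cube: "AE \<omega> in \<Omega>. \<forall>n. \<forall>c\<in>Basis. 0 < X n \<omega> \<bullet> c \<and> X n \<omega> \<bullet> c \<le> 1"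
    by (rule AE_X[OF cube_meas]) (use laplace_coord_cube in blast)
  have X_psd: "AE \<omega> in \<Omega>. \<forall>n. laplace_inv (X n \<omega>) \<in> psd"
    by (rule AE_X) (auto simp: laplace_inv_coord)
  have Z_cube: "AE \<omega> in \<Omega>. \<forall>c\<in>Basis. 0 \<le> Z \<omega> \<bullet> c \<and> Z \<omega> \<bullet> c \<le> 1"
    using X_cube X_lim
  proof eventually_elim
    case (elim \<omega>)
    have lim: "(\<lambda>n. X n \<omega> \<bullet> c) \<longlonglongrightarrow> Z \<omega> \<bullet> c" for c
      using elim(2) by (intro tendsto_intros)
    have "0 \<le> X n \<omega> \<bullet> c \<and> X n \<omega> \<bullet> c \<le> 1" if "c \<in> Basis" for n c
      using elim(1) that by (auto intro: less_imp_le)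
    then show ?case
      using LIMSEQ_le_const[OF lim] LIMSEQ_le_const2[OF lim] by blast
  qed
  have Z_pos: "AE \<omega> in \<Omega>. 0 < Z \<omega> \<bullet> c" if c: "c \<in> Basis" for c
  proof -
    obtain w where w: "w \<in> laplace_generators" "\<And>\<xi>. laplace_coord \<xi> \<bullet> c = exp (- (\<xi> \<bullet> w))"
      using laplace_coord_inner[OF c] by metis
    have pw: "w \<in> psd"
      using w(1) laplace_generators_psd by auto
    \<comment> \<open>Roots are continuous and bounded on the cube, and the root of
      \<open>exp (- (\<xi> \<bullet> w))\<close> is the exponential at \<open>w / (k + 1)\<close>;
      the mean can therefore be computed along the subsequence.\<close>
    have E: "(\<integral>\<omega>. root (Suc k) (Z \<omega> \<bullet> c) \<partial>\<Omega>) = L ((1 / real (Suc k)) *\<^sub>R w)" for k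
    proof (rule LIMSEQ_unique)
      show "(\<lambda>n. \<integral>\<omega>. root (Suc k) (X n \<omega> \<bullet> c) \<partial>\<Omega>) \<longlonglongrightarrow> (\<integral>\<omega>. root (Suc k) (Z \<omega> \<bullet> c) \<partial>\<Omega>)"
      proof (rule integral_dominated_convergence[where w = "\<lambda>_. 1"])
        show "AE \<omega> in \<Omega>. (\<lambda>n. root (Suc k) (X n \<omega> \<bullet> c)) \<longlonglongrightarrow> root (Suc k) (Z \<omega> \<bullet> c)"
          using X_lim by eventually_elim (intro tendsto_intros)
        show "AE \<omega> in \<Omega>. norm (root (Suc k) (X n \<omega> \<bullet> c)) \<le> 1" for n
          using X_cube by eventually_elim (use c in \<open>auto simp: real_root_le_1_iff less_imp_le\<close>)
      qed auto
      have eq: "(\<integral>\<omega>. root (Suc k) (X n \<omega> \<bullet> c) \<partial>\<Omega>) = (\<integral>\<xi>. exp (- (((1 / real (Suc k)) *\<^sub>R w) \<bullet> \<xi>)) \<partial>P (r n))" for n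
      proof -
        have "root (Suc k) (laplace_coord \<xi> \<bullet> c) = exp (- (((1 / real (Suc k)) *\<^sub>R w) \<bullet> \<xi>))" for \<xi>
        proof (rule real_root_pos_unique)
          show "exp (- (((1 / real (Suc k)) *\<^sub>R w) \<bullet> \<xi>)) ^ Suc k = laplace_coord \<xi> \<bullet> c"
            unfolding w(2) exp_of_nat_mult[symmetric] by (simp add: inner_commute del: of_nat_Suc)
        qed auto
        then show ?thesis
          using expect[of "\<lambda>z. root (Suc k) (z \<bullet> c)" n] by simp
      qed
      have mem: "(1 / real (Suc k)) *\<^sub>R w \<in> V'"
        using w(1) by (auto simp: V'_def)
      show "(\<lambda>n. \<integral>\<omega>. root (Suc k) (X n \<omega> \<bullet> c) \<partial>\<Omega>) \<longlonglongrightarrow> L ((1 / real (Suc k)) *\<^sub>R w)"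
        unfolding eq using LIMSEQ_subseq_LIMSEQ[OF P_lim[OF mem] r] by (simp add: comp_def)
    qed
    \<comment> \<open>A root of a number between 0 and 1 is at most 1, and it is 0 at 0.\<close>
    have le: "(\<integral>\<omega>. root (Suc k) (Z \<omega> \<bullet> c) \<partial>\<Omega>) \<le> \<P>(\<omega> in \<Omega>. 0 < Z \<omega> \<bullet> c)" for k
    proof -
      have "(\<integral>\<omega>. root (Suc k) (Z \<omega> \<bullet> c) \<partial>\<Omega>) \<le> (\<integral>\<omega>. indicator {\<omega> \<in> space \<Omega>. 0 < Z \<omega> \<bullet> c} \<omega> \<partial>\<Omega>)"
      proof (rule integral_mono_AE)
        have root: "AE \<omega> in \<Omega>. norm (root (Suc k) (Z \<omega> \<bullet> c)) \<le> 1"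
          using Z_cube by eventually_elim (use c in \<open>auto simp: real_root_le_1_iff\<close>)
        then show "integrable \<Omega> (\<lambda>\<omega>. root (Suc k) (Z \<omega> \<bullet> c))"
          by (rule \<Omega>.integrable_const_bound) simp
        show "integrable \<Omega> (indicator {\<omega> \<in> space \<Omega>. 0 < Z \<omega> \<bullet> c} :: _ \<Rightarrow> real)"
          by (rule \<Omega>.integrable_const_bound[of _ 1]) auto
        show "AE \<omega> in \<Omega>. root (Suc k) (Z \<omega> \<bullet> c) \<le> indicator {\<omega> \<in> space \<Omega>. 0 < Z \<omega> \<bullet> c} \<omega>"
          using Z_cube AE_space
        proof eventually_elim
          case (elim \<omega>)
          then have "Z \<omega> \<bullet> c = 0 \<or> 0 < Z \<omega> \<bullet> c" "Z \<omega> \<bullet> c \<le> 1"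
            using c by (auto simp: less_le)
          with elim(2) show ?case
            by (auto simp: indicator_def real_root_le_1_iff)
        qed
      qed
      then show ?thesis
        by simp
    qed
    have "1 \<le> \<P>(\<omega> in \<Omega>. 0 < Z \<omega> \<bullet> c)"
      using cont[OF pw] le unfolding E by (intro LIMSEQ_le_const2) auto
    then have "\<P>(\<omega> in \<Omega>. 0 < Z \<omega> \<bullet> c) = 1"
      using \<Omega>.prob_le_1 by (intro antisym)
    then show ?thesis
      by (subst \<Omega>.prob_Collect_eq_1[symmetric]) auto
  qed
  have "AE \<omega> in \<Omega>. \<forall>c\<in>Basis. 0 < Z \<omega> \<bullet> c"
    by (intro AE_finite_allI Z_pos) auto
  then have inv_lim: "AE \<omega> in \<Omega>. (\<lambda>n. laplace_inv (X n \<omega>)) \<longlonglongrightarrow> laplace_inv (Z \<omega>)"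
    using X_lim
  proof eventually_elim
    case (elim \<omega>)
    have pos: "0 < snd (Z \<omega>)" "b \<in> Basis \<Longrightarrow> 0 < fst (Z \<omega>) \<bullet> b" for b
      using bspec[OF elim(1), of "(0, 1)"] bspec[OF elim(1), of "(b, 0)"]
      by (auto simp: Basis_prod_def inner_prod_def)
    show ?case
      unfolding laplace_inv_def using elim(2) pos
      by (intro tendsto_sum tendsto_scaleR tendsto_diff tendsto_ln tendsto_inner tendsto_fst tendsto_snd
          tendsto_const) (auto dest: pos(2))
  qed
  have Z_psd: "AE \<omega> in \<Omega>. laplace_inv (Z \<omega>) \<in> psd"
    using inv_lim X_psd by eventually_elim (use closed_psd in \<open>auto intro: closed_sequentially\<close>)
  \<comment> \<open>A change on a null set, so that the values lie in the cone everywhere.\<close>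
  define Y where "Y \<omega> = (if laplace_inv (Z \<omega>) \<in> psd then laplace_inv (Z \<omega>) else 0)" for \<omega>
  have Y: "Y \<in> \<Omega> \<rightarrow>\<^sub>M psd_space"
    unfolding Y_def by (intro measurable_restrict_space2) auto
  show ?thesis
  proof (rule that[of "distr \<Omega> psd_space Y"])
    show "prob_space (distr \<Omega> psd_space Y)"
      using Y by (rule \<Omega>.prob_space_distr)
    fix u :: "'d sym_matrix"
    assume u: "u \<in> V"
    then have "u \<in> V'" "u \<in> psd"
      using V(2) by (auto simp: V'_def)
    have "(\<integral>\<xi>. exp (- (u \<bullet> \<xi>)) \<partial>distr \<Omega> psd_space Y) = (\<integral>\<omega>. exp (- (u \<bullet> Y \<omega>)) \<partial>\<Omega>)"
      by (rule integral_distr[OF Y]) (rule measurable_restrict_space1, simp)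
    also have "\<dots> = (\<integral>\<omega>. exp (- (u \<bullet> laplace_inv (Z \<omega>))) \<partial>\<Omega>)"
      using Z_psd Y by (intro integral_cong_AE) (auto simp: Y_def elim!: eventually_mono)
    also have "\<dots> = L u"
    proof (rule LIMSEQ_unique)
      show "(\<lambda>n. \<integral>\<omega>. exp (- (u \<bullet> laplace_inv (X n \<omega>))) \<partial>\<Omega>) \<longlonglongrightarrow> (\<integral>\<omega>. exp (- (u \<bullet> laplace_inv (Z \<omega>))) \<partial>\<Omega>)"
      proof (rule integral_dominated_convergence[where w = "\<lambda>_. 1"])
        show "AE \<omega> in \<Omega>. (\<lambda>n. exp (- (u \<bullet> laplace_inv (X n \<omega>)))) \<longlonglongrightarrow> exp (- (u \<bullet> laplace_inv (Z \<omega>)))"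
          using inv_lim by eventually_elim (intro tendsto_intros)
        show "AE \<omega> in \<Omega>. norm (exp (- (u \<bullet> laplace_inv (X n \<omega>)))) \<le> 1" for n
          using X_psd by eventually_elim (use \<open>u \<in> psd\<close> psd_inner_nonneg in auto)
      qed auto
      show "(\<lambda>n. \<integral>\<omega>. exp (- (u \<bullet> laplace_inv (X n \<omega>))) \<partial>\<Omega>) \<longlonglongrightarrow> L u"
        using LIMSEQ_subseq_LIMSEQ[OF P_lim[OF \<open>u \<in> V'\<close>] r] expect[of "\<lambda>z. exp (- (u \<bullet> laplace_inv z))"]
        by (simp add: comp_def laplace_inv_coord)
    qed
    finally show "(\<integral>\<xi>. exp (- (u \<bullet> \<xi>)) \<partial>distr \<Omega> psd_space Y) = L u" .
  qed simp
qed

text \<open>For each \<open>u\<close> there is a law that is right at \<open>u\<close> and on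
  \<open>laplace_directions\<close>. All these laws agree on \<open>laplace_directions\<close>, so
  by uniqueness they are one law, which is right at every \<open>u\<close>.\<close>

theorem laplace_representation:
  fixes L :: "('d::finite) sym_matrix \<Rightarrow> real"
  assumes L: "laplace_limit L" "L 0 = 1"
    and cont: "\<And>u. u \<in> psd \<Longrightarrow> (\<lambda>k. L ((1 / real (Suc k)) *\<^sub>R u)) \<longlonglongrightarrow> 1"
  obtains q where "prob_space q" "sets q = sets psd_space"
    "\<And>u. u \<in> psd \<Longrightarrow> laplace_transform q u = L u"
proof -
  have ex: "\<exists>q. prob_space q \<and> sets q = sets psd_space \<and>
      (\<forall>v\<in>insert u laplace_directions. laplace_transform q v = L v)" if "u \<in> psd" for u
    using laplace_representation_countable[OF assms, of "insert u laplace_directions"] that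
      countable_laplace_directions laplace_directions_psd by (metis countable_insert insert_subset)
  obtain q where q: "prob_space q" "sets q = sets psd_space"
    "\<And>v. v \<in> laplace_directions \<Longrightarrow> laplace_transform q v = L v"
    using ex[OF psd_0] by auto
  show ?thesis
  proof (rule that[OF q(1,2)])
    fix u :: "'d sym_matrix"
    assume "u \<in> psd"
    from ex[OF this] obtain q' where q': "prob_space q'" "sets q' = sets psd_space"
      "\<And>v. v \<in> insert u laplace_directions \<Longrightarrow> laplace_transform q' v = L v"
      by blast
    have "q = q'"
      by (rule laplace_transform_unique[OF q(1,2) q'(1,2)]) (simp add: q(3) q'(3) inner_commute)
    then show "laplace_transform q u = L u"
      using q'(3)[of u] by simp
  qed
qed

section \<open>One-step schemes and quasi-monotone maps\<close>

lemma linear_norm_bound: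
  fixes T :: "'a::euclidean_space \<Rightarrow> 'b::real_normed_vector"
  assumes "linear T"
  obtains K where "0 < K" "\<And>x. norm (T x) \<le> K * norm x"
  using bounded_linear.pos_bounded[OF linear_conv_bounded_linear[THEN iffD1, OF assms]]
  by (metis mult.commute)

context
  fixes T :: "'a::euclidean_space \<Rightarrow> 'a"
  assumes T: "linear T"
begin

lemma funpow_scaleR_linear: "((\<lambda>y. s *\<^sub>R T y) ^^ k) x = s ^ k *\<^sub>R (T ^^ k) x"
  by (induction k) (simp_all add: linear_scale[OF T] mult.commute)

lemma linear_funpow: "linear (T ^^ k)"
proof (induction k)
  case (Suc k)
  then show ?case
    using linear_compose[OF Suc T] by (simp add: o_def)
qed (simp add: linear_ident)

lemma summable_exp_map: "summable (\<lambda>k. norm ((s ^ k / fact k) *\<^sub>R (T ^^ k) x))"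
proof -
  obtain K where K: "0 < K" "\<And>x. norm (T x) \<le> K * norm x"
    using linear_norm_bound[OF T] by blast
  have pow: "norm ((T ^^ k) x) \<le> K ^ k * norm x" for k
  proof (induction k)
    case (Suc k)
    have "norm ((T ^^ Suc k) x) \<le> K * norm ((T ^^ k) x)"
      using K(2) by simp
    also have "\<dots> \<le> K * (K ^ k * norm x)"
      using Suc K(1) by (intro mult_left_mono) auto
    finally show ?case by simp
  qed simp
  show ?thesis
  proof (rule summable_comparison_test'[of _ 0])
    show "summable (\<lambda>k. ((\<bar>s\<bar> * K) ^ k /\<^sub>R fact k) * norm x)"
      by (intro summable_mult2 summable_exp_generic)
    fix k
    have "\<bar>s ^ k / fact k\<bar> * norm ((T ^^ k) x) \<le> (\<bar>s\<bar> ^ k / fact k) * (K ^ k * norm x)"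
      using pow[of k] by (simp add: power_abs mult_left_mono divide_right_mono)
    then show "norm (norm ((s ^ k / fact k) *\<^sub>R (T ^^ k) x)) \<le> ((\<bar>s\<bar> * K) ^ k /\<^sub>R fact k) * norm x"
      by (simp add: power_mult_distrib divide_inverse algebra_simps)
  qed
qed

lemma exp_map_sums: "(\<lambda>k. (s ^ k / fact k) *\<^sub>R (T ^^ k) x) sums exp_map (\<lambda>y. s *\<^sub>R T y) x"
  using summable_sums[OF summable_norm_cancel[OF summable_exp_map]]
  by (simp add: exp_map_def funpow_scaleR_linear divide_inverse mult.commute)

lemma linear_exp_map: "linear (exp_map (\<lambda>y. s *\<^sub>R T y))"
proof (rule linearI)
  fix x y c
  show "exp_map (\<lambda>y. s *\<^sub>R T y) (x + y) = exp_map (\<lambda>y. s *\<^sub>R T y) x + exp_map (\<lambda>y. s *\<^sub>R T y) y"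
    using exp_map_sums[of s "x + y"] sums_add[OF exp_map_sums[of s x] exp_map_sums[of s y]]
    by (simp add: linear_add[OF linear_funpow] scaleR_add_right sums_unique2)
  show "exp_map (\<lambda>y. s *\<^sub>R T y) (c *\<^sub>R x) = c *\<^sub>R exp_map (\<lambda>y. s *\<^sub>R T y) x"
    using exp_map_sums[of s "c *\<^sub>R x"] sums_scaleR_right[OF exp_map_sums[of s x], of c]
    by (simp add: linear_scale[OF linear_funpow] mult.commute sums_unique2)
qed

lemma exp_map_0: "exp_map (\<lambda>y. 0 *\<^sub>R T y) x = x"
proof -
  have "(\<lambda>k. (0 ^ k / fact k) *\<^sub>R (T ^^ k) x) sums (\<Sum>k\<in>{0}. (0 ^ k / fact k) *\<^sub>R (T ^^ k) x)"
    by (rule sums_finite) auto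
  from sums_unique2[OF exp_map_sums this] show ?thesis
    by simp
qed

text \<open>Each coordinate is an everywhere convergent power series in \<open>s\<close> that can be
  differentiated termwise; shifting the index produces one more factor \<open>T\<close>.\<close>

lemma has_vector_derivative_exp_map:
  "((\<lambda>s. exp_map (\<lambda>y. s *\<^sub>R T y) x) has_vector_derivative T (exp_map (\<lambda>y. s *\<^sub>R T y) x)) (at s)"
proof -
  let ?E = "\<lambda>s. exp_map (\<lambda>y. s *\<^sub>R T y) x"
  have comp: "((\<lambda>s. ?E s \<bullet> b) has_vector_derivative T (?E s) \<bullet> b) (at s)" for b
  proof -
    define c where "c k = ((T ^^ k) x \<bullet> b) / fact k" for k
    have E: "(\<lambda>k. c k * s ^ k) sums (?E s \<bullet> b)" for s
      using bounded_linear.sums[OF bounded_linear_inner_left exp_map_sums[of s x], of b]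
      by (simp add: c_def mult.commute)
    have "(\<lambda>k. T ((s ^ k / fact k) *\<^sub>R (T ^^ k) x) \<bullet> b) sums (T (?E s) \<bullet> b)"
      by (intro bounded_linear.sums[OF bounded_linear_inner_left]
          bounded_linear.sums[OF linear_conv_bounded_linear[THEN iffD1, OF T]] exp_map_sums)
    moreover have "T ((s ^ k / fact k) *\<^sub>R (T ^^ k) x) \<bullet> b = diffs c k * s ^ k" for k
      by (simp add: diffs_def c_def linear_scale[OF T] del: of_nat_Suc)
    ultimately have TE: "(\<Sum>k. diffs c k * s ^ k) = T (?E s) \<bullet> b"
      by (simp add: sums_iff)
    have "((\<lambda>s. \<Sum>k. c k * s ^ k) has_field_derivative (\<Sum>k. diffs c k * s ^ k)) (at s)"
      using E by (intro termdiffs_strong_converges_everywhere) (auto simp: sums_iff)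
    then show ?thesis
      using E TE by (simp add: sums_iff has_real_derivative_iff_has_vector_derivative)
  qed
  have "((\<lambda>s. \<Sum>b\<in>Basis. (?E s \<bullet> b) *\<^sub>R b) has_vector_derivative (\<Sum>b\<in>Basis. (T (?E s) \<bullet> b) *\<^sub>R b)) (at s)"
    by (intro has_vector_derivative_sum bounded_linear.has_vector_derivative[OF bounded_linear_scaleR_left] comp)
  then show ?thesis
    by (simp add: euclidean_representation)
qed

end

text \<open>The classical argument: a local error of order \<open>h\<^sup>2\<close>, Lipschitz
  stability and a discrete Gronwall estimate give a global error of order \<open>h\<close>. The
  region \<open>S\<close> may be unbounded, because the consistency error is relative to
  \<open>norm v\<close> and is absorbed into the growth rate.\<close>

lemma one_step_scheme_converges:
  fixes y :: "real \<Rightarrow> 'a::real_normed_vector"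
  assumes t: "0 \<le> t"
    and deriv: "\<And>s. s \<in> {0..t} \<Longrightarrow> (y has_vector_derivative R (y s)) (at s within {0..t})"
    and S: "\<And>s. s \<in> {0..t} \<Longrightarrow> y s \<in> S"
    and lip: "\<And>v w. v \<in> S \<Longrightarrow> w \<in> S \<Longrightarrow> norm (R v - R w) \<le> L * norm (v - w)"
    and "0 \<le> L" "0 \<le> K" "0 < \<eta>"
    and stable: "\<And>h v. 0 \<le> h \<Longrightarrow> h \<le> \<eta> \<Longrightarrow> v \<in> S \<Longrightarrow> f h v \<in> S"
    and consistent: "\<And>h v. 0 \<le> h \<Longrightarrow> h \<le> \<eta> \<Longrightarrow> v \<in> S \<Longrightarrow>
      norm (f h v - v - h *\<^sub>R R v) \<le> K * h\<^sup>2 * norm v"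
  shows "(\<lambda>n. (f (t / real n) ^^ n) (y 0)) \<longlonglongrightarrow> y t"
proof -
  have "continuous_on {0..t} y"
    using deriv by (meson continuous_on_eq_continuous_within has_vector_derivative_continuous)
  then have "compact (y ` {0..t})"
    by (intro compact_continuous_image) auto
  then obtain Y where Y: "\<And>s. s \<in> {0..t} \<Longrightarrow> norm (y s) \<le> Y"
    by (meson bounded_iff compact_imp_bounded imageI)
  have "0 \<le> Y"
    using Y[of 0] t norm_ge_zero order_trans by (metis atLeastAtMost_iff order_refl)
  \<comment> \<open>\<open>Y\<close> bounds the solution, so two of its values differ by at most
    \<open>2 * Y\<close>; \<open>D\<close> bounds the variation of \<open>R\<close> along it, and
    \<open>D'\<close> below bounds its speed.\<close>
  define D where "D = L * (2 * Y)"
  have RD: "norm (R (y s) - R (y r)) \<le> D" if "s \<in> {0..t}" "r \<in> {0..t}" for s r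
  proof -
    have "norm (y s - y r) \<le> 2 * Y"
      using norm_triangle_ineq4[of "y s" "y r"] Y[OF that(1)] Y[OF that(2)] by linarith
    then show ?thesis
      using lip[OF S[OF that(1)] S[OF that(2)]] \<open>0 \<le> L\<close> by (smt (verit) D_def mult_left_mono)
  qed
  define D' where "D' = norm (R (y 0)) + D"
  have "0 \<le> D'"
    using RD[of 0 0] t by (simp add: D'_def)
  have Lip_y: "norm (y s - y r) \<le> \<bar>s - r\<bar> * D'" if "s \<in> {0..t}" "r \<in> {0..t}" for s r
  proof -
    have "norm (y s - y r - (s - r) *\<^sub>R R (y 0)) \<le> norm (s - r) * D"
      using that t RD
      by (intro vector_differentiable_bound_linearization[where S = "{0..t}" and f' = "\<lambda>s. R (y s)"] deriv)
        (auto simp: closed_segment_eq_real_ivl)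
    moreover have "norm (y s - y r) \<le> norm (y s - y r - (s - r) *\<^sub>R R (y 0)) + norm ((s - r) *\<^sub>R R (y 0))"
      by (metis add.commute norm_triangle_sub)
    ultimately show ?thesis
      by (simp add: D'_def distrib_left)
  qed
  have local_error: "norm (y (s + h) - y s - h *\<^sub>R R (y s)) \<le> h\<^sup>2 * (L * D')"
    if "0 \<le> s" "0 \<le> h" "s + h \<le> t" for s h
  proof -
    have "norm (y (s + h) - y s - (s + h - s) *\<^sub>R R (y s)) \<le> norm (s + h - s) * (L * (h * D'))"
    proof (rule vector_differentiable_bound_linearization[where S = "{s..s+h}" and f' = "\<lambda>s. R (y s)"])
      fix r
      assume r: "r \<in> {s..s+h}"
      show "(y has_vector_derivative R (y r)) (at r within {s..s+h})"
        using r that by (intro has_vector_derivative_within_subset[OF deriv]) auto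
      have "norm (R (y r) - R (y s)) \<le> L * norm (y r - y s)"
        using r that by (intro lip S) auto
      also have "\<dots> \<le> L * (h * D')"
        using Lip_y[of r s] r that \<open>0 \<le> L\<close> \<open>0 \<le> D'\<close>
        by (intro mult_left_mono order_trans[OF Lip_y] mult_right_mono) auto
      finally show "norm (R (y r) - R (y s)) \<le> L * (h * D')" .
    qed (use that in \<open>auto simp: closed_segment_eq_real_ivl\<close>)
    then show ?thesis
      using that by (simp add: power2_eq_square algebra_simps)
  qed
  \<comment> \<open>\<open>A\<close> is the rate at which an existing error grows. \<open>C\<close>
    collects what each step adds: the local error of the solution and the consistency error at its
    size \<open>Y\<close>.\<close>
  define A where "A = L + K"
  define C where "C = L * D' + K * Y"
  have AC: "0 \<le> A" "0 \<le> C"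
    using \<open>0 \<le> L\<close> \<open>0 \<le> K\<close> \<open>0 \<le> D'\<close> \<open>0 \<le> Y\<close> by (auto simp: A_def C_def)
  have error: "(f h ^^ k) (y 0) \<in> S \<and>
      norm (y (real k * h) - (f h ^^ k) (y 0)) \<le> real k * h\<^sup>2 * C * exp (A * (real k * h))"
    if h: "0 \<le> h" "h \<le> \<eta>" "h \<le> 1" and "real k * h \<le> t" for h k
    using \<open>real k * h \<le> t\<close>
  proof (induction k)
    case 0
    then show ?case
      using S[of 0] t by simp
  next
    case (Suc k)
    let ?s = "real k * h" and ?z = "(f h ^^ k) (y 0)"
    let ?e = "norm (y ?s - ?z)"
    have s: "0 \<le> ?s" "?s + h \<le> t"
      using h Suc.prems by (auto simp: algebra_simps)
    with h have s': "?s \<in> {0..t}" by auto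
    have IH: "?z \<in> S" "?e \<le> real k * h\<^sup>2 * C * exp (A * ?s)"
      using Suc.IH s h by auto
    have "y (?s + h) - f h ?z = (y (?s + h) - y ?s - h *\<^sub>R R (y ?s)) + (y ?s - ?z)
        + h *\<^sub>R (R (y ?s) - R ?z) - (f h ?z - ?z - h *\<^sub>R R ?z)"
      by (simp add: algebra_simps)
    moreover have "norm (a + b + c - d) \<le> norm a + norm b + norm c + norm d" for a b c d :: 'a
      using norm_triangle_ineq4[of "a + b + c" d] norm_triangle_ineq[of "a + b" c] norm_triangle_ineq[of a b]
      by linarith
    ultimately have "norm (y (?s + h) - f h ?z) \<le> norm (y (?s + h) - y ?s - h *\<^sub>R R (y ?s)) + ?e
        + norm (h *\<^sub>R (R (y ?s) - R ?z)) + norm (f h ?z - ?z - h *\<^sub>R R ?z)"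
      by metis
    also have "\<dots> \<le> h\<^sup>2 * (L * D') + ?e + h * (L * ?e) + h\<^sup>2 * K * (Y + ?e)"
    proof (intro add_mono order_refl)
      show "norm (y (?s + h) - y ?s - h *\<^sub>R R (y ?s)) \<le> h\<^sup>2 * (L * D')"
        using s h by (intro local_error)
      show "norm (h *\<^sub>R (R (y ?s) - R ?z)) \<le> h * (L * ?e)"
        using lip[OF S[OF s'] IH(1)] h by (simp add: mult_left_mono)
      have "norm ?z \<le> Y + ?e"
        using Y[OF s'] norm_triangle_sub[of ?z "y ?s"] by (simp add: norm_minus_commute)
      then have "K * h\<^sup>2 * norm ?z \<le> K * h\<^sup>2 * (Y + ?e)"
        using \<open>0 \<le> K\<close> by (intro mult_left_mono) auto
      then show "norm (f h ?z - ?z - h *\<^sub>R R ?z) \<le> h\<^sup>2 * K * (Y + ?e)"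
        using consistent[OF h(1,2) IH(1)] by (simp add: mult.commute)
    qed
    also have "\<dots> = (1 + h * L + h\<^sup>2 * K) * ?e + h\<^sup>2 * C"
      by (simp add: C_def algebra_simps)
    also have "\<dots> \<le> exp (A * h) * ?e + h\<^sup>2 * C"
    proof -
      have "h\<^sup>2 * K \<le> h * K"
        using h \<open>0 \<le> K\<close> by (intro mult_right_mono) (auto simp: power2_eq_square mult_left_le)
      then have "1 + h * L + h\<^sup>2 * K \<le> 1 + A * h"
        by (simp add: A_def algebra_simps)
      also have "\<dots> \<le> exp (A * h)"
        by (rule exp_ge_add_one_self)
      finally show ?thesis
        by (intro add_right_mono mult_right_mono) auto
    qed
    \<comment> \<open>The fresh error is weighted by the exponential at the new time, so that it
      combines with the propagated one into \<open>k + 1\<close> equal terms.\<close>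
    also have "\<dots> \<le> exp (A * h) * (real k * h\<^sup>2 * C * exp (A * ?s)) + h\<^sup>2 * C * exp (A * (?s + h))"
    proof (intro add_mono mult_left_mono IH)
      have "1 \<le> exp (A * (?s + h))"
        using AC s h by simp
      then show "h\<^sup>2 * C \<le> h\<^sup>2 * C * exp (A * (?s + h))"
        using AC mult_left_mono[of 1 "exp (A * (?s + h))" "h\<^sup>2 * C"] by simp
    qed simp
    also have "\<dots> = real (Suc k) * h\<^sup>2 * C * exp (A * (?s + h))"
      by (simp add: exp_add distrib_left algebra_simps)
    also have "?s + h = real (Suc k) * h"
      by (simp add: algebra_simps)
    finally show ?case
      using stable[OF h(1,2) IH(1)] by simp
  qed
  have "(\<lambda>n. y t - (f (t / real n) ^^ n) (y 0)) \<longlonglongrightarrow> 0"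
  proof (rule Lim_null_comparison)
    have lim: "(\<lambda>n. t / real n) \<longlonglongrightarrow> 0"
      by (rule lim_const_over_n)
    have "\<forall>\<^sub>F n in sequentially. t / real n < min \<eta> 1"
      using \<open>0 < \<eta>\<close> by (intro order_tendstoD(2)[OF lim]) simp
    then show "\<forall>\<^sub>F n in sequentially. norm (y t - (f (t / real n) ^^ n) (y 0)) \<le> (t / real n) * (t * C * exp (A * t))"
      using eventually_gt_at_top[of 0]
    proof eventually_elim
      case (elim n)
      then have n: "real n * (t / real n) = t" "0 \<le> t / real n"
        using t by auto
      have "norm (y (real n * (t / real n)) - (f (t / real n) ^^ n) (y 0))
          \<le> real n * (t / real n)\<^sup>2 * C * exp (A * (real n * (t / real n)))"
        using error[of "t / real n" n] n elim by auto
      also have "real n * (t / real n)\<^sup>2 = (t / real n) * t"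
        using n by (simp add: power2_eq_square)
      finally show ?case
        by (simp only: n mult.assoc)
    qed
    show "(\<lambda>n. (t / real n) * (t * C * exp (A * t))) \<longlonglongrightarrow> 0"
      using tendsto_mult_left_zero[OF lim] by blast
  qed
  then have "(\<lambda>n. (f (t / real n) ^^ n) (y 0) - y t) \<longlonglongrightarrow> 0"
    using tendsto_minus by fastforce
  then show ?thesis
    by (rule LIM_zero_cancel)
qed

section \<open>Quasi-monotone maps and their resolvents\<close>

definition quasi_monotone :: "(('d::finite) sym_matrix \<Rightarrow> 'd sym_matrix) \<Rightarrow> bool" where
  "quasi_monotone B \<longleftrightarrow> (\<forall>x\<in>psd. \<forall>u\<in>psd. x \<bullet> u = 0 \<longrightarrow> 0 \<le> B x \<bullet> u)"

lemma rank_one_scaleR: "rank_one (c *\<^sub>R v) = c\<^sup>2 *\<^sub>R rank_one v"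
  by (rule sym_matrix_eqI) (simp add: rank_one.rep_eq scaleR_sym_matrix.rep_eq power2_eq_square)

lemma psd_iff_unit_rank_one: "x \<in> psd \<longleftrightarrow> (\<forall>v. norm v = 1 \<longrightarrow> 0 \<le> x \<bullet> rank_one v)"
proof
  assume *: "\<forall>v. norm v = 1 \<longrightarrow> 0 \<le> x \<bullet> rank_one v"
  have "0 \<le> x \<bullet> rank_one v" for v
  proof (cases "v = 0")
    case True
    then show ?thesis
      using rank_one_scaleR[of 0 v] by simp
  next
    case False
    then have "0 \<le> x \<bullet> rank_one (inverse (norm v) *\<^sub>R v)"
      using * by simp
    then show ?thesis
      using False by (simp add: rank_one_scaleR zero_le_mult_iff)
  qed
  then show "x \<in> psd"
    by (simp add: psd_iff_rank_one)
qed (simp add: psd_iff_rank_one)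

text \<open>If \<open>y\<close> were outside the cone, let \<open>- c\<close> be its smallest
  eigenvalue, with unit eigenvector \<open>v\<close>. Then \<open>y + c *\<^sub>R sym_one\<close>
  lies in the cone and is orthogonal to \<open>rank_one v\<close>, so quasi-monotonicity bounds
  \<open>B y \<bullet> rank_one v\<close> below by \<open>- c * norm (B sym_one)\<close>. Positivity
  of \<open>y - h *\<^sub>R B y\<close> then yields
  \<open>c \<le> c * h * norm (B sym_one) < c\<close>.\<close>

lemma quasi_monotone_resolvent:
  fixes y :: "('d::finite) sym_matrix"
  assumes B: "linear B" "quasi_monotone B" and h: "0 \<le> h" "h * norm (B sym_one) < 1"
    and y: "y - h *\<^sub>R B y \<in> psd"
  shows "y \<in> psd"
proof (rule ccontr)
  assume "y \<notin> psd"
  have "continuous_on (sphere 0 1) (\<lambda>v. y \<bullet> rank_one v)"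
    unfolding quadratic_form[symmetric] by (intro continuous_intros matrix_vector_mult_linear_continuous_on)
  then obtain v where v: "norm v = 1" and min: "\<And>w. norm w = 1 \<Longrightarrow> y \<bullet> rank_one v \<le> y \<bullet> rank_one w"
    using continuous_attains_inf[of "sphere 0 1 :: (real^'d) set" "\<lambda>v. y \<bullet> rank_one v"] by auto
  define c where "c = - (y \<bullet> rank_one v)"
  have "0 < c"
    using \<open>y \<notin> psd\<close> min unfolding psd_iff_unit_rank_one c_def by fastforce
  have "y + c *\<^sub>R sym_one \<in> psd"
    unfolding psd_iff_unit_rank_one using min
    by (auto simp: inner_add_left inner_diff_left inner_one_rank_one c_def)
  moreover have "(y + c *\<^sub>R sym_one) \<bullet> rank_one v = 0"
    using v by (simp add: inner_add_left inner_diff_left inner_one_rank_one c_def)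
  ultimately have "0 \<le> B (y + c *\<^sub>R sym_one) \<bullet> rank_one v"
    using B(2) rank_one_psd by (auto simp: quasi_monotone_def)
  then have "- (c * (B sym_one \<bullet> rank_one v)) \<le> B y \<bullet> rank_one v"
    by (simp add: linear_add[OF B(1)] linear_scale[OF B(1)] inner_add_left)
  moreover have "c * (B sym_one \<bullet> rank_one v) \<le> c * norm (B sym_one)"
    using norm_cauchy_schwarz[of "B sym_one" "rank_one v"] \<open>0 < c\<close> v
    by (simp add: norm_rank_one)
  ultimately have "- (c * norm (B sym_one)) \<le> B y \<bullet> rank_one v"
    by linarith
  then have "h * - (c * norm (B sym_one)) \<le> h * (B y \<bullet> rank_one v)"
    using h(1) by (rule mult_left_mono)
  moreover have "0 \<le> y \<bullet> rank_one v - h * (B y \<bullet> rank_one v)"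
    using y rank_one_psd psd_inner_nonneg by (auto simp: inner_diff_left psd_iff_rank_one)
  ultimately have "c * 1 \<le> c * (h * norm (B sym_one))"
    by (simp add: c_def algebra_simps)
  with h(2) \<open>0 < c\<close> show False
    by simp
qed

text \<open>\<open>J h\<close> is the implicit Euler step, the inverse of \<open>1 - h B\<close>.
  The explicit step \<open>1 + h B\<close> has the same order but need not preserve the
  cone.\<close>

lemma resolvent_step:
  fixes B :: "('d::finite) sym_matrix \<Rightarrow> 'd sym_matrix"
  assumes B: "linear B" "quasi_monotone B"
  obtains J h0 K where "0 < h0" "0 \<le> K"
    "\<And>h. 0 \<le> h \<Longrightarrow> h \<le> h0 \<Longrightarrow> linear (J h)"
    "\<And>h x. 0 \<le> h \<Longrightarrow> h \<le> h0 \<Longrightarrow> x \<in> psd \<Longrightarrow> J h x \<in> psd"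
    "\<And>h x. 0 \<le> h \<Longrightarrow> h \<le> h0 \<Longrightarrow> norm (J h x - x - h *\<^sub>R B x) \<le> K * h\<^sup>2 * norm x"
proof -
  obtain K where K: "0 < K" "\<And>x. norm (B x) \<le> K * norm x"
    using linear_norm_bound[OF B(1)] by blast
  \<comment> \<open>Two requirements at once: \<open>h * K \<le> 1 / 2\<close> makes
    \<open>A h\<close> injective with an inverse of norm at most 2, and
    \<open>h * norm (B sym_one) < 1\<close> is what preservation of the cone needs.\<close>
  define h0 where "h0 = inverse (2 * K * (1 + norm (sym_one :: 'd sym_matrix)))"
  define A where "A h y = y - h *\<^sub>R B y" for h y
  define J where "J h = inv (A h)" for h
  have "0 < 1 + norm (sym_one :: 'd sym_matrix)"
    by (simp add: add_pos_nonneg)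
  with K(1) have "0 < h0"
    by (simp add: h0_def)
  have h0: "h0 * K * (1 + norm (sym_one :: 'd sym_matrix)) = 1 / 2"
  proof -
    have "inverse (2 * K * N) * K * N = 1 / 2" if "0 < N" for N
      using that K(1) by (simp add: field_simps)
    from this[OF \<open>0 < 1 + norm (sym_one :: 'd sym_matrix)\<close>] show ?thesis
      by (simp only: h0_def)
  qed
  have small: "h * K \<le> 1 / 2" "h * norm (B sym_one) < 1" if "0 \<le> h" "h \<le> h0" for h
  proof -
    have le: "h * K * (1 + norm (sym_one :: 'd sym_matrix)) \<le> 1 / 2"
      unfolding h0[symmetric] using that K(1) by (intro mult_right_mono) auto
    moreover have "0 \<le> h * K * norm (sym_one :: 'd sym_matrix)" "0 \<le> h * K"
      using that K(1) by auto
    ultimately show "h * K \<le> 1 / 2"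
      unfolding distrib_left by linarith
    have "h * norm (B sym_one) \<le> h * (K * norm (sym_one :: 'd sym_matrix))"
      using K(2) that by (intro mult_left_mono) auto
    then show "h * norm (B sym_one) < 1"
      using le \<open>0 \<le> h * K\<close> by (simp add: distrib_left)
  qed
  have linA: "linear (A h)" for h
    unfolding A_def by (rule linearI) (simp_all add: linear_add[OF B(1)] linear_scale[OF B(1)] algebra_simps)
  have normA: "norm y \<le> 2 * norm (A h y)" if h: "0 \<le> h" "h \<le> h0" for h y
  proof -
    have "norm (h *\<^sub>R B y) \<le> h * (K * norm y)"
      using K(2) h by (simp add: mult_left_mono)
    also have "\<dots> \<le> 1 / 2 * norm y"
      using mult_right_mono[OF small(1)[OF h] norm_ge_zero[of y]] by simp
    finally show ?thesis
      using norm_triangle_ineq2[of y "h *\<^sub>R B y"] by (simp add: A_def)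
  qed
  have injA: "inj (A h)" if h: "0 \<le> h" "h \<le> h0" for h
    unfolding linear_injective_0[OF linA] using normA[OF h] by (metis mult_zero_right norm_le_zero_iff norm_zero)
  have surjA: "surj (A h)" if h: "0 \<le> h" "h \<le> h0" for h
    using linear_inj_imp_surj[OF linA injA[OF h]] .
  have AJ: "A h (J h x) = x" if h: "0 \<le> h" "h \<le> h0" for h x
    unfolding J_def using surjA[OF h] by (rule surj_f_inv_f)
  show ?thesis
  proof (rule that[of h0 "2 * K\<^sup>2" J])
    show "0 < h0" "0 \<le> 2 * K\<^sup>2"
      using \<open>0 < h0\<close> by auto
    fix h
    assume h: "0 \<le> h" "h \<le> h0"
    show "linear (J h)"
      unfolding J_def using linA injA[OF h] by (rule inj_linear_imp_inv_linear)
    fix x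
    show "norm (J h x - x - h *\<^sub>R B x) \<le> 2 * K\<^sup>2 * h\<^sup>2 * norm x"
    proof -
      let ?y = "J h x"
      have y: "?y - x = h *\<^sub>R B ?y"
        using AJ[OF h, of x] by (simp add: A_def algebra_simps)
      \<comment> \<open>The identity \<open>y - x = h B y\<close> is used twice, which leaves the
        second-order term \<open>h\<^sup>2 B (B y)\<close>.\<close>
      have "?y - x - h *\<^sub>R B x = h *\<^sub>R B (?y - x)"
        by (simp add: y linear_diff[OF B(1)] algebra_simps flip: y)
      also have "\<dots> = h\<^sup>2 *\<^sub>R B (B ?y)"
        by (simp add: y linear_scale[OF B(1)] power2_eq_square)
      finally have "norm (?y - x - h *\<^sub>R B x) = h\<^sup>2 * norm (B (B ?y))"
        by simp
      also have "\<dots> \<le> h\<^sup>2 * (K * (K * norm ?y))"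
        using K by (intro mult_left_mono order_trans[OF K(2)]) auto
      also have "\<dots> \<le> h\<^sup>2 * (K * (K * (2 * norm x)))"
        using normA[OF h, of ?y] K(1) by (intro mult_left_mono) (auto simp: AJ[OF h])
      finally show ?thesis
        by (simp add: power2_eq_square algebra_simps)
    qed
    assume "x \<in> psd"
    then show "J h x \<in> psd"
      using quasi_monotone_resolvent[OF B h(1) small(2)[OF h], of "J h x"] AJ[OF h, of x] by (simp add: A_def)
  qed
qed

section \<open>The Riccati flow\<close>

lemma sandwich_0: "sandwich u 0 = 0"
  by transfer (simp add: matrix_matrix_mult_def vec_eq_iff)

lemma exp_minus_one_bound:
  assumes "u \<in> psd" "\<xi> \<in> psd"
  shows "norm (exp (- (u \<bullet> \<xi>)) - 1) \<le> norm u * norm \<xi>"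
  using one_minus_exp_bounds[of "u \<bullet> \<xi>"] psd_inner_nonneg[OF assms(2,1)] norm_cauchy_schwarz[of u \<xi>]
  by simp

lemma measurable_exp_inner:
  fixes u :: "('d::finite) sym_matrix"
  shows "(\<lambda>\<xi>. exp (- (u \<bullet> \<xi>)) - 1 :: real) \<in> borel_measurable borel"
  by measurable

locale riccati_generator = jump_kernel \<mu>
  for \<mu> :: "('d::finite) sym_matrix set \<Rightarrow> 'd sym_matrix" +
  fixes B :: "'d sym_matrix \<Rightarrow> 'd sym_matrix"
  assumes linear_B: "linear B" and quasi_monotone_B: "quasi_monotone B"
begin

abbreviation mean_flow :: "real \<Rightarrow> 'd sym_matrix \<Rightarrow> 'd sym_matrix" where
  "mean_flow s \<equiv> exp_map (\<lambda>y. s *\<^sub>R effective_drift B \<mu> y)"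

definition jump_exponent :: "'d sym_matrix \<Rightarrow> 'd sym_matrix" where
  "jump_exponent u = - matrix_integral \<mu> (\<lambda>\<xi>. exp (- (u \<bullet> \<xi>)) - 1)"

definition jump_drift :: "'d sym_matrix \<Rightarrow> 'd sym_matrix" where
  "jump_drift x = signed_integral (\<lambda>A. x \<bullet> \<mu> A) (\<lambda>\<xi>. \<xi>)"

lemma drift_R_eq: "drift_R 0 B \<mu> u = adjoint B u + jump_exponent u"
  by (simp add: drift_R_def sandwich_0 jump_exponent_def)

lemma effective_drift_eq: "effective_drift B \<mu> x = B x + jump_drift x"
  by (simp add: effective_drift_def jump_drift_def)

lemma inner_adjoint: "linear T \<Longrightarrow> adjoint T u \<bullet> x = u \<bullet> T x" for T :: "'d sym_matrix \<Rightarrow> 'd sym_matrix"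
  by (metis adjoint_works inner_commute)

lemma integrable_exp_jump:
  "u \<in> psd \<Longrightarrow> x \<in> psd \<Longrightarrow> integrable (jump_measure x) (\<lambda>\<xi>. 1 - exp (- (u \<bullet> \<xi>)))"
  using integrable_minus[OF integrable_jump_measure[OF measurable_exp_inner exp_minus_one_bound]]
  by simp

lemma integrable_ident_jump: "x \<in> psd \<Longrightarrow> integrable (jump_measure x) (\<lambda>\<xi>. \<xi>)"
  by (rule integrable_jump_measure[of _ 1]) simp_all

lemma jump_exponent_inner:
  assumes "u \<in> psd" "x \<in> psd"
  shows "jump_exponent u \<bullet> x = (\<integral>\<xi>. 1 - exp (- (u \<bullet> \<xi>)) \<partial>jump_measure x)"
proof -
  note f = measurable_exp_inner exp_minus_one_bound[OF assms(1)]
  have "matrix_integral \<mu> (\<lambda>\<xi>. exp (- (u \<bullet> \<xi>)) - 1) \<bullet> x = (\<integral>\<xi>. exp (- (u \<bullet> \<xi>)) - 1 \<partial>jump_measure x)"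
    using matrix_integral_inner[OF f, of x]
      signed_integral_jump_psd[OF f assms(2)] by simp
  also have "\<dots> = - (\<integral>\<xi>. 1 - exp (- (u \<bullet> \<xi>)) \<partial>jump_measure x)"
    unfolding integral_minus[symmetric] by simp
  finally show ?thesis
    by (simp add: jump_exponent_def)
qed

lemma jump_drift_inner:
  assumes "x \<in> psd"
  shows "u \<bullet> jump_drift x = (\<integral>\<xi>. u \<bullet> \<xi> \<partial>jump_measure x)"
proof -
  have "jump_drift x = (\<integral>\<xi>. \<xi> \<partial>jump_measure x)"
    unfolding jump_drift_def
    by (rule signed_integral_jump_psd[OF _ _ assms, of _ 1]) simp_all
  then show ?thesis
    using integrable_ident_jump[OF assms] by simp
qed

lemma linear_jump_drift: "linear jump_drift"
  using linear_signed_integral_jump[of "\<lambda>\<xi>. \<xi>" 1]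
  by (simp add: jump_drift_def[abs_def])

lemma linear_effective_drift: "linear (effective_drift B \<mu>)"
  using linear_compose_add[OF linear_B linear_jump_drift] by (simp add: effective_drift_eq[abs_def])

lemma jump_exponent_psd: "u \<in> psd \<Longrightarrow> jump_exponent u \<in> psd"
proof -
  assume u: "u \<in> psd"
  have "0 \<le> jump_exponent u \<bullet> x" if "x \<in> psd" for x
    unfolding jump_exponent_inner[OF u that]
    using u by (intro integral_nonneg_AE AE_I2)
      (auto simp: space_jump_measure[OF that] psd_inner_nonneg)
  then show ?thesis
    using psd_self_dual by blast
qed

lemma jump_drift_psd: "x \<in> psd \<Longrightarrow> jump_drift x \<in> psd"
proof -
  assume x: "x \<in> psd"
  have "0 \<le> u \<bullet> jump_drift x" if "u \<in> psd" for u
    unfolding jump_drift_inner[OF x]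
    using that by (intro integral_nonneg_AE AE_I2)
      (auto simp: space_jump_measure[OF x] psd_inner_nonneg)
  then show ?thesis
    using psd_self_dual by (metis inner_commute)
qed

text \<open>Since \<open>1 - exp (- z) \<le> z\<close>: the jump part lies below its linearisation
  at 0. This is the source of the comparison between the Riccati flow and the mean flow.\<close>

lemma jump_exponent_le_drift:
  assumes "u \<in> psd" "x \<in> psd"
  shows "jump_exponent u \<bullet> x \<le> u \<bullet> jump_drift x"
  unfolding jump_exponent_inner[OF assms] jump_drift_inner[OF assms(2)]
proof (rule integral_mono)
  show "integrable (jump_measure x) (\<lambda>\<xi>. u \<bullet> \<xi>)"
    using integrable_ident_jump[OF assms(2)] by simp
  show "1 - exp (- (u \<bullet> \<xi>)) \<le> u \<bullet> \<xi>" for \<xi>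
    using exp_ge_add_one_self[of "- (u \<bullet> \<xi>)"] by simp
qed (rule integrable_exp_jump[OF assms])

lemma abs_exp_diff_le: "\<bar>exp (- a) - exp (- b)\<bar> \<le> \<bar>a - b\<bar>" if "0 \<le> a" "0 \<le> b" for a b :: real
proof -
  have *: "exp (- a) - exp (- b) \<le> b - a" if "0 \<le> a" "a \<le> b" for a b :: real
  proof -
    have "exp (- a) - exp (- b) = exp (- a) * (1 - exp (- (b - a)))"
      by (simp add: right_diff_distrib flip: exp_add)
    also have "\<dots> \<le> 1 * (b - a)"
      using that one_minus_exp_bounds[of "b - a"] by (intro mult_mono) auto
    finally show ?thesis by simp
  qed
  show ?thesis
    using *[of a b] *[of b a] that by (cases "a \<le> b") auto
qed

text \<open>Integral estimates are available only against elements of the cone, where the jump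
  measure is positive.\<close>

lemma jump_exponent_lipschitz:
  obtains L where "0 \<le> L"
    "\<And>u v. u \<in> psd \<Longrightarrow> v \<in> psd \<Longrightarrow> norm (jump_exponent u - jump_exponent v) \<le> L * norm (u - v)"
proof
  let ?k = "jump_moment" and ?N = "norm (sym_one :: 'd sym_matrix)"
  have k: "0 \<le> ?k"
    by (rule jump_moment_nonneg)
  then show "0 \<le> ?k * (1 + 2 * ?N)"
    by simp
  fix u v :: "'d sym_matrix"
  assume uv: "u \<in> psd" "v \<in> psd"
  let ?w = "jump_exponent u - jump_exponent v"
  have psd: "\<bar>?w \<bullet> x\<bar> \<le> norm (u - v) * (norm x * ?k)" if x: "x \<in> psd" for x
  proof -
    have "?w \<bullet> x = (\<integral>\<xi>. (1 - exp (- (u \<bullet> \<xi>))) - (1 - exp (- (v \<bullet> \<xi>))) \<partial>jump_measure x)"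
      using uv x by (simp add: inner_diff_left jump_exponent_inner integrable_exp_jump
          flip: Bochner_Integration.integral_diff)
    also have "\<bar>\<dots>\<bar> \<le> (\<integral>\<xi>. norm (u - v) * norm \<xi> \<partial>jump_measure x)"
    proof (rule integral_abs_bound_integral)
      show "integrable (jump_measure x) (\<lambda>\<xi>. norm (u - v) * norm \<xi>)"
        using integrable_norm_jump_measure[OF x] by simp
      fix \<xi>
      assume "\<xi> \<in> space (jump_measure x)"
      then have "\<xi> \<in> psd"
        by (simp add: space_jump_measure[OF x])
      then have "\<bar>exp (- (v \<bullet> \<xi>)) - exp (- (u \<bullet> \<xi>))\<bar> \<le> \<bar>v \<bullet> \<xi> - u \<bullet> \<xi>\<bar>"
        using uv by (intro abs_exp_diff_le psd_inner_nonneg)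
      also have "\<dots> \<le> norm (u - v) * norm \<xi>"
        using Cauchy_Schwarz_ineq2[of "u - v" \<xi>] by (simp add: inner_diff_left abs_minus_commute)
      finally show "\<bar>1 - exp (- (u \<bullet> \<xi>)) - (1 - exp (- (v \<bullet> \<xi>)))\<bar> \<le> norm (u - v) * norm \<xi>"
        by simp
    qed (use Bochner_Integration.integrable_diff[OF integrable_exp_jump[OF uv(1) x] integrable_exp_jump[OF uv(2) x]] in simp)
    also have "\<dots> \<le> norm (u - v) * (norm x * ?k)"
      using integral_norm_jump_measure[OF x] by (simp add: mult_left_mono)
    finally show ?thesis .
  qed
  \<comment> \<open>The difference is tested against itself, split into two elements of the cone by
    \<open>psd_shift\<close>. One factor \<open>norm ?w\<close> cancels; the constant
    \<open>1 + 2 * ?N\<close> comes from the norms of the two parts.\<close>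
  have "(norm ?w)\<^sup>2 = ?w \<bullet> (norm ?w *\<^sub>R sym_one + ?w) - ?w \<bullet> (norm ?w *\<^sub>R sym_one)"
    by (simp add: power2_norm_eq_inner inner_add_right)
  also have "\<dots> \<le> norm (u - v) * (norm (norm ?w *\<^sub>R sym_one + ?w) * ?k)
      + norm (u - v) * (norm (norm ?w *\<^sub>R (sym_one :: 'd sym_matrix)) * ?k)"
    using psd[of "norm ?w *\<^sub>R sym_one + ?w"] psd[of "norm ?w *\<^sub>R sym_one"] psd_shift(1)[of ?w "norm ?w"]
    by (simp add: psd_scaleR)
  also have "\<dots> \<le> norm (u - v) * ((norm ?w * ?N + norm ?w) * ?k) + norm (u - v) * (norm ?w * ?N * ?k)"
    using norm_triangle_ineq[of "norm ?w *\<^sub>R sym_one" ?w] k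
    by (intro add_mono mult_left_mono mult_right_mono) auto
  finally have "norm ?w * norm ?w \<le> norm ?w * (?k * (1 + 2 * ?N) * norm (u - v))"
    by (simp add: power2_eq_square algebra_simps)
  then show "norm ?w \<le> ?k * (1 + 2 * ?N) * norm (u - v)"
    using k by (cases "norm ?w = 0") (auto simp: mult_le_cancel_left)
qed

text \<open>
  The scheme is implicit in the linear drift, so that it preserves the cone, and explicit in the jumps.
\<close>

lemma riccati_scheme:
  obtains step up :: "real \<Rightarrow> 'd sym_matrix \<Rightarrow> 'd sym_matrix" and h0 K :: real
  where "0 < h0" "0 \<le> K"
    "\<And>h u. 0 \<le> h \<Longrightarrow> h \<le> h0 \<Longrightarrow> u \<in> psd \<Longrightarrow> step h u \<in> psd"
    "\<And>h u. 0 \<le> h \<Longrightarrow> h \<le> h0 \<Longrightarrow> u \<in> psd \<Longrightarrow> norm (step h u - u - h *\<^sub>R drift_R 0 B \<mu> u) \<le> K * h\<^sup>2 * norm u"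
    "\<And>h x. 0 \<le> h \<Longrightarrow> h \<le> h0 \<Longrightarrow> x \<in> psd \<Longrightarrow> laplace_limit (\<lambda>u. exp (- (step h u \<bullet> x)))"
    "\<And>h x. 0 \<le> h \<Longrightarrow> h \<le> h0 \<Longrightarrow> x \<in> psd \<Longrightarrow> up h x \<in> psd"
    "\<And>h x. 0 \<le> h \<Longrightarrow> h \<le> h0 \<Longrightarrow> norm (up h x - x - h *\<^sub>R effective_drift B \<mu> x) \<le> K * h\<^sup>2 * norm x"
    "\<And>h u x. 0 \<le> h \<Longrightarrow> h \<le> h0 \<Longrightarrow> u \<in> psd \<Longrightarrow> x \<in> psd \<Longrightarrow> step h u \<bullet> x \<le> u \<bullet> up h x"
proof -
  obtain J h0 K where h0: "0 < h0" "0 \<le> K"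
    and lin: "\<And>h. 0 \<le> h \<Longrightarrow> h \<le> h0 \<Longrightarrow> linear (J h)"
    and psd: "\<And>h x. 0 \<le> h \<Longrightarrow> h \<le> h0 \<Longrightarrow> x \<in> psd \<Longrightarrow> J h x \<in> psd"
    and cons: "\<And>h x. 0 \<le> h \<Longrightarrow> h \<le> h0 \<Longrightarrow> norm (J h x - x - h *\<^sub>R B x) \<le> K * h\<^sup>2 * norm x"
    by (rule resolvent_step[OF linear_B quasi_monotone_B]) blast
  define step where "step h u = adjoint (J h) u + h *\<^sub>R jump_exponent u" for h u
  \<comment> \<open>\<open>step\<close> acts on the dual variable \<open>u\<close>, hence the
    adjoint. \<open>up\<close> acts on states, with the same resolvent and with the jump part
    linearised.\<close>
  define up where "up h x = J h x + h *\<^sub>R jump_drift x" for h x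
  have step_inner: "step h u \<bullet> x = u \<bullet> J h x + h * (jump_exponent u \<bullet> x)" if "0 \<le> h" "h \<le> h0" for h u x
    using inner_adjoint[OF lin[OF that]] by (simp add: step_def inner_add_left)
  have step_psd: "step h u \<in> psd" if h: "0 \<le> h" "h \<le> h0" and u: "u \<in> psd" for h u
  proof -
    have "0 \<le> step h u \<bullet> x" if x: "x \<in> psd" for x
      using psd_inner_nonneg[OF psd[OF h x] u] psd_inner_nonneg[OF x jump_exponent_psd[OF u]] h
      by (simp add: step_inner[OF h])
    then show ?thesis
      using psd_self_dual by blast
  qed
  show ?thesis
  proof (rule that[of h0 K step up])
    show "0 < h0" "0 \<le> K"
      by (rule h0)+
    fix h :: real and u x :: "'d sym_matrix"
    assume h: "0 \<le> h" "h \<le> h0"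
    show "norm (up h x - x - h *\<^sub>R effective_drift B \<mu> x) \<le> K * h\<^sup>2 * norm x"
      using cons[OF h, of x] by (simp add: up_def effective_drift_eq algebra_simps)
    {
      assume u: "u \<in> psd"
      then show "step h u \<in> psd"
        using step_psd h by blast
      \<comment> \<open>The estimate for the adjoint follows by duality: the error is tested against
        itself and the known estimate for \<open>J h\<close> is used on the other side.\<close>
      let ?e = "adjoint (J h) u - u - h *\<^sub>R adjoint B u"
      have "?e \<bullet> y = u \<bullet> (J h y - y - h *\<^sub>R B y)" for y
        by (simp add: inner_diff_left inner_diff_right inner_adjoint[OF lin[OF h]] inner_adjoint[OF linear_B])
      then have "(norm ?e)\<^sup>2 = u \<bullet> (J h ?e - ?e - h *\<^sub>R B ?e)"
        unfolding power2_norm_eq_inner .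
      also have "\<dots> \<le> norm u * (K * h\<^sup>2 * norm ?e)"
        using norm_cauchy_schwarz cons[OF h] by (meson mult_left_mono norm_ge_zero order_trans)
      finally have "norm ?e * norm ?e \<le> norm ?e * (K * h\<^sup>2 * norm u)"
        by (simp add: power2_eq_square algebra_simps)
      then have "norm ?e \<le> K * h\<^sup>2 * norm u"
        using h0 by (cases "norm ?e = 0") (auto simp: mult_le_cancel_left)
      moreover have "step h u - u - h *\<^sub>R drift_R 0 B \<mu> u = ?e"
        by (simp add: step_def drift_R_eq algebra_simps)
      ultimately show "norm (step h u - u - h *\<^sub>R drift_R 0 B \<mu> u) \<le> K * h\<^sup>2 * norm u"
        by (simp only:)
    }
    assume x: "x \<in> psd"
    show "up h x \<in> psd"
      using psd[OF h x] jump_drift_psd[OF x] h by (simp add: up_def psd_add psd_scaleR)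
    have hx: "h *\<^sub>R x \<in> psd"
      using x h(1) by (rule psd_scaleR)
    \<comment> \<open>The law behind one step: a point mass at \<open>J h x\<close>, convolved with
      a compound Poisson law whose jumps have intensity measure
      \<open>jump_measure (h *\<^sub>R x)\<close>.\<close>
    have "laplace_limit (\<lambda>u. exp (- (u \<bullet> J h x)) * exp (- (\<integral>\<xi>. 1 - exp (- (u \<bullet> \<xi>)) \<partial>jump_measure (h *\<^sub>R x))))"
      using psd[OF h x] sets_jump_measure[OF hx] integrable_norm_jump_measure[OF hx]
      by (intro laplace_limit_mult laplace_limit_exp laplace_limit_compound_poisson)
    then show "laplace_limit (\<lambda>u. exp (- (step h u \<bullet> x)))"
    proof (rule laplace_limit_cong[THEN iffD1, rotated])
      fix u :: "'d sym_matrix"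
      assume "u \<in> psd"
      then show "exp (- (u \<bullet> J h x)) * exp (- (\<integral>\<xi>. 1 - exp (- (u \<bullet> \<xi>)) \<partial>jump_measure (h *\<^sub>R x))) = exp (- (step h u \<bullet> x))"
        by (simp add: step_inner[OF h] jump_exponent_inner[OF _ hx, symmetric] flip: exp_add)
    qed
    assume u: "u \<in> psd"
    show "step h u \<bullet> x \<le> u \<bullet> up h x"
      using jump_exponent_le_drift[OF u x] h by (simp add: step_inner[OF h] up_def inner_add_right mult_left_mono)
  qed
qed

end

section \<open>The flow as a limit of the scheme\<close>

locale riccati_flow = riccati_generator \<mu> B
  for \<mu> :: "('d::finite) sym_matrix set \<Rightarrow> 'd sym_matrix" and B :: "'d sym_matrix \<Rightarrow> 'd sym_matrix" +
  fixes \<psi> :: "real \<Rightarrow> 'd sym_matrix \<Rightarrow> 'd sym_matrix"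
  assumes flow_0: "\<And>u. u \<in> psd \<Longrightarrow> \<psi> 0 u = u"
    and flow_psd: "\<And>u t. u \<in> psd \<Longrightarrow> 0 \<le> t \<Longrightarrow> \<psi> t u \<in> psd"
    and flow_deriv: "\<And>u t. u \<in> psd \<Longrightarrow> 0 \<le> t \<Longrightarrow>
      ((\<lambda>s. \<psi> s u) has_vector_derivative drift_R 0 B \<mu> (\<psi> t u)) (at t within {0..})"
begin

lemma riccati_scheme_converges:
  assumes t: "0 \<le> t" and u: "u \<in> psd"
    and "0 < h0" "0 \<le> K"
    and psd: "\<And>h u. 0 \<le> h \<Longrightarrow> h \<le> h0 \<Longrightarrow> u \<in> psd \<Longrightarrow> step h u \<in> psd"
    and cons: "\<And>h u. 0 \<le> h \<Longrightarrow> h \<le> h0 \<Longrightarrow> u \<in> psd \<Longrightarrow>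
      norm (step h u - u - h *\<^sub>R drift_R 0 B \<mu> u) \<le> K * h\<^sup>2 * norm u"
  shows "(\<lambda>n. (step (t / real n) ^^ n) u) \<longlonglongrightarrow> \<psi> t u"
proof -
  obtain L where L: "0 \<le> L"
    "\<And>u v. u \<in> psd \<Longrightarrow> v \<in> psd \<Longrightarrow> norm (jump_exponent u - jump_exponent v) \<le> L * norm (u - v)"
    using jump_exponent_lipschitz by blast
  have adj: "linear (adjoint B)"
    by (rule adjoint_linear[OF linear_B])
  obtain K' where K': "0 < K'" "\<And>u. norm (adjoint B u) \<le> K' * norm u"
    using linear_norm_bound[OF adj] by blast
  have "(\<lambda>n. (step (t / real n) ^^ n) (\<psi> 0 u)) \<longlonglongrightarrow> \<psi> t u"
  proof (rule one_step_scheme_converges[where S = psd and R = "drift_R 0 B \<mu>" and L = "K' + L" and K = K and \<eta> = h0 and y = "\<lambda>s. \<psi> s u"])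
    show "((\<lambda>s. \<psi> s u) has_vector_derivative drift_R 0 B \<mu> (\<psi> s u)) (at s within {0..t})" if "s \<in> {0..t}" for s
      using that by (intro has_vector_derivative_within_subset[OF flow_deriv[OF u]]) auto
    show "\<psi> s u \<in> psd" if "s \<in> {0..t}" for s
      using flow_psd[OF u] that by auto
    show "norm (drift_R 0 B \<mu> v - drift_R 0 B \<mu> w) \<le> (K' + L) * norm (v - w)" if "v \<in> psd" "w \<in> psd" for v w
    proof -
      have "drift_R 0 B \<mu> v - drift_R 0 B \<mu> w = adjoint B (v - w) + (jump_exponent v - jump_exponent w)"
        by (simp add: drift_R_eq linear_diff[OF adj])
      then have "norm (drift_R 0 B \<mu> v - drift_R 0 B \<mu> w) \<le> norm (adjoint B (v - w)) + norm (jump_exponent v - jump_exponent w)"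
        using norm_triangle_ineq by metis
      also have "\<dots> \<le> K' * norm (v - w) + L * norm (v - w)"
        using K'(2) L(2)[OF that] by (intro add_mono)
      finally show ?thesis
        by (simp add: distrib_right)
    qed
  qed (use t L(1) K'(1) \<open>0 < h0\<close> \<open>0 \<le> K\<close> psd cons in auto)
  then show ?thesis
    by (simp add: flow_0[OF u])
qed

lemma
  assumes t: "0 \<le> t" and x: "x \<in> psd"
  shows laplace_limit_flow: "laplace_limit (\<lambda>u. exp (- (\<psi> t u \<bullet> x)))"
    and flow_le_mean_flow: "u \<in> psd \<Longrightarrow> \<psi> t u \<bullet> x \<le> u \<bullet> mean_flow t x"
proof -
  obtain step up h0 K where h0: "0 < h0" "0 \<le> K"
    and psd: "\<And>h u. 0 \<le> h \<Longrightarrow> h \<le> h0 \<Longrightarrow> u \<in> psd \<Longrightarrow> step h u \<in> psd"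
    and cons: "\<And>h u. 0 \<le> h \<Longrightarrow> h \<le> h0 \<Longrightarrow> u \<in> psd \<Longrightarrow>
      norm (step h u - u - h *\<^sub>R drift_R 0 B \<mu> u) \<le> K * h\<^sup>2 * norm u"
    and lap: "\<And>h x. 0 \<le> h \<Longrightarrow> h \<le> h0 \<Longrightarrow> x \<in> psd \<Longrightarrow> laplace_limit (\<lambda>u. exp (- (step h u \<bullet> x)))"
    and up_psd: "\<And>h x. 0 \<le> h \<Longrightarrow> h \<le> h0 \<Longrightarrow> x \<in> psd \<Longrightarrow> up h x \<in> psd"
    and up_cons: "\<And>h x. 0 \<le> h \<Longrightarrow> h \<le> h0 \<Longrightarrow>
      norm (up h x - x - h *\<^sub>R effective_drift B \<mu> x) \<le> K * h\<^sup>2 * norm x"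
    and le: "\<And>h u x. 0 \<le> h \<Longrightarrow> h \<le> h0 \<Longrightarrow> u \<in> psd \<Longrightarrow> x \<in> psd \<Longrightarrow> step h u \<bullet> x \<le> u \<bullet> up h x"
    by (rule riccati_scheme) blast
  obtain N where N: "\<And>n. N \<le> n \<Longrightarrow> t / real n \<le> h0"
    using order_tendstoD(2)[OF lim_const_over_n h0(1), of t] unfolding eventually_sequentially
    by (meson less_imp_le)
  have step_lim: "(\<lambda>n. (step (t / real n) ^^ n) u \<bullet> x) \<longlonglongrightarrow> \<psi> t u \<bullet> x" if "u \<in> psd" for u
    by (intro tendsto_intros riccati_scheme_converges[OF t that h0 psd cons])
  have iter: "laplace_limit (\<lambda>u. exp (- ((step h ^^ n) u \<bullet> x)))" if h: "0 \<le> h" "h \<le> h0" for h n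
  proof (induction n)
    case 0
    show ?case
      using laplace_limit_exp[OF x] by simp
  next
    case (Suc n)
    \<comment> \<open>The innermost step is split off, so that the new step is substituted into a
      function already known to be a limit of transforms.\<close>
    have "laplace_limit (\<lambda>u. exp (- ((step h ^^ n) (step h u) \<bullet> x)))"
      by (rule laplace_limit_compose[OF Suc psd[OF h] lap[OF h]])
    then show ?case
      by (simp add: funpow_swap1)
  qed
  show "laplace_limit (\<lambda>u. exp (- (\<psi> t u \<bullet> x)))"
  proof (rule laplace_limit_lim)
    show "laplace_limit (\<lambda>u. exp (- ((step (t / real (n + N)) ^^ (n + N)) u \<bullet> x)))" for n
      using N[of "n + N"] t by (intro iter) auto
    fix u :: "'d sym_matrix"
    assume "u \<in> psd"
    from tendsto_exp[OF tendsto_minus[OF step_lim[OF this]]]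
    show "(\<lambda>n. exp (- ((step (t / real (n + N)) ^^ (n + N)) u \<bullet> x))) \<longlonglongrightarrow> exp (- (\<psi> t u \<bullet> x))"
      by (rule LIMSEQ_ignore_initial_segment)
  qed
  assume u: "u \<in> psd"
  \<comment> \<open>Each outermost \<open>step\<close> on the left is moved to the right as an
    \<open>up\<close> on the state. The state therefore changes along the induction, and
    \<open>x\<close> has to be arbitrary.\<close>
  have iter_le: "(step h ^^ n) u \<in> psd \<and> (step h ^^ n) u \<bullet> x \<le> u \<bullet> (up h ^^ n) x"
    if h: "0 \<le> h" "h \<le> h0" and x: "x \<in> psd" for h n x
    using x
  proof (induction n arbitrary: x)
    case (Suc n)
    then have "(step h ^^ n) u \<in> psd"
      by blast
    with Suc.prems have "step h ((step h ^^ n) u) \<bullet> x \<le> (step h ^^ n) u \<bullet> up h x"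
      by (intro le h)
    also have "\<dots> \<le> u \<bullet> (up h ^^ n) (up h x)"
      using Suc.IH up_psd[OF h Suc.prems] by blast
    finally show ?case
      using psd[OF h \<open>(step h ^^ n) u \<in> psd\<close>] by (simp add: funpow_swap1)
  qed (use u in simp)
  note lin = linear_effective_drift
  obtain L where L: "0 < L" "\<And>x. norm (effective_drift B \<mu> x) \<le> L * norm x"
    using linear_norm_bound[OF lin] by blast
  let ?E = "\<lambda>s. mean_flow s x"
  have "(\<lambda>n. (up (t / real n) ^^ n) (?E 0)) \<longlonglongrightarrow> ?E t"
  proof (rule one_step_scheme_converges[where S = UNIV and R = "effective_drift B \<mu>" and L = L and K = K and \<eta> = h0 and y = ?E])
    show "(?E has_vector_derivative effective_drift B \<mu> (?E s)) (at s within {0..t})" for s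
      by (rule has_vector_derivative_at_within[OF has_vector_derivative_exp_map[OF lin]])
    show "norm (effective_drift B \<mu> v - effective_drift B \<mu> w) \<le> L * norm (v - w)" for v w
      using L(2)[of "v - w"] by (simp add: linear_diff[OF lin])
  qed (use t L(1) h0 up_cons in auto)
  then have up_lim: "(\<lambda>n. u \<bullet> (up (t / real n) ^^ n) x) \<longlonglongrightarrow> u \<bullet> ?E t"
    unfolding exp_map_0[OF lin] by (intro tendsto_intros)
  show "\<psi> t u \<bullet> x \<le> u \<bullet> mean_flow t x"
    using iter_le x t N by (intro LIMSEQ_le[OF step_lim[OF u] up_lim]) (auto intro!: exI[of _ N])
qed

end

section \<open>Convolutions, couplings and first moments\<close>

lemma space_psd_measure: "sets q = sets psd_space \<Longrightarrow> space q = psd"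
  using sets_eq_imp_space_eq[of q psd_space] by (simp add: space_restrict_space)

lemma borel_measurable_psd_measure:
  "sets q = sets psd_space \<Longrightarrow> f \<in> borel_measurable borel \<Longrightarrow> f \<in> borel_measurable q"
  by (simp add: measurable_cong_sets[of q psd_space] measurable_restrict_space1)

lemma nn_laplace_transform:
  fixes q :: "('d::finite) sym_matrix measure"
  assumes "prob_space q" "sets q = sets psd_space" "u \<in> psd"
  shows "(\<integral>\<^sup>+\<xi>. ennreal (exp (- (u \<bullet> \<xi>))) \<partial>q) = ennreal (laplace_transform q u)"
  using integrable_exp_psd[OF assms] by (intro nn_integral_eq_integral) (simp_all add: inner_commute)

lemma nn_integral_prob_pair:
  assumes "prob_space A" "prob_space B"
  shows "f \<in> borel_measurable A \<Longrightarrow> (\<integral>\<^sup>+z. f (fst z) \<partial>(A \<Otimes>\<^sub>M B)) = integral\<^sup>N A f"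
    and "g \<in> borel_measurable B \<Longrightarrow> (\<integral>\<^sup>+z. g (snd z) \<partial>(A \<Otimes>\<^sub>M B)) = integral\<^sup>N B g"
proof -
  interpret A: prob_space A by fact
  interpret B: prob_space B by fact
  show "(\<integral>\<^sup>+z. f (fst z) \<partial>(A \<Otimes>\<^sub>M B)) = integral\<^sup>N A f" if [measurable]: "f \<in> borel_measurable A"
    by (subst B.nn_integral_fst[symmetric]) (simp_all add: B.emeasure_space_1)
  show "(\<integral>\<^sup>+z. g (snd z) \<partial>(A \<Otimes>\<^sub>M B)) = integral\<^sup>N B g" if [measurable]: "g \<in> borel_measurable B"
    by (subst B.nn_integral_fst[symmetric]) (simp_all add: A.emeasure_space_1)
qed

text \<open>Factorisation of transforms identifies \<open>P\<close> as the law of an independent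
  sum. The second summand is a random variable on a larger space \<open>K\<close>, because in the
  coupling it is one projection of a product. Nonnegative integrals allow Tonelli without
  integrability conditions.\<close>

lemma distr_convolution_eq:
  fixes r P :: "('d::finite) sym_matrix measure"
  assumes r: "prob_space r" "sets r = sets psd_space" and P: "prob_space P" "sets P = sets psd_space"
    and K: "prob_space K" and X [measurable]: "X \<in> K \<rightarrow>\<^sub>M psd_space"
    and laplace: "\<And>u. u \<in> psd \<Longrightarrow> (\<integral>\<^sup>+\<xi>. ennreal (exp (- (u \<bullet> \<xi>))) \<partial>P)
      = (\<integral>\<^sup>+\<xi>. ennreal (exp (- (u \<bullet> \<xi>))) \<partial>r) * (\<integral>\<^sup>+k. ennreal (exp (- (u \<bullet> X k))) \<partial>K)"
  shows "(\<lambda>z. fst z + X (snd z)) \<in> r \<Otimes>\<^sub>M K \<rightarrow>\<^sub>M psd_space"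
    and "distr (r \<Otimes>\<^sub>M K) psd_space (\<lambda>z. fst z + X (snd z)) = P"
proof -
  interpret K: prob_space K by fact
  interpret r: prob_space r by fact
  interpret pair_prob_space r K ..
  have X_borel [measurable]: "X \<in> borel_measurable K"
    using X by (auto simp: measurable_restrict_space2_iff)
  have id [measurable]: "(\<lambda>\<xi>. \<xi>) \<in> borel_measurable r"
    using r(2) by (rule borel_measurable_psd_measure) simp
  have [measurable]: "fst \<in> borel_measurable (r \<Otimes>\<^sub>M K)"
    using measurable_compose[OF measurable_fst id] by simp
  have X_psd: "X k \<in> psd" if "k \<in> space K" for k
    using measurable_space[OF X that] by (simp add: space_restrict_space)
  show sum [measurable]: "(\<lambda>z. fst z + X (snd z)) \<in> r \<Otimes>\<^sub>M K \<rightarrow>\<^sub>M psd_space"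
    by (intro measurable_restrict_space2)
      (auto simp: space_pair_measure space_psd_measure[OF r(2)] X_psd intro!: psd_add)
  let ?Q = "distr (r \<Otimes>\<^sub>M K) psd_space (\<lambda>z. fst z + X (snd z))"
  have Q: "prob_space ?Q" "sets ?Q = sets psd_space"
    by (simp_all add: prob_space_distr)
  show "?Q = P"
  proof (rule laplace_transform_unique[OF Q P])
    fix u :: "'d sym_matrix"
    assume "u \<in> laplace_directions"
    then have u: "u \<in> psd"
      using laplace_directions_psd by blast
    have "(\<integral>\<^sup>+\<xi>. ennreal (exp (- (u \<bullet> \<xi>))) \<partial>?Q)
        = (\<integral>\<^sup>+z. ennreal (exp (- (u \<bullet> (fst z + X (snd z))))) \<partial>(r \<Otimes>\<^sub>M K))"
      by (intro nn_integral_distr sum) (simp add: measurable_restrict_space1)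
    also have "\<dots> = (\<integral>\<^sup>+\<xi>. \<integral>\<^sup>+k. ennreal (exp (- (u \<bullet> (\<xi> + X k)))) \<partial>K \<partial>r)"
      by (subst K.nn_integral_fst[symmetric]) simp_all
    also have "\<dots> = (\<integral>\<^sup>+\<xi>. \<integral>\<^sup>+k. ennreal (exp (- (u \<bullet> \<xi>))) * ennreal (exp (- (u \<bullet> X k))) \<partial>K \<partial>r)"
      by (simp add: inner_add_right exp_add exp_diff flip: ennreal_mult) (simp add: exp_minus divide_inverse mult.commute)
    also have "\<dots> = (\<integral>\<^sup>+\<xi>. ennreal (exp (- (u \<bullet> \<xi>))) \<partial>r) * (\<integral>\<^sup>+k. ennreal (exp (- (u \<bullet> X k))) \<partial>K)"
      by (simp add: nn_integral_cmult nn_integral_multc)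
    finally have "(\<integral>\<^sup>+\<xi>. ennreal (exp (- (u \<bullet> \<xi>))) \<partial>?Q) = (\<integral>\<^sup>+\<xi>. ennreal (exp (- (u \<bullet> \<xi>))) \<partial>P)"
      by (simp add: laplace[OF u])
    then show "(\<integral>\<xi>. exp (- (\<xi> \<bullet> u)) \<partial>?Q) = (\<integral>\<xi>. exp (- (\<xi> \<bullet> u)) \<partial>P)"
      unfolding nn_laplace_transform[OF Q u] nn_laplace_transform[OF P u]
      by (subst (asm) ennreal_inj) (auto simp: inner_commute)
  qed
qed

text \<open>
  The same \<open>r\<close>-distributed summand is used in both laws and cancels in the transport cost.
\<close>

lemma wasserstein1_common_factor:
  fixes r q q' P P' :: "('d::finite) sym_matrix measure"
  assumes r: "prob_space r" "sets r = sets psd_space"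
    and q: "prob_space q" "sets q = sets psd_space" and q': "prob_space q'" "sets q' = sets psd_space"
    and P: "prob_space P" "sets P = sets psd_space" and P': "prob_space P'" "sets P' = sets psd_space"
    and laplace: "\<And>u. u \<in> psd \<Longrightarrow> laplace_transform P u = laplace_transform r u * laplace_transform q u"
    and laplace': "\<And>u. u \<in> psd \<Longrightarrow> laplace_transform P' u = laplace_transform r u * laplace_transform q' u"
  shows "wasserstein1 P P' \<le> (\<integral>\<^sup>+\<xi>. ennreal (norm \<xi>) \<partial>q) + (\<integral>\<^sup>+\<xi>. ennreal (norm \<xi>) \<partial>q')"
proof -
  let ?K = "q \<Otimes>\<^sub>M q'"
  let ?N = "r \<Otimes>\<^sub>M ?K"
  interpret r: prob_space r by fact
  interpret q: prob_space q by fact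
  interpret q': prob_space q' by fact
  interpret K: pair_prob_space q q' ..
  interpret N: pair_prob_space r ?K ..
  have fst_K [measurable]: "fst \<in> ?K \<rightarrow>\<^sub>M psd_space" and snd_K [measurable]: "snd \<in> ?K \<rightarrow>\<^sub>M psd_space"
    using measurable_fst[of q q'] measurable_snd[of q q'] q(2) q'(2)
    by (simp_all cong: measurable_cong_sets)
  have exp_meas: "(\<lambda>\<xi>. ennreal (exp (- (u \<bullet> \<xi>)))) \<in> borel_measurable M" "(\<lambda>\<xi>. ennreal (norm \<xi>)) \<in> borel_measurable M"
    if "sets M = sets psd_space" for M and u :: "'d sym_matrix"
    by (rule borel_measurable_psd_measure[OF that], measurable)+
  have l: "(\<integral>\<^sup>+\<xi>. ennreal (exp (- (u \<bullet> \<xi>))) \<partial>P)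
      = (\<integral>\<^sup>+\<xi>. ennreal (exp (- (u \<bullet> \<xi>))) \<partial>r) * (\<integral>\<^sup>+k. ennreal (exp (- (u \<bullet> fst k))) \<partial>?K)" if u: "u \<in> psd" for u
    using nn_integral_prob_pair(1)[OF q(1) q'(1) exp_meas(1)[OF q(2)], of u] laplace[OF u]
    by (simp add: nn_laplace_transform[OF _ _ u] r q P ennreal_mult)
  have l': "(\<integral>\<^sup>+\<xi>. ennreal (exp (- (u \<bullet> \<xi>))) \<partial>P')
      = (\<integral>\<^sup>+\<xi>. ennreal (exp (- (u \<bullet> \<xi>))) \<partial>r) * (\<integral>\<^sup>+k. ennreal (exp (- (u \<bullet> snd k))) \<partial>?K)" if u: "u \<in> psd" for u
    using nn_integral_prob_pair(2)[OF q(1) q'(1) exp_meas(1)[OF q'(2)], of u] laplace'[OF u]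
    by (simp add: nn_laplace_transform[OF _ _ u] r q' P' ennreal_mult)
  note D = distr_convolution_eq[OF r P K.prob_space_axioms fst_K l]
  note D' = distr_convolution_eq[OF r P' K.prob_space_axioms snd_K l']
  \<comment> \<open>A triple of independent variables is sent to two sums with the same first
    summand; their difference involves only the other two.\<close>
  define f where "f z = (fst z + fst (snd z), fst z + snd (snd z))" for z :: "'d sym_matrix \<times> 'd sym_matrix \<times> 'd sym_matrix"
  have f [measurable]: "f \<in> ?N \<rightarrow>\<^sub>M P \<Otimes>\<^sub>M P'"
    unfolding f_def using D(1) D'(1) P(2) P'(2) by (intro measurable_Pair) (simp_all cong: measurable_cong_sets)
  have fst_f: "fst \<circ> f = (\<lambda>z. fst z + fst (snd z))" and snd_f: "snd \<circ> f = (\<lambda>z. fst z + snd (snd z))"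
    by (auto simp: f_def)
  let ?H = "distr ?N (P \<Otimes>\<^sub>M P') f"
  have marginals: "distr ?H P fst = P" "distr ?H P' snd = P'"
  proof -
    have "distr ?H P fst = distr ?N P (fst \<circ> f)"
      by (simp add: distr_distr)
    also have "\<dots> = P"
      unfolding fst_f using D(2) P(2) by (simp cong: distr_cong)
    finally show "distr ?H P fst = P" .
    have "distr ?H P' snd = distr ?N P' (snd \<circ> f)"
      by (simp add: distr_distr)
    also have "\<dots> = P'"
      unfolding snd_f using D'(2) P'(2) by (simp cong: distr_cong)
    finally show "distr ?H P' snd = P'" .
  qed
  have "?H \<in> couplings P P'"
    using marginals f by (simp add: couplings_def N.prob_space_distr)
  then have "wasserstein1 P P' \<le> (\<integral>\<^sup>+z. ennreal (norm (fst z - snd z)) \<partial>?H)"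
    unfolding wasserstein1_def by (rule INF_lower)
  also have "\<dots> = (\<integral>\<^sup>+z. ennreal (norm (fst (f z) - snd (f z))) \<partial>?N)"
  proof (rule nn_integral_distr[OF f])
    have id: "(\<lambda>\<xi>. \<xi>) \<in> borel_measurable P" "(\<lambda>\<xi>. \<xi>) \<in> borel_measurable P'"
      using P(2) P'(2) by (auto intro: borel_measurable_psd_measure)
    have [measurable]: "fst \<in> borel_measurable (P \<Otimes>\<^sub>M P')" "snd \<in> borel_measurable (P \<Otimes>\<^sub>M P')"
      by (rule measurable_compose[OF measurable_fst id(1)], rule measurable_compose[OF measurable_snd id(2)])
    show "(\<lambda>z. ennreal (norm (fst z - snd z))) \<in> borel_measurable ?H"
      unfolding measurable_distr_eq1 by measurable
  qed
  also have "\<dots> \<le> (\<integral>\<^sup>+z. ennreal (norm (fst (snd z))) + ennreal (norm (snd (snd z))) \<partial>?N)"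
    by (intro nn_integral_mono) (simp add: f_def norm_triangle_ineq4 flip: ennreal_plus)
  also have "\<dots> = (\<integral>\<^sup>+k. ennreal (norm (fst k)) + ennreal (norm (snd k)) \<partial>?K)"
  proof -
    have [measurable]: "(\<lambda>k. ennreal (norm (fst k))) \<in> borel_measurable ?K" "(\<lambda>k. ennreal (norm (snd k))) \<in> borel_measurable ?K"
      using measurable_compose[OF measurable_fst exp_meas(2)[OF q(2)]]
        measurable_compose[OF measurable_snd exp_meas(2)[OF q'(2)]] by auto
    show ?thesis
      by (rule nn_integral_prob_pair(2)[OF r(1) K.prob_space_axioms]) measurable
  qed
  also have "\<dots> = (\<integral>\<^sup>+k. ennreal (norm (fst k)) \<partial>?K) + (\<integral>\<^sup>+k. ennreal (norm (snd k)) \<partial>?K)"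
    using measurable_compose[OF measurable_fst exp_meas(2)[OF q(2)]]
      measurable_compose[OF measurable_snd exp_meas(2)[OF q'(2)]]
    by (intro nn_integral_add) auto
  also have "\<dots> = (\<integral>\<^sup>+\<xi>. ennreal (norm \<xi>) \<partial>q) + (\<integral>\<^sup>+\<xi>. ennreal (norm \<xi>) \<partial>q')"
    by (simp only: nn_integral_prob_pair(1)[OF q(1) q'(1) exp_meas(2)[OF q(2)]]
        nn_integral_prob_pair(2)[OF q(1) q'(1) exp_meas(2)[OF q'(2)]])
  finally show ?thesis .
qed

section \<open>First moments from Laplace transforms\<close>

lemma exp_difference_quotient:
  fixes a :: real
  shows "(\<lambda>k. real (Suc k) * (1 - exp (- (a / real (Suc k))))) \<longlonglongrightarrow> a"
proof -
  have "((\<lambda>h. - exp (- (a * h))) has_real_derivative a) (at 0)"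
    by (auto intro!: derivative_eq_intros)
  then have "((\<lambda>h. (- exp (- (a * h)) + 1) / h) \<longlongrightarrow> a) (at 0)"
    by (simp add: has_field_derivative_iff)
  moreover have "filterlim (\<lambda>k. inverse (real (Suc k))) (at 0) sequentially"
    using LIMSEQ_inverse_real_of_nat by (auto simp: filterlim_at intro!: always_eventually)
  ultimately have "(\<lambda>k. (- exp (- (a * inverse (real (Suc k)))) + 1) / inverse (real (Suc k))) \<longlonglongrightarrow> a"
    by (rule filterlim_compose)
  then show ?thesis
    by (simp add: divide_inverse algebra_simps)
qed

text \<open>Fatou's lemma: \<open>k * (1 - exp (- trace / k))\<close> tends to the trace, which
  dominates the norm on the cone. Only multiples of the identity are needed as arguments.\<close>

lemma first_moment_from_laplace:
  fixes q :: "('d::finite) sym_matrix measure"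
  assumes q: "prob_space q" "sets q = sets psd_space"
    and C: "\<And>k. 1 - laplace_transform q ((1 / real (Suc k)) *\<^sub>R sym_one) \<le> C / real (Suc k)"
  shows "(\<integral>\<^sup>+\<xi>. ennreal (norm \<xi>) \<partial>q) \<le> ennreal C"
proof -
  interpret prob_space q by fact
  define f where "f k \<xi> = real (Suc k) * (1 - exp (- (((1 / real (Suc k)) *\<^sub>R sym_one) \<bullet> \<xi>)))" for k and \<xi> :: "'d sym_matrix"
  have meas: "(\<lambda>\<xi>. ennreal (f k \<xi>)) \<in> borel_measurable q" for k
    unfolding f_def by (rule borel_measurable_psd_measure[OF q(2)]) measurable
  have nonneg: "0 \<le> sym_one \<bullet> \<xi>" if "\<xi> \<in> space q" for \<xi> :: "'d sym_matrix"
    using that by (simp add: space_psd_measure[OF q(2)] psd_inner_nonneg)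
  have "(\<integral>\<^sup>+\<xi>. ennreal (norm \<xi>) \<partial>q) \<le> (\<integral>\<^sup>+\<xi>. liminf (\<lambda>k. ennreal (f k \<xi>)) \<partial>q)"
  proof (rule nn_integral_mono)
    fix \<xi> :: "'d sym_matrix"
    assume \<xi>: "\<xi> \<in> space q"
    have "(\<lambda>k. f k \<xi>) \<longlonglongrightarrow> sym_one \<bullet> \<xi>"
      using exp_difference_quotient[of "sym_one \<bullet> \<xi>"] by (simp add: f_def)
    then have "(\<lambda>k. ennreal (f k \<xi>)) \<longlonglongrightarrow> ennreal (sym_one \<bullet> \<xi>)"
      by (rule tendsto_ennrealI)
    then have "liminf (\<lambda>k. ennreal (f k \<xi>)) = ennreal (sym_one \<bullet> \<xi>)"
      by (intro lim_imp_Liminf) simp_all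
    then show "ennreal (norm \<xi>) \<le> liminf (\<lambda>k. ennreal (f k \<xi>))"
      using \<xi> by (simp add: norm_le_inner_one space_psd_measure[OF q(2)] ennreal_leI)
  qed
  also have "\<dots> \<le> liminf (\<lambda>k. \<integral>\<^sup>+\<xi>. ennreal (f k \<xi>) \<partial>q)"
    using meas by (rule nn_integral_liminf)
  also have "\<dots> \<le> liminf (\<lambda>k::nat. ennreal C)"
  proof (intro Liminf_mono always_eventually allI)
    fix k
    have psd: "(1 / real (Suc k)) *\<^sub>R sym_one \<in> (psd :: 'd sym_matrix set)"
      by (simp add: psd_scaleR)
    have int: "integrable q (\<lambda>\<xi>. exp (- (((1 / real (Suc k)) *\<^sub>R sym_one) \<bullet> \<xi>)))"
      using integrable_exp_psd[OF q psd] by (simp add: inner_commute)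
    have "(\<integral>\<^sup>+\<xi>. ennreal (f k \<xi>) \<partial>q) = ennreal (\<integral>\<xi>. f k \<xi> \<partial>q)"
    proof (rule nn_integral_eq_integral)
      show "integrable q (f k)"
        unfolding f_def using int by (intro integrable_mult_right Bochner_Integration.integrable_diff) auto
      show "AE \<xi> in q. 0 \<le> f k \<xi>"
        using nonneg unfolding f_def by (intro AE_I2 mult_nonneg_nonneg) auto
    qed
    also have "(\<integral>\<xi>. f k \<xi> \<partial>q) = real (Suc k) * (1 - laplace_transform q ((1 / real (Suc k)) *\<^sub>R sym_one))"
      unfolding f_def integral_mult_right_zero
      by (subst Bochner_Integration.integral_diff[OF integrable_const int]) (simp add: prob_space)
    also have "ennreal \<dots> \<le> ennreal C"
      using mult_left_mono[OF C[of k], of "real (Suc k)"] by (intro ennreal_leI) (simp del: of_nat_Suc)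
    finally show "(\<integral>\<^sup>+\<xi>. ennreal (f k \<xi>) \<partial>q) \<le> ennreal C" .
  qed
  also have "\<dots> = ennreal C"
    by (simp add: Liminf_const)
  finally show ?thesis .
qed

section \<open>Contraction to the invariant distribution\<close>

locale affine_without_diffusion = riccati_flow \<mu> B \<psi>
  for \<mu> :: "('d::finite) sym_matrix set \<Rightarrow> 'd sym_matrix" and B :: "'d sym_matrix \<Rightarrow> 'd sym_matrix"
    and \<psi> :: "real \<Rightarrow> 'd sym_matrix \<Rightarrow> 'd sym_matrix" +
  fixes b :: "'d sym_matrix" and m :: "'d sym_matrix measure"
    and \<phi> :: "real \<Rightarrow> 'd sym_matrix \<Rightarrow> real"
    and p :: "real \<Rightarrow> 'd sym_matrix \<Rightarrow> 'd sym_matrix measure" and M \<delta> :: real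
  assumes b_psd: "b \<in> psd" and sets_m: "sets m = sets jump_space"
    and m_small: "(\<integral>\<^sup>+\<xi>. ennreal (min (norm \<xi>) 1) \<partial>m) < \<infinity>"
    and m_large: "(\<integral>\<^sup>+\<xi>\<in>{\<xi>. norm \<xi> > 1}. ennreal (norm \<xi>) \<partial>m) < \<infinity>"
    and phi_0: "\<And>u. u \<in> psd \<Longrightarrow> \<phi> 0 u = 0"
    and phi_deriv: "\<And>u t. u \<in> psd \<Longrightarrow> 0 \<le> t \<Longrightarrow>
      ((\<lambda>s. \<phi> s u) has_real_derivative drift_F b m (\<psi> t u)) (at t within {0..})"
    and semigroup: "transition_semigroup p"
    and laplace: "\<And>t x u. 0 \<le> t \<Longrightarrow> x \<in> psd \<Longrightarrow> u \<in> psd \<Longrightarrow>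
      laplace_transform (p t x) u = exp (- \<phi> t u - \<psi> t u \<bullet> x)"
    and M_nonneg: "0 \<le> M" and \<delta>_pos: "0 < \<delta>"
    and decay: "\<And>s. 0 \<le> s \<Longrightarrow> onorm (mean_flow s) \<le> M * exp (- \<delta> * s)"
begin

lemma norm_mean_flow:
  assumes "0 \<le> s"
  shows "norm (mean_flow s x) \<le> M * exp (- \<delta> * s) * norm x"
proof -
  have "bounded_linear (mean_flow s)"
    using linear_exp_map[OF linear_effective_drift] by (simp add: linear_conv_bounded_linear)
  then have "norm (mean_flow s x)
      \<le> onorm (mean_flow s) * norm x"
    by (rule onorm)
  also have "\<dots> \<le> M * exp (- \<delta> * s) * norm x"
    using decay[OF assms] by (rule mult_right_mono) simp
  finally show ?thesis .
qed

lemma flow_bound: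
  assumes "0 \<le> t" "u \<in> psd" "x \<in> psd"
  shows "\<psi> t u \<bullet> x \<le> norm u * (M * exp (- \<delta> * t) * norm x)"
proof -
  have "\<psi> t u \<bullet> x \<le> u \<bullet> mean_flow t x"
    by (rule flow_le_mean_flow[OF assms(1,3,2)])
  also have "\<dots> \<le> norm u * norm (mean_flow t x)"
    by (rule norm_cauchy_schwarz)
  also have "\<dots> \<le> norm u * (M * exp (- \<delta> * t) * norm x)"
    using norm_mean_flow[OF assms(1)] by (intro mult_left_mono) simp_all
  finally show ?thesis .
qed

lemma flow_nonneg: "0 \<le> t \<Longrightarrow> u \<in> psd \<Longrightarrow> x \<in> psd \<Longrightarrow> 0 \<le> \<psi> t u \<bullet> x"
  using flow_psd psd_inner_nonneg by blast

section \<open>Bounds on the immigration part\<close>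

lemma space_m: "space m = psd - {0}"
  using sets_eq_imp_space_eq[OF sets_m] by (simp add: space_restrict_space)

lemma measurable_m: "f \<in> borel_measurable borel \<Longrightarrow> f \<in> borel_measurable m"
  unfolding measurable_cong_sets[OF sets_m refl] by (rule measurable_restrict_space1)

lemma integrable_ident_m: "integrable m (\<lambda>\<xi>. \<xi>)"
proof -
  have meas: "(\<lambda>\<xi>. ennreal (min (norm \<xi>) 1)) \<in> borel_measurable m"
    "(\<lambda>\<xi>. ennreal (norm \<xi>) * indicator {\<xi>. norm \<xi> > 1} \<xi>) \<in> borel_measurable m"
    by (intro measurable_m; measurable)+
  have "(\<integral>\<^sup>+\<xi>. ennreal (norm \<xi>) \<partial>m)
      \<le> (\<integral>\<^sup>+\<xi>. ennreal (min (norm \<xi>) 1) + ennreal (norm \<xi>) * indicator {\<xi>. norm \<xi> > 1} \<xi> \<partial>m)"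
    by (intro nn_integral_mono) (auto simp: indicator_def min_def)
  also have "\<dots> < \<infinity>"
    using m_small m_large by (simp add: nn_integral_add[OF meas] less_top)
  finally show ?thesis
    by (simp add: integrable_iff_bounded measurable_m)
qed

text \<open>The gradient of \<open>drift_F\<close> at 0; the linear functional that it defines
  dominates \<open>drift_F\<close> on the cone.\<close>

definition mean_immigration :: "'d sym_matrix" where
  "mean_immigration = b + (\<integral>\<xi>. \<xi> \<partial>m)"

lemma inner_mean_immigration: "v \<bullet> mean_immigration = b \<bullet> v + (\<integral>\<xi>. v \<bullet> \<xi> \<partial>m)"
  using integrable_ident_m by (simp add: mean_immigration_def inner_add_right inner_commute)

lemma mean_immigration_psd: "mean_immigration \<in> psd"
proof -
  have "0 \<le> mean_immigration \<bullet> v" if v: "v \<in> psd" for v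
  proof -
    have "0 \<le> (\<integral>\<xi>. v \<bullet> \<xi> \<partial>m)"
      using v by (intro integral_nonneg_AE AE_I2) (auto simp: space_m psd_inner_nonneg)
    then show ?thesis
      using psd_inner_nonneg[OF v b_psd] inner_mean_immigration[of v] by (simp add: inner_commute)
  qed
  then show ?thesis
    using psd_self_dual by blast
qed

lemma drift_F_le:
  assumes v: "v \<in> psd"
  shows "drift_F b m v \<le> v \<bullet> mean_immigration"
proof -
  have int: "integrable m (\<lambda>\<xi>. 1 - exp (- (v \<bullet> \<xi>)))"
  proof (rule Bochner_Integration.integrable_bound)
    show "integrable m (\<lambda>\<xi>. norm v * norm \<xi>)"
      using integrable_norm[OF integrable_ident_m] by simp
    show "(\<lambda>\<xi>. 1 - exp (- (v \<bullet> \<xi>))) \<in> borel_measurable m"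
      by (intro measurable_m) measurable
    show "AE \<xi> in m. norm (1 - exp (- (v \<bullet> \<xi>))) \<le> norm (norm v * norm \<xi>)"
      using exp_minus_one_bound[OF v] by (intro AE_I2) (auto simp: space_m abs_minus_commute)
  qed
  have "- (\<integral>\<xi>. exp (- (v \<bullet> \<xi>)) - 1 \<partial>m) = (\<integral>\<xi>. 1 - exp (- (v \<bullet> \<xi>)) \<partial>m)"
    unfolding integral_minus[symmetric] by simp
  also have "\<dots> \<le> (\<integral>\<xi>. v \<bullet> \<xi> \<partial>m)"
  proof (rule integral_mono[OF int])
    show "integrable m (\<lambda>\<xi>. v \<bullet> \<xi>)"
      using integrable_ident_m by simp
    show "1 - exp (- (v \<bullet> \<xi>)) \<le> v \<bullet> \<xi>" for \<xi>
      using exp_ge_add_one_self[of "- (v \<bullet> \<xi>)"] by simp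
  qed
  finally show ?thesis
    by (simp add: drift_F_def inner_mean_immigration)
qed

text \<open>The integral of \<open>M * exp (- \<delta> * s) * norm mean_immigration\<close> over all
  \<open>s \<ge> 0\<close>.\<close>

definition immigration_bound :: real where
  "immigration_bound = M * norm mean_immigration / \<delta>"

lemma immigration_bound_nonneg: "0 \<le> immigration_bound"
  using M_nonneg \<delta>_pos by (simp add: immigration_bound_def)

lemma phi_bound:
  assumes t: "0 \<le> t" and u: "u \<in> psd"
  shows "\<phi> t u \<le> norm u * immigration_bound"
proof -
  let ?c = "norm u * immigration_bound"
  \<comment> \<open>The added term has derivative minus the bound on the derivative of
    \<open>\<phi>\<close>, so \<open>k\<close> stays below its initial value
    \<open>?c\<close>.\<close>
  define k where "k s = \<phi> s u + ?c * exp (- \<delta> * s)" for s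
  have "(k has_real_derivative drift_F b m (\<psi> s u) + ?c * (exp (- \<delta> * s) * - \<delta>)) (at s within {0..t})"
    if "0 \<le> s" for s
    unfolding k_def using phi_deriv[OF u that]
    by (auto intro!: derivative_eq_intros intro: has_field_derivative_subset)
  then have "\<And>s. 0 \<le> s \<Longrightarrow> s \<le> t \<Longrightarrow>
      (k has_derivative (\<lambda>h. h * (drift_F b m (\<psi> s u) + ?c * (exp (- \<delta> * s) * - \<delta>)))) (at s within {0..t})"
    by (simp add: has_field_derivative_def mult_commute_abs)
  from mvt_very_simple[OF t this] obtain s where s: "s \<in> {0..t}"
    "k t - k 0 = (t - 0) * (drift_F b m (\<psi> s u) + ?c * (exp (- \<delta> * s) * - \<delta>))"
    by blast
  have "drift_F b m (\<psi> s u) \<le> \<psi> s u \<bullet> mean_immigration"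
    using s u by (intro drift_F_le flow_psd) auto
  also have "\<dots> \<le> norm u * (M * exp (- \<delta> * s) * norm mean_immigration)"
    using s u by (intro flow_bound mean_immigration_psd) auto
  also have "\<dots> = ?c * (exp (- \<delta> * s) * \<delta>)"
    using \<delta>_pos by (simp add: immigration_bound_def)
  finally have "k t - k 0 \<le> 0"
    unfolding s(2) using t by (intro mult_nonneg_nonpos) auto
  moreover have "k 0 = ?c"
    by (simp add: k_def phi_0[OF u])
  moreover have "0 \<le> ?c * exp (- \<delta> * t)"
    using immigration_bound_nonneg by simp
  ultimately show ?thesis
    by (simp add: k_def)
qed

lemma
  assumes "0 \<le> t" "x \<in> psd"
  shows prob_kernel: "prob_space (p t x)" and sets_kernel: "sets (p t x) = sets psd_space"
proof -
  have "p t \<in> psd_space \<rightarrow>\<^sub>M prob_algebra psd_space"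
    using semigroup assms(1) by (simp add: transition_semigroup_def)
  from measurable_space[OF this, of x] show "prob_space (p t x)" "sets (p t x) = sets psd_space"
    using assms(2) by (simp_all add: space_prob_algebra space_restrict_space)
qed

text \<open>The part of the law at time \<open>t\<close> that stems from the initial distribution, without immigration.\<close>

lemma branching_factor:
  fixes \<rho> :: "'d sym_matrix measure"
  assumes t: "0 \<le> t" and \<rho>: "prob_space \<rho>" "sets \<rho> = sets psd_space" "integrable \<rho> norm"
  obtains q where "prob_space q" "sets q = sets psd_space"
    "\<And>u. u \<in> psd \<Longrightarrow> laplace_transform q u = laplace_transform \<rho> (\<psi> t u)"
    "(\<integral>\<^sup>+\<xi>. ennreal (norm \<xi>) \<partial>q)
      \<le> ennreal (sqrt (real CARD('d)) * (M * exp (- \<delta> * t) * (\<integral>\<xi>. norm \<xi> \<partial>\<rho>)))"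
proof -
  interpret prob_space \<rho> by (rule \<rho>(1))
  have space: "space \<rho> = psd"
    by (rule space_psd_measure[OF \<rho>(2)])
  define L where "L u = laplace_transform \<rho> (\<psi> t u)" for u
  define c where "c = M * exp (- \<delta> * t) * (\<integral>\<xi>. norm \<xi> \<partial>\<rho>)"
  have int: "integrable \<rho> (\<lambda>\<xi>. exp (- (\<psi> t u \<bullet> \<xi>)))" if "u \<in> psd" for u
    using integrable_exp_psd[OF \<rho>(1,2) flow_psd[OF that t]] by (simp add: inner_commute)
  \<comment> \<open>This bound is used twice: at small \<open>u\<close> it shows that
    \<open>L\<close> tends to 1, and along multiples of the identity it gives the first
    moment.\<close>
  have lower: "1 - L u \<le> norm u * c" if u: "u \<in> psd" for u
  proof -
    have "1 - L u = (\<integral>\<xi>. 1 - exp (- (\<psi> t u \<bullet> \<xi>)) \<partial>\<rho>)"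
      unfolding L_def by (subst Bochner_Integration.integral_diff[OF integrable_const int[OF u]]) (simp add: prob_space)
    also have "\<dots> \<le> (\<integral>\<xi>. norm u * (M * exp (- \<delta> * t)) * norm \<xi> \<partial>\<rho>)"
    proof (rule integral_mono)
      show "integrable \<rho> (\<lambda>\<xi>. 1 - exp (- (\<psi> t u \<bullet> \<xi>)))"
        by (intro Bochner_Integration.integrable_diff integrable_const int u)
      show "integrable \<rho> (\<lambda>\<xi>. norm u * (M * exp (- \<delta> * t)) * norm \<xi>)"
        using \<rho>(3) by simp
      fix \<xi>
      assume "\<xi> \<in> space \<rho>"
      then show "1 - exp (- (\<psi> t u \<bullet> \<xi>)) \<le> norm u * (M * exp (- \<delta> * t)) * norm \<xi>"
        using flow_bound[OF t u, of \<xi>] exp_ge_add_one_self[of "- (\<psi> t u \<bullet> \<xi>)"] by (simp add: space mult.assoc)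
    qed
    finally show ?thesis
      by (simp add: c_def mult.assoc)
  qed
  have upper: "L u \<le> 1" if u: "u \<in> psd" for u
    unfolding L_def using flow_nonneg[OF t u] by (intro integral_le_const int u AE_I2) (simp add: space)
  have "laplace_limit L"
    unfolding L_def
    by (rule laplace_limit_mixture[OF \<rho>(1,2) flow_psd[OF _ t]
          laplace_limit_flow[OF t]])
  moreover have "L 0 = 1"
    using lower[OF psd_0] upper[OF psd_0] by simp
  moreover have "(\<lambda>k. L ((1 / real (Suc k)) *\<^sub>R u)) \<longlonglongrightarrow> 1" if u: "u \<in> psd" for u
  proof (rule tendsto_sandwich)
    have "1 - norm u * c * inverse (real (Suc k)) \<le> L ((1 / real (Suc k)) *\<^sub>R u)" for k
      using lower[OF psd_scaleR[OF u], of "1 / real (Suc k)"] by (simp add: divide_inverse algebra_simps)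
    then show "\<forall>\<^sub>F k in sequentially. 1 - norm u * c * inverse (real (Suc k)) \<le> L ((1 / real (Suc k)) *\<^sub>R u)"
      by (intro always_eventually allI)
    show "\<forall>\<^sub>F k in sequentially. L ((1 / real (Suc k)) *\<^sub>R u) \<le> 1"
      using upper[OF psd_scaleR[OF u]] by (intro always_eventually) simp
    show "(\<lambda>k. 1 - norm u * c * inverse (real (Suc k))) \<longlonglongrightarrow> 1"
      using tendsto_diff[OF tendsto_const tendsto_mult_right_zero[OF LIMSEQ_inverse_real_of_nat], of 1 "norm u * c"]
      by simp
  qed simp
  ultimately obtain q where q: "prob_space q" "sets q = sets psd_space"
    "\<And>u. u \<in> psd \<Longrightarrow> laplace_transform q u = L u"
    by (rule laplace_representation) blast+
  \<comment> \<open>The norm of the identity enters here and becomes the factor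
    \<open>sqrt d\<close>.\<close>
  have "(\<integral>\<^sup>+\<xi>. ennreal (norm \<xi>) \<partial>q) \<le> ennreal (norm (sym_one :: 'd sym_matrix) * c)"
  proof (rule first_moment_from_laplace[OF q(1,2)])
    fix k
    let ?u = "(1 / real (Suc k)) *\<^sub>R sym_one :: 'd sym_matrix"
    have u: "?u \<in> psd"
      by (simp add: psd_scaleR)
    show "1 - laplace_transform q ?u \<le> norm (sym_one :: 'd sym_matrix) * c / real (Suc k)"
      unfolding q(3)[OF u] using lower[OF u] by simp
  qed
  then show ?thesis
    using that[OF q(1,2)] q(3) by (simp add: L_def norm_sym_one c_def)
qed

section \<open>The invariant distribution\<close>

context
  fixes \<pi> :: "'d sym_matrix measure"
  assumes invariant: "invariant_distribution p \<pi>"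
begin

lemma prob_invariant: "prob_space \<pi>" and sets_invariant: "sets \<pi> = sets psd_space"
  using invariant by (auto simp: invariant_distribution_def)

lemma invariant_laplace:
  assumes t: "0 \<le> t" and u: "u \<in> psd"
  shows "laplace_transform \<pi> u = exp (- \<phi> t u) * laplace_transform \<pi> (\<psi> t u)"
proof -
  have meas: "(\<lambda>\<xi>. ennreal (exp (- (v \<bullet> \<xi>)))) \<in> borel_measurable psd_space" for v :: "'d sym_matrix"
    by (intro measurable_restrict_space1) measurable
  have "p t \<in> \<pi> \<rightarrow>\<^sub>M subprob_algebra psd_space"
    using semigroup t unfolding measurable_cong_sets[OF sets_invariant refl]
    by (auto simp: transition_semigroup_def intro: measurable_prob_algebraD)
  from nn_integral_bind[OF meas this, of u]
  have "(\<integral>\<^sup>+\<xi>. ennreal (exp (- (u \<bullet> \<xi>))) \<partial>\<pi>) = (\<integral>\<^sup>+y. \<integral>\<^sup>+\<xi>. ennreal (exp (- (u \<bullet> \<xi>))) \<partial>p t y \<partial>\<pi>)"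
    using invariant t by (simp add: invariant_distribution_def)
  also have "\<dots> = (\<integral>\<^sup>+y. ennreal (exp (- \<phi> t u)) * ennreal (exp (- (\<psi> t u \<bullet> y))) \<partial>\<pi>)"
  proof (rule nn_integral_cong)
    fix y
    assume "y \<in> space \<pi>"
    then have y: "y \<in> psd"
      by (simp add: space_psd_measure[OF sets_invariant])
    show "(\<integral>\<^sup>+\<xi>. ennreal (exp (- (u \<bullet> \<xi>))) \<partial>p t y) = ennreal (exp (- \<phi> t u)) * ennreal (exp (- (\<psi> t u \<bullet> y)))"
      unfolding nn_laplace_transform[OF prob_kernel[OF t y] sets_kernel[OF t y] u] laplace[OF t y u]
      by (simp flip: ennreal_mult exp_add)
  qed
  also have "\<dots> = ennreal (exp (- \<phi> t u)) * (\<integral>\<^sup>+y. ennreal (exp (- (\<psi> t u \<bullet> y))) \<partial>\<pi>)"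
    using meas by (intro nn_integral_cmult) (simp add: measurable_cong_sets[OF sets_invariant refl])
  finally show ?thesis
    by (simp add: nn_laplace_transform[OF prob_invariant sets_invariant] u flow_psd t flip: ennreal_mult)
qed

text \<open>Let \<open>t\<close> tend to infinity in \<open>invariant_laplace\<close>: the flow
  tends to 0, so the second factor tends to 1, while \<open>phi_bound\<close> controls the first
  uniformly in \<open>t\<close>.\<close>

lemma invariant_laplace_lower_bound:
  assumes u: "u \<in> psd"
  shows "exp (- (norm u * immigration_bound)) \<le> laplace_transform \<pi> u"
proof -
  interpret prob_space \<pi> by (rule prob_invariant)
  have space: "space \<pi> = psd"
    by (rule space_psd_measure[OF sets_invariant])
  have "(\<lambda>n. \<integral>\<xi>. exp (- (\<psi> (real n) u \<bullet> \<xi>)) \<partial>\<pi>) \<longlonglongrightarrow> (\<integral>\<xi>. 1 \<partial>\<pi>)"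
  proof (rule integral_dominated_convergence[where w = "\<lambda>_. 1"])
    show "(\<lambda>\<xi>. exp (- (\<psi> (real n) u \<bullet> \<xi>))) \<in> borel_measurable \<pi>" for n
      by (rule borel_measurable_psd_measure[OF sets_invariant]) measurable
    show "AE \<xi> in \<pi>. norm (exp (- (\<psi> (real n) u \<bullet> \<xi>))) \<le> 1" for n
      using flow_nonneg[OF _ u] by (intro AE_I2) (simp add: space)
    show "AE \<xi> in \<pi>. (\<lambda>n. exp (- (\<psi> (real n) u \<bullet> \<xi>))) \<longlonglongrightarrow> 1"
    proof (rule AE_I2)
      fix \<xi>
      assume "\<xi> \<in> space \<pi>"
      then have \<xi>: "\<xi> \<in> psd"
        by (simp add: space)
      have "(\<lambda>n. \<psi> (real n) u \<bullet> \<xi>) \<longlonglongrightarrow> 0"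
      proof (rule tendsto_sandwich)
        show "\<forall>\<^sub>F n in sequentially. 0 \<le> \<psi> (real n) u \<bullet> \<xi>"
          using flow_nonneg[OF _ u \<xi>] by simp
        show "\<forall>\<^sub>F n in sequentially. \<psi> (real n) u \<bullet> \<xi> \<le> norm u * M * norm \<xi> * exp (- \<delta>) ^ n"
        proof (intro always_eventually allI)
          fix n
          show "\<psi> (real n) u \<bullet> \<xi> \<le> norm u * M * norm \<xi> * exp (- \<delta>) ^ n"
            using flow_bound[OF of_nat_0_le_iff u \<xi>, of n] by (simp add: exp_of_nat_mult[symmetric] mult_ac)
        qed
        show "(\<lambda>n. norm u * M * norm \<xi> * exp (- \<delta>) ^ n) \<longlonglongrightarrow> 0"
          using \<delta>_pos by (intro tendsto_mult_right_zero LIMSEQ_power_zero) simp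
      qed simp
      from tendsto_exp[OF tendsto_minus[OF this]] show "(\<lambda>n. exp (- (\<psi> (real n) u \<bullet> \<xi>))) \<longlonglongrightarrow> 1"
        by simp
    qed
  qed auto
  then have "(\<lambda>n. exp (- (norm u * immigration_bound)) * laplace_transform \<pi> (\<psi> (real n) u))
      \<longlonglongrightarrow> exp (- (norm u * immigration_bound)) * 1"
    by (intro tendsto_mult tendsto_const) (simp add: prob_space)
  moreover have "exp (- (norm u * immigration_bound)) * laplace_transform \<pi> (\<psi> (real n) u)
      \<le> laplace_transform \<pi> u" for n
    unfolding invariant_laplace[OF of_nat_0_le_iff u, of n]
    using phi_bound[OF _ u, of "real n"] by (intro mult_right_mono) (auto intro: integral_nonneg_AE)
  ultimately show ?thesis
    by (intro LIMSEQ_le_const2) auto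
qed

text \<open>By \<open>exp (- z) \<ge> 1 - z\<close> the preceding lower bound is linear in
  \<open>u\<close>, which is the form that yields a first moment. \<open>branching_factor\<close>
  can then be applied to \<open>\<pi>\<close>.\<close>

lemma integrable_norm_invariant: "integrable \<pi> norm"
proof -
  have "(\<integral>\<^sup>+\<xi>. ennreal (norm \<xi>) \<partial>\<pi>) \<le> ennreal (norm (sym_one :: 'd sym_matrix) * immigration_bound)"
  proof (rule first_moment_from_laplace[OF prob_invariant sets_invariant])
    fix k
    let ?u = "(1 / real (Suc k)) *\<^sub>R sym_one :: 'd sym_matrix"
    have "?u \<in> psd"
      by (simp add: psd_scaleR)
    from invariant_laplace_lower_bound[OF this] exp_ge_add_one_self[of "- (norm ?u * immigration_bound)"]
    have "1 - laplace_transform \<pi> ?u \<le> norm ?u * immigration_bound"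
      by linarith
    then show "1 - laplace_transform \<pi> ?u \<le> norm (sym_one :: 'd sym_matrix) * immigration_bound / real (Suc k)"
      by simp
  qed
  also have "\<dots> < \<infinity>"
    by simp
  finally show ?thesis
    by (simp add: integrable_iff_bounded borel_measurable_psd_measure[OF sets_invariant])
qed

theorem wasserstein1_kernel_invariant:
  assumes t: "0 \<le> t" and x: "x \<in> psd"
  shows "wasserstein1 (p t x) \<pi>
    \<le> ennreal (sqrt (real CARD('d)) * M * exp (- \<delta> * t) * (norm x + (\<integral>y. norm y \<partial>\<pi>)))"
proof -
  \<comment> \<open>A point mass as initial distribution makes the part of \<open>p t x\<close>
    without immigration another case of \<open>branching_factor\<close>.\<close>
  have return_x: "prob_space (return psd_space x)" "sets (return psd_space x) = sets psd_space"
    "integrable (return psd_space x) norm" "integral\<^sup>L (return psd_space x) norm = norm x"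
    "laplace_transform (return psd_space x) v = exp (- (v \<bullet> x))" for v
    using x by (auto simp: prob_space_return space_restrict_space integrable_iff_bounded nn_integral_return
        integral_return measurable_restrict_space1)
  obtain q where q: "prob_space q" "sets q = sets psd_space"
    "\<And>u. u \<in> psd \<Longrightarrow> laplace_transform q u = laplace_transform (return psd_space x) (\<psi> t u)"
    "(\<integral>\<^sup>+\<xi>. ennreal (norm \<xi>) \<partial>q)
      \<le> ennreal (sqrt (real CARD('d)) * (M * exp (- \<delta> * t) * (\<integral>\<xi>. norm \<xi> \<partial>return psd_space x)))"
    by (rule branching_factor[OF t return_x(1-3)]) blast
  obtain q' where q': "prob_space q'" "sets q' = sets psd_space"
    "\<And>u. u \<in> psd \<Longrightarrow> laplace_transform q' u = laplace_transform \<pi> (\<psi> t u)"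
    "(\<integral>\<^sup>+\<xi>. ennreal (norm \<xi>) \<partial>q')
      \<le> ennreal (sqrt (real CARD('d)) * (M * exp (- \<delta> * t) * (\<integral>\<xi>. norm \<xi> \<partial>\<pi>)))"
    by (rule branching_factor[OF t prob_invariant sets_invariant integrable_norm_invariant]) blast
  \<comment> \<open>The process started at 0 consists of immigration alone; its law is the summand
    shared by \<open>p t x\<close> and \<open>\<pi>\<close>.\<close>
  have r: "laplace_transform (p t 0) u = exp (- \<phi> t u)" if "u \<in> psd" for u
    using laplace[OF t psd_0 that] by simp
  have "wasserstein1 (p t x) \<pi> \<le> (\<integral>\<^sup>+\<xi>. ennreal (norm \<xi>) \<partial>q) + (\<integral>\<^sup>+\<xi>. ennreal (norm \<xi>) \<partial>q')"
  proof (rule wasserstein1_common_factor[OF prob_kernel[OF t psd_0] sets_kernel[OF t psd_0] q(1,2) q'(1,2)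
        prob_kernel[OF t x] sets_kernel[OF t x] prob_invariant sets_invariant])
    fix u :: "'d sym_matrix"
    assume u: "u \<in> psd"
    show "laplace_transform (p t x) u = laplace_transform (p t 0) u * laplace_transform q u"
      by (simp add: laplace[OF t x u] r[OF u] q(3)[OF u] return_x(5) flip: exp_add)
    show "laplace_transform \<pi> u = laplace_transform (p t 0) u * laplace_transform q' u"
      by (simp add: invariant_laplace[OF t u] r[OF u] q'(3)[OF u])
  qed
  also have "\<dots> \<le> ennreal (sqrt (real CARD('d)) * (M * exp (- \<delta> * t) * norm x))
      + ennreal (sqrt (real CARD('d)) * (M * exp (- \<delta> * t) * (\<integral>\<xi>. norm \<xi> \<partial>\<pi>)))"
    using q(4) q'(4) unfolding return_x(4) by (rule add_mono)
  also have "\<dots> = ennreal (sqrt (real CARD('d)) * M * exp (- \<delta> * t) * (norm x + (\<integral>y. norm y \<partial>\<pi>)))"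
    using M_nonneg by (simp add: algebra_simps flip: ennreal_plus)
  finally show ?thesis .
qed

end

end

theorem theorem2p9:
  fixes \<alpha> b x :: "('d::finite) sym_matrix"
    and B :: "'d sym_matrix \<Rightarrow> 'd sym_matrix"
    and m \<pi> :: "'d sym_matrix measure"
    and \<mu> :: "'d sym_matrix set \<Rightarrow> 'd sym_matrix"
    and p :: "real \<Rightarrow> 'd sym_matrix \<Rightarrow> 'd sym_matrix measure"
    and M \<delta> t :: real
  assumes "CARD('d) \<ge> 2"
    and "admissible \<alpha> b B m \<mu>"
    and "affine_kernel \<alpha> b B m \<mu> p"
    and "subcritical B \<mu>"
    and "(\<integral>\<^sup>+\<xi>\<in>{\<xi>. norm \<xi> > 1}. ennreal (norm \<xi>) \<partial>m) < \<infinity>"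
    and "invariant_distribution p \<pi>"
    and "M \<ge> 1" and "\<delta> > 0"
    and "\<And>s. s \<ge> 0 \<Longrightarrow>
           onorm (exp_map (\<lambda>y. s *\<^sub>R effective_drift B \<mu> y)) \<le> M * exp (- \<delta> * s)"
    and "\<alpha> = 0"
    and "t \<ge> 0" and "x \<in> psd"
  shows "wasserstein1 (p t x) \<pi>
           \<le> ennreal (sqrt (real CARD('d)) * M * exp (- \<delta> * t) * (norm x + (\<integral>y. norm y \<partial>\<pi>)))"
proof -
  obtain \<phi> \<psi> where riccati: "riccati_solution 0 b B m \<mu> \<phi> \<psi>"
    and laplace: "\<And>t x u. 0 \<le> t \<Longrightarrow> x \<in> psd \<Longrightarrow> u \<in> psd \<Longrightarrow>
      laplace_transform (p t x) u = exp (- \<phi> t u - \<psi> t u \<bullet> x)"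
    using \<open>affine_kernel \<alpha> b B m \<mu> p\<close> \<open>\<alpha> = 0\<close> unfolding affine_kernel_def by blast
  have semigroup: "transition_semigroup p"
    using \<open>affine_kernel \<alpha> b B m \<mu> p\<close> by (simp add: affine_kernel_def)
  have adm: "linear B" "quasi_monotone B" "psd_measure \<mu>"
    "signed_integrable (\<lambda>A. trace (mat_of (\<mu> A))) norm"
    "b \<in> psd" "sets m = sets jump_space" "(\<integral>\<^sup>+\<xi>. ennreal (min (norm \<xi>) 1) \<partial>m) < \<infinity>"
    using \<open>admissible \<alpha> b B m \<mu>\<close> unfolding admissible_def quasi_monotone_def by blast+
  have "0 \<le> M"
    using \<open>M \<ge> 1\<close> by simp
  note sol = riccati[unfolded riccati_solution_def, rule_format]
  interpret affine_without_diffusion \<mu> B \<psi> b m \<phi> p M \<delta>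
    by (intro affine_without_diffusion.intro riccati_flow.intro riccati_generator.intro jump_kernel.intro
        affine_without_diffusion_axioms.intro riccati_flow_axioms.intro riccati_generator_axioms.intro)
      (fact adm laplace semigroup \<open>0 \<le> M\<close> assms | use sol in blast)+
  show ?thesis
    by (rule wasserstein1_kernel_invariant[OF \<open>invariant_distribution p \<pi>\<close> \<open>t \<ge> 0\<close> \<open>x \<in> psd\<close>])
qed

end
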